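(* Let $\alpha>0$. Then: (1) $\mathcal{L}\circ\mathcal{C}_\alpha^*=\mathfrak{C}_\alpha\circ\mathcal{L}$ on $L_p(\mathbb{R}^+)$ for $1\le p\le 2$. (2) $\mathcal{L}\circ\mathcal{C}_\alpha=\mathfrak{C}_\alpha^*\circ\mathcal{L}$ on $L_q(\mathbb{R}^+)$ for $1<q\le 2$.
   Context: $\mathbb{R}^+=(0,\infty)$, $\mathbb{C}^+=\{z\in\mathbb{C}:\Re z>0\}$, $\mathcal{L}f(z)=\int_0^\infty f(t)e^{-zt}\,dt$ for $z\in\mathbb{C}^+$. Real operators: $\mathcal{C}_\alpha f(s)=\frac{\alpha}{s^\alpha}\int_0^s(s-u)^{\alpha-1}f(u)\,du$ (bounded on $L_r(\mathbb{R}^+)$, $1<r\le\infty$), and $\mathcal{C}_\alpha^*f(s)=\alpha\int_s^\infty\frac{(u-s)^{\alpha-1}}{u^\alpha}f(u)\,du$ (bounded on $L_r(\mathbb{R}^+)$, $1\le r<\infty$). Complex operators: for $1\le r<\infty$, $H_r(\mathbb{C}^+)$ is the Hardy space of holomorphic $F$ on $\mathbb{C}^+$ with $\|F\|_r:=\sup_{x>0}\left(\frac{1}{2\pi}\int_{-\infty}^\infty|F(x+iy)|^r\,dy\right)^{1/r}<\infty$; for $r=\infty$ one uses instead the Banach space $\mathcal{A}_0(\mathbb{C}^+)$ of holomorphic functions on $\mathbb{C}^+$ extending continuously to $\overline{\mathbb{C}^+}$ and vanishing at infinity (sup norm). For $1\le r\le\infty$ and $t\in\mathbb{R}$, $T_r(t)F(z)=e^{-t/r}F(e^{-t}z)$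 (with $t/\infty=0$), a strongly continuous group of isometries. Put $\varphi_{\alpha,r}(t)=\alpha(1-e^{-t})^{\alpha-1}e^{-t/r}$, $t>0$. For conjugate exponents $1/r+1/r'=1$, $1\le r<\infty$, and $F\in H_r(\mathbb{C}^+)$, $G\in H_{r'}(\mathbb{C}^+)$ ($G\in\mathcal{A}_0(\mathbb{C}^+)$ if $r'=\infty$), define the Bochner integrals $$\mathfrak{C}_\alpha^*F=\int_0^\infty\varphi_{\alpha,r}(t)\,T_r(-t)F\,dt,\qquad\mathfrak{C}_\alpha G=\int_0^\infty\varphi_{\alpha,r}(t)\,T_{r'}(t)G\,dt.$$ For $1\le p\le 2$ and $1/p+1/q=1$, $\mathcal{L}$ maps $L_p(\mathbb{R}^+)$ into $H_q(\mathbb{C}^+)$ (into $\mathcal{A}_0(\mathbb{C}^+)$ if $p=1$), so that in (1) $\mathfrak{C}_\alpha$ acts on the space with exponent conjugate to $p$, and in (2) $\mathfrak{C}_\alpha^*$ acts on the space with exponent conjugate to $q$. *)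

theory Defs
  imports "HOL-Complex_Analysis.Complex_Analysis"
begin

text \<open>Exponents range over \<open>[1, \<infinity>]\<close> and are of type \<^typ>\<open>ennreal\<close>; since \<open>1 / \<infinity> = 0\<close> there,
  \<open>enn2real (1 / r)\<close> is the real number \<open>1/r\<close> with the convention \<open>1/\<infinity> = 0\<close>.\<close>

text \<open>Elements of \<open>L\<^sub>p(\<real>\<^sup>+)\<close> are represented by functions on \<open>\<real>\<close>, whose values outside
  \<open>(0, \<infinity>)\<close> are irrelevant.\<close>

definition Lp :: "ennreal \<Rightarrow> (real \<Rightarrow> complex) set" where
  "Lp p = {f \<in> borel_measurable (lebesgue_on {0<..}).
     if p = \<infinity> then \<exists>C. AE t in lebesgue_on {0<..}. norm (f t) \<le> C
     else integrable (lebesgue_on {0<..}) (\<lambda>t. norm (f t) powr enn2real p)}"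

definition cesaro :: "real \<Rightarrow> (real \<Rightarrow> complex) \<Rightarrow> real \<Rightarrow> complex" where
  "cesaro \<alpha> f s =
     (\<alpha> / s powr \<alpha>) *\<^sub>R (LINT u:{0<..<s}|lebesgue. (s - u) powr (\<alpha> - 1) *\<^sub>R f u)"

definition cesaro_adj :: "real \<Rightarrow> (real \<Rightarrow> complex) \<Rightarrow> real \<Rightarrow> complex" where
  "cesaro_adj \<alpha> f s =
     \<alpha> *\<^sub>R (LINT u:{s<..}|lebesgue. ((u - s) powr (\<alpha> - 1) / u powr \<alpha>) *\<^sub>R f u)"

text \<open>A function on the open right half-plane is represented by its extension by \<open>0\<close> to
  \<open>\<complex>\<close>, so that equality of functions on the half-plane is equality in HOL.\<close>

definition right_half_plane :: "complex set" where
  "right_half_plane = {z. Re z > 0}"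

definition laplace :: "(real \<Rightarrow> complex) \<Rightarrow> complex \<Rightarrow> complex" where
  "laplace f z = (if z \<in> right_half_plane
     then LINT t:{0<..}|lebesgue. f t * exp (- z * complex_of_real t) else 0)"

definition holomorphic_rhp :: "(complex \<Rightarrow> complex) set" where
  "holomorphic_rhp =
     {F. F holomorphic_on right_half_plane \<and> (\<forall>z. z \<notin> right_half_plane \<longrightarrow> F z = 0)}"

definition hardy_mean :: "real \<Rightarrow> (complex \<Rightarrow> complex) \<Rightarrow> real \<Rightarrow> real" where
  "hardy_mean r F x =
     (1 / (2 * pi) * (LINT y|lborel. norm (F (Complex x y)) powr r)) powr (1 / r)"

definition A0 :: "(complex \<Rightarrow> complex) set" where
  "A0 = {F \<in> holomorphic_rhp. \<exists>G.
     continuous_on {z. Re z \<ge> 0} G \<and> (\<forall>z\<in>right_half_plane. G z = F z) \<and>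
     (G \<longlongrightarrow> 0) (inf at_infinity (principal {z. Re z \<ge> 0}))}"

definition hardy_space :: "ennreal \<Rightarrow> (complex \<Rightarrow> complex) set" where
  "hardy_space r = (if r = \<infinity> then A0 else
     {F \<in> holomorphic_rhp.
        (\<forall>x>0. integrable lborel (\<lambda>y. norm (F (Complex x y)) powr enn2real r)) \<and>
        bdd_above (hardy_mean (enn2real r) F ` {0<..})})"

definition hardy_norm :: "ennreal \<Rightarrow> (complex \<Rightarrow> complex) \<Rightarrow> real" where
  "hardy_norm r F = (if r = \<infinity> then SUP z\<in>right_half_plane. norm (F z)
     else SUP x\<in>{0<..}. hardy_mean (enn2real r) F x)"

text \<open>The library's Bochner integral is tied to a type of class \<^class>\<open>banach\<close>, but the Hardy
  spaces depend on the exponent. The following is the usual Bochner integral for functions with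
  values in a space \<open>V\<close> of functions, with pointwise operations and an explicit norm \<open>N\<close>: the
  integrand is approximated almost everywhere and in \<open>L\<^sub>1\<close>-norm by \<open>V\<close>-valued integrable simple
  functions.\<close>

definition simple_integrable_in ::
    "('b \<Rightarrow> 'c::real_vector) set \<Rightarrow> 'a measure \<Rightarrow> ('a \<Rightarrow> 'b \<Rightarrow> 'c) \<Rightarrow> bool" where
  "simple_integrable_in V M s \<longleftrightarrow> simple_function M s \<and> s ` space M \<subseteq> V \<and>
     emeasure M {t \<in> space M. s t \<noteq> (\<lambda>z. 0)} \<noteq> \<infinity>"

definition simple_integral_in ::
    "'a measure \<Rightarrow> ('a \<Rightarrow> 'b \<Rightarrow> 'c::real_vector) \<Rightarrow> 'b \<Rightarrow> 'c" where
  "simple_integral_in M s =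
     (\<lambda>z. \<Sum>F\<in>s ` space M. measure M {t \<in> space M. s t = F} *\<^sub>R F z)"

definition has_bochner_integral_in ::
    "('b \<Rightarrow> 'c::real_vector) set \<Rightarrow> (('b \<Rightarrow> 'c) \<Rightarrow> real) \<Rightarrow> 'a measure \<Rightarrow> ('a \<Rightarrow> 'b \<Rightarrow> 'c) \<Rightarrow> ('b \<Rightarrow> 'c) \<Rightarrow> bool"
  where
  "has_bochner_integral_in V N M g I \<longleftrightarrow> g ` space M \<subseteq> V \<and> I \<in> V \<and>
     (\<exists>s. (\<forall>n. simple_integrable_in V M (s n)) \<and>
        (AE t in M. (\<lambda>n::nat. N (\<lambda>z. g t z - s n t z)) \<longlonglongrightarrow> 0) \<and>
        (\<lambda>n. \<integral>\<^sup>+ t. ennreal (N (\<lambda>z. g t z - s n t z)) \<partial>M) \<longlonglongrightarrow> 0 \<and>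
        (\<lambda>n. N (\<lambda>z. I z - simple_integral_in M (s n) z)) \<longlonglongrightarrow> 0)"

definition bochner_integral_in ::
    "('b \<Rightarrow> 'c::real_vector) set \<Rightarrow> (('b \<Rightarrow> 'c) \<Rightarrow> real) \<Rightarrow> 'a measure \<Rightarrow> ('a \<Rightarrow> 'b \<Rightarrow> 'c) \<Rightarrow> 'b \<Rightarrow> 'c"
  where "bochner_integral_in V N M g = (THE I. has_bochner_integral_in V N M g I)"

definition dilation :: "ennreal \<Rightarrow> real \<Rightarrow> (complex \<Rightarrow> complex) \<Rightarrow> complex \<Rightarrow> complex" where
  "dilation r t F z = exp (- t * enn2real (1 / r)) *\<^sub>R F (exp (- t) *\<^sub>R z)"

definition phi :: "real \<Rightarrow> ennreal \<Rightarrow> real \<Rightarrow> real" where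
  "phi \<alpha> r t = \<alpha> * (1 - exp (- t)) powr (\<alpha> - 1) * exp (- t * enn2real (1 / r))"

definition cesaro_hardy_adj ::
    "real \<Rightarrow> ennreal \<Rightarrow> (complex \<Rightarrow> complex) \<Rightarrow> complex \<Rightarrow> complex" where
  "cesaro_hardy_adj \<alpha> r F = bochner_integral_in (hardy_space r) (hardy_norm r)
     (lebesgue_on {0<..}) (\<lambda>t z. phi \<alpha> r t *\<^sub>R dilation r (- t) F z)"

text \<open>Here \<open>r\<close> and \<open>r'\<close> are conjugate exponents; the operator acts on the space of exponent
  \<open>r'\<close>, while \<open>r\<close> enters through the weight.\<close>

definition cesaro_hardy ::
    "real \<Rightarrow> ennreal \<Rightarrow> ennreal \<Rightarrow> (complex \<Rightarrow> complex) \<Rightarrow> complex \<Rightarrow> complex" where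
  "cesaro_hardy \<alpha> r r' G = bochner_integral_in (hardy_space r') (hardy_norm r')
     (lebesgue_on {0<..}) (\<lambda>t z. phi \<alpha> r t *\<^sub>R dilation r' t G z)"

end

theory Submission
  imports Defs "HOL-Probability.Probability"
begin

text \<open>On functions of a half-line variable both Cesaro operators are averages of dilations: with
  \<open>u = s e\<^sup>\<plusminus>\<^sup>t\<close> one gets \<open>\<integral> \<phi>(t) U\<^sub>\<plusminus>\<^sub>t f dt\<close>, where the \<open>U\<^sub>\<tau>\<close> are isometric dilations of \<open>L\<^sub>p\<close>, and the Laplace
  transform carries \<open>U\<^sub>\<tau>\<close> to the dilation group of the Hardy space. So everything reduces to
  moving the Laplace transform through a Bochner integral, i.e. to its boundedness from \<open>L\<^sub>p\<close> to
  \<open>H\<^sub>q\<close> and to strong continuity of \<open>U\<close> on \<open>L\<^sub>p\<close>. Boundedness is the Hausdorff--Young inequality on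
  vertical lines; since its constant is irrelevant, Marcinkiewicz interpolation between the trivial
  bound and an \<open>L\<^sub>2\<close> bound (by Gaussian summation) suffices. For \<open>p = 1\<close> the target is \<open>A\<^sub>0\<close>, by the
  Riemann--Lebesgue lemma on the closed half-plane. The Bochner integral is unique because the
  integrals over vertical segments are bounded functionals separating the points of \<open>H\<^sub>q\<close>.\<close>

section \<open>The Hausdorff--Young inequality\<close>

text \<open>On a line Re z = x > 0 the damping makes exp(-xt) f(t) absolutely integrable, so each
  transform met here is a convergent integral and Hausdorff-Young is wanted only on L_1 intersected
  with L_a; what matters is that its constant is independent of x. The Hardy-side operators are
  definite descriptions, so existence and uniqueness of the Bochner integral must both be proved.
  Existence is settled inside L_a: the weight is approximated from below by simple functions
  supported in (0, n], the dilation parameter is rounded to a grid of mesh 1/(n+1), and, as the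
  dilations form a group of isometries, the rounding error is governed by continuity at the identity
  alone. The Laplace transform then carries these estimates over through its bound. Uniqueness goes
  through scalar functionals because the norm of the error need not be measurable in t. Since
  constants are irrelevant, a-th powers of norms with a crude triangle inequality take the place of
  norms, and |x| <= 1 + |x|^a takes the place of Hoelder's inequality in the integrability
  proofs.\<close>

lemma norm_integral_le_nn_integral:
  fixes f :: "'a \<Rightarrow> 'b::{banach, second_countable_topology}"
  shows "ennreal (norm (integral\<^sup>L M f)) \<le> (\<integral>\<^sup>+ x. ennreal (norm (f x)) \<partial>M)"
  by (cases "integrable M f") (auto simp: not_integrable_integral_eq intro: integral_norm_bound_ennreal)

section \<open>Fourier integrals and their L2 bound\<close>

definition fourier :: "(real \<Rightarrow> complex) \<Rightarrow> real \<Rightarrow> complex" where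
  "fourier h y = (LINT t|lborel. iexp (- (y * t)) * h t)"

lemma iexp_integrable:
  assumes "integrable lborel h"
  shows "integrable lborel (\<lambda>t. iexp (- (y * t)) * h t)"
  by (rule Bochner_Integration.integrable_bound[OF assms])
     (use assms in \<open>auto simp: norm_mult\<close>)

lemma fourier_measurable [measurable]:
  assumes [measurable]: "h \<in> borel_measurable borel"
  shows "fourier h \<in> borel_measurable borel"
  unfolding fourier_def[abs_def] by measurable

lemma fourier_add:
  assumes "integrable lborel f" "integrable lborel g"
  shows "fourier (\<lambda>t. f t + g t) y = fourier f y + fourier g y"
  unfolding fourier_def distrib_left
  using assms by (intro Bochner_Integration.integral_add iexp_integrable)

lemma norm_fourier_le: "norm (fourier h y) \<le> (LINT t|lborel. norm (h t))"
  unfolding fourier_def by (rule order_trans[OF integral_norm_bound]) (simp add: norm_mult)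

lemma integrable_tensor:
  fixes f g :: "real \<Rightarrow> complex"
  assumes f: "integrable lborel f" and g: "integrable lborel g"
  shows "integrable (lborel \<Otimes>\<^sub>M lborel) (\<lambda>(s, t). f s * g t)"
proof (rule lborel_pair.Fubini_integrable)
  have [measurable]: "f \<in> borel_measurable borel" "g \<in> borel_measurable borel"
    using borel_measurable_integrable[OF f] borel_measurable_integrable[OF g] by auto
  show "(\<lambda>(s, t). f s * g t) \<in> borel_measurable (lborel \<Otimes>\<^sub>M lborel)" by measurable
  show "integrable lborel (\<lambda>s. LINT t|lborel. norm (case (s, t) of (s, t) \<Rightarrow> f s * g t))"
    using f by (auto simp: norm_mult)
  show "AE s in lborel. integrable lborel (\<lambda>t. case (s, t) of (s, t) \<Rightarrow> f s * g t)"
    using g by auto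
qed

text \<open>In this form v enters only through the phase v (t - s). Averaging over a normally
  distributed v therefore produces the Gaussian characteristic function, a positive kernel in t -
  s.\<close>

lemma norm_fourier_square:
  assumes h: "integrable lborel h"
  shows "complex_of_real ((norm (fourier h v))\<^sup>2)
     = integral\<^sup>L (lborel \<Otimes>\<^sub>M lborel) (\<lambda>(s, t). h s * cnj (h t) * iexp (v * (t - s)))"
proof -
  let ?f = "\<lambda>t. iexp (- (v * t)) * h t"
  have f: "integrable lborel ?f" by (rule iexp_integrable[OF h])
  have "complex_of_real ((norm (fourier h v))\<^sup>2) = fourier h v * cnj (fourier h v)"
    by (rule complex_norm_square)
  also have "\<dots> = (LINT s|lborel. ?f s) * (LINT t|lborel. cnj (?f t))"
    unfolding fourier_def by (simp del: complex_cnj_mult)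
  also have "\<dots> = (LINT s|lborel. LINT t|lborel. ?f s * cnj (?f t))"
    using f by (simp del: complex_cnj_mult)
  also have "\<dots> = integral\<^sup>L (lborel \<Otimes>\<^sub>M lborel) (\<lambda>(s, t). ?f s * cnj (?f t))"
    by (rule lborel_pair.integral_fst, rule integrable_tensor) (use f in \<open>auto simp del: complex_cnj_mult\<close>)
  also have "\<dots> = integral\<^sup>L (lborel \<Otimes>\<^sub>M lborel) (\<lambda>(s, t). h s * cnj (h t) * iexp (v * (t - s)))"
  proof (intro Bochner_Integration.integral_cong refl, clarify)
    fix s t
    have "iexp (- (v * s)) * cnj (iexp (- (v * t))) = iexp (v * (t - s))"
      by (simp add: exp_cnj exp_add[symmetric] algebra_simps)
    then show "?f s * cnj (?f t) = h s * cnj (h t) * iexp (v * (t - s))"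
      by (simp add: mult_ac)
  qed
  finally show ?thesis .
qed

lemma integral_gauss_iexp:
  "(LINT v|std_normal_distribution. iexp (v * u)) = complex_of_real (exp (- u\<^sup>2 / 2))"
  using fun_cong[OF char_std_normal_distribution, of u] by (simp add: char_def mult.commute)

text \<open>After averaging, the kernel is exp(-((t-s)/\<epsilon>)^2 / 2), which is sqrt(2 pi)
  \<epsilon> times the normal density with mean s and deviation \<epsilon>. The density has total
  mass 1 in each variable, so a Schur-type estimate bounds the quadratic form by the factor in
  front.\<close>

lemma fourier_gauss_mean:
  assumes h: "integrable lborel h" and h2: "integrable lborel (\<lambda>t. (norm (h t))\<^sup>2)" and \<epsilon>: "\<epsilon> > 0"
  shows "(LINT v|std_normal_distribution. (norm (fourier h (v / \<epsilon>)))\<^sup>2)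
     \<le> sqrt (2 * pi) * \<epsilon> * (LINT t|lborel. (norm (h t))\<^sup>2)"
proof -
  interpret P: real_distribution std_normal_distribution by (rule real_dist_normal_dist)
  interpret Q: pair_sigma_finite std_normal_distribution "lborel \<Otimes>\<^sub>M lborel :: (real \<times> real) measure"
    by unfold_locales
  have [measurable]: "h \<in> borel_measurable borel" using borel_measurable_integrable[OF h] by simp
  let ?F = "\<lambda>v (s, t). h s * cnj (h t) * iexp (v / \<epsilon> * (t - s))"
  have int1: "integrable (lborel \<Otimes>\<^sub>M lborel) (\<lambda>(s, t). h s * cnj (h t))"
    by (rule integrable_tensor) (use h in auto)
  have seteq: "sets (std_normal_distribution \<Otimes>\<^sub>M (lborel \<Otimes>\<^sub>M lborel)) = sets (borel \<Otimes>\<^sub>M (borel \<Otimes>\<^sub>M borel))"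
    by (intro sets_pair_measure_cong) auto
  have [measurable]: "cnj \<in> borel_measurable borel"
    by (intro borel_measurable_continuous_onI continuous_intros)
  have norm_F: "norm (?F v p) = norm (case p of (s, t) \<Rightarrow> h s * cnj (h t))" for v p
    by (cases p) (simp add: norm_mult)
  have int: "integrable (std_normal_distribution \<Otimes>\<^sub>M (lborel \<Otimes>\<^sub>M lborel)) (\<lambda>(v, p). ?F v p)"
  proof (rule Q.Fubini_integrable)
    show "(\<lambda>(v, p). ?F v p) \<in> borel_measurable (std_normal_distribution \<Otimes>\<^sub>M (lborel \<Otimes>\<^sub>M lborel))"
      unfolding measurable_cong_sets[OF seteq refl] by measurable
    show "integrable std_normal_distribution (\<lambda>x. LINT y|(lborel \<Otimes>\<^sub>M lborel). norm (case (x, y) of (v, p) \<Rightarrow> ?F v p))"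
      by (simp only: prod.case norm_F) simp
    show "AE x in std_normal_distribution. integrable (lborel \<Otimes>\<^sub>M lborel) (\<lambda>y. case (x, y) of (v, p) \<Rightarrow> ?F v p)"
    proof (intro AE_I2)
      fix v
      show "integrable (lborel \<Otimes>\<^sub>M lborel) (\<lambda>y. case (v, y) of (v, p) \<Rightarrow> ?F v p)"
        by (rule Bochner_Integration.integrable_bound[OF int1])
           (auto simp: case_prod_beta norm_mult)
    qed
  qed
  let ?G = "\<lambda>s t. sqrt (2 * pi) * \<epsilon> * normal_density s \<epsilon> t"
  have G: "exp (- ((t - s) / \<epsilon>)\<^sup>2 / 2) = ?G s t" for s t
    using \<epsilon> unfolding normal_density_def
    by (simp add: real_sqrt_mult field_simps power2_eq_square)
  have "complex_of_real (LINT v|std_normal_distribution. (norm (fourier h (v / \<epsilon>)))\<^sup>2)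
     = (LINT v|std_normal_distribution. integral\<^sup>L (lborel \<Otimes>\<^sub>M lborel) (?F v))"
    unfolding integral_complex_of_real[symmetric] norm_fourier_square[OF h] ..
  also have "\<dots> = (LINT p|(lborel \<Otimes>\<^sub>M lborel). LINT v|std_normal_distribution. ?F v p)"
    by (rule Q.Fubini_integral[OF int, symmetric])
  also have "\<dots> = (LINT (s, t)|(lborel \<Otimes>\<^sub>M lborel). h s * cnj (h t) * complex_of_real (?G s t))"
  proof (intro Bochner_Integration.integral_cong refl, clarify)
    fix s t
    have "(LINT v|std_normal_distribution. h s * cnj (h t) * iexp (v / \<epsilon> * (t - s)))
      = h s * cnj (h t) * (LINT v|std_normal_distribution. iexp (v * ((t - s) / \<epsilon>)))"
      by (simp add: field_simps)
    also have "\<dots> = h s * cnj (h t) * complex_of_real (?G s t)"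
      by (simp only: integral_gauss_iexp G)
    finally show "(LINT v|std_normal_distribution. h s * cnj (h t) * iexp (v / \<epsilon> * (t - s)))
      = h s * cnj (h t) * complex_of_real (?G s t)" .
  qed
  finally have eq: "complex_of_real (LINT v|std_normal_distribution. (norm (fourier h (v / \<epsilon>)))\<^sup>2) = \<dots>" .
  have sym: "normal_density s \<epsilon> t = normal_density t \<epsilon> s" for s t
    unfolding normal_density_def by (simp add: power2_commute)
  have nnG: "(\<integral>\<^sup>+ t. ennreal (?G s t) \<partial>lborel) = ennreal (sqrt (2 * pi) * \<epsilon>)" for s
    using \<epsilon> by (subst nn_integral_eq_integral) auto
  \<comment> \<open>The inequality 2xy <= x^2 + y^2 separates the two variables; in each half the
    kernel can be integrated over the variable that does not occur in h.\<close>
  have ptw: "norm (h s * cnj (h t) * complex_of_real (?G s t))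
      \<le> (norm (h s))\<^sup>2 / 2 * ?G s t + (norm (h t))\<^sup>2 / 2 * ?G s t" for s t
  proof -
    have "2 * (norm (h s) * norm (h t)) \<le> (norm (h s))\<^sup>2 + (norm (h t))\<^sup>2"
      using sum_squares_bound[of "norm (h s)" "norm (h t)"] by simp
    then have "norm (h s) * norm (h t) * ?G s t \<le> ((norm (h s))\<^sup>2 + (norm (h t))\<^sup>2) / 2 * ?G s t"
      using \<epsilon> by (intro mult_right_mono) auto
    moreover have "norm (h s * cnj (h t) * complex_of_real (?G s t)) = norm (h s) * norm (h t) * ?G s t"
      using \<epsilon> by (simp add: norm_mult)
    ultimately show ?thesis by (simp add: distrib_right add_divide_distrib)
  qed
  have half: "(\<integral>\<^sup>+ s. \<integral>\<^sup>+ t. ennreal ((norm (h s))\<^sup>2 / 2 * ?G s t) \<partial>lborel \<partial>lborel)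
      = ennreal (sqrt (2 * pi) * \<epsilon> * (LINT t|lborel. (norm (h t))\<^sup>2) / 2)"
  proof -
    have "(\<integral>\<^sup>+ s. \<integral>\<^sup>+ t. ennreal ((norm (h s))\<^sup>2 / 2 * ?G s t) \<partial>lborel \<partial>lborel)
      = (\<integral>\<^sup>+ s. ennreal ((norm (h s))\<^sup>2 / 2) * (\<integral>\<^sup>+ t. ennreal (?G s t) \<partial>lborel) \<partial>lborel)"
    proof (intro nn_integral_cong)
      fix s
      have "(\<integral>\<^sup>+ t. ennreal ((norm (h s))\<^sup>2 / 2 * ?G s t) \<partial>lborel)
          = (\<integral>\<^sup>+ t. ennreal ((norm (h s))\<^sup>2 / 2) * ennreal (?G s t) \<partial>lborel)"
        using \<epsilon> by (intro nn_integral_cong ennreal_mult) auto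
      also have "\<dots> = ennreal ((norm (h s))\<^sup>2 / 2) * (\<integral>\<^sup>+ t. ennreal (?G s t) \<partial>lborel)"
        by (rule nn_integral_cmult) simp
      finally show "(\<integral>\<^sup>+ t. ennreal ((norm (h s))\<^sup>2 / 2 * ?G s t) \<partial>lborel) = \<dots>" .
    qed
    also have "\<dots> = (\<integral>\<^sup>+ s. ennreal ((norm (h s))\<^sup>2 / 2 * (sqrt (2 * pi) * \<epsilon>)) \<partial>lborel)"
      unfolding nnG using \<epsilon> by (intro nn_integral_cong ennreal_mult[symmetric]) auto
    also have "\<dots> = ennreal (LINT s|lborel. (norm (h s))\<^sup>2 / 2 * (sqrt (2 * pi) * \<epsilon>))"
      using \<epsilon> h2 by (intro nn_integral_eq_integral) auto
    finally show ?thesis by (simp add: mult_ac)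
  qed
  \<comment> \<open>The density is symmetric in mean and argument, so exchanging the order of
    integration reduces this half to the other one.\<close>
  have half': "(\<integral>\<^sup>+ s. \<integral>\<^sup>+ t. ennreal ((norm (h t))\<^sup>2 / 2 * ?G s t) \<partial>lborel \<partial>lborel)
      = ennreal (sqrt (2 * pi) * \<epsilon> * (LINT t|lborel. (norm (h t))\<^sup>2) / 2)"
    unfolding half[symmetric]
    by (subst lborel_pair.Fubini') (simp_all add: sym, simp add: normal_density_def)
  have "ennreal (LINT v|std_normal_distribution. (norm (fourier h (v / \<epsilon>)))\<^sup>2)
     = ennreal (norm (complex_of_real (LINT v|std_normal_distribution. (norm (fourier h (v / \<epsilon>)))\<^sup>2)))"
    by simp
  also have "\<dots> \<le> (\<integral>\<^sup>+ (s, t). ennreal (norm (h s * cnj (h t) * complex_of_real (?G s t))) \<partial>(lborel \<Otimes>\<^sub>M lborel))"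
    unfolding eq
    by (rule order_trans[OF norm_integral_le_nn_integral]) (auto intro!: eq_refl nn_integral_cong)
  also have "\<dots> \<le> (\<integral>\<^sup>+ (s, t). ennreal ((norm (h s))\<^sup>2 / 2 * ?G s t) + ennreal ((norm (h t))\<^sup>2 / 2 * ?G s t) \<partial>(lborel \<Otimes>\<^sub>M lborel))"
    using \<epsilon> ptw by (intro nn_integral_mono) (auto simp flip: ennreal_plus)
  also have "\<dots> = (\<integral>\<^sup>+ s. \<integral>\<^sup>+ t. ennreal ((norm (h s))\<^sup>2 / 2 * ?G s t) + ennreal ((norm (h t))\<^sup>2 / 2 * ?G s t) \<partial>lborel \<partial>lborel)"
    by (subst lborel.nn_integral_fst[symmetric]) (simp_all add: normal_density_def)
  also have "\<dots> = ennreal (sqrt (2 * pi) * \<epsilon> * (LINT t|lborel. (norm (h t))\<^sup>2))"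
  proof -
    have "(\<integral>\<^sup>+ s. \<integral>\<^sup>+ t. ennreal ((norm (h s))\<^sup>2 / 2 * ?G s t) + ennreal ((norm (h t))\<^sup>2 / 2 * ?G s t) \<partial>lborel \<partial>lborel)
      = (\<integral>\<^sup>+ s. (\<integral>\<^sup>+ t. ennreal ((norm (h s))\<^sup>2 / 2 * ?G s t) \<partial>lborel) + (\<integral>\<^sup>+ t. ennreal ((norm (h t))\<^sup>2 / 2 * ?G s t) \<partial>lborel) \<partial>lborel)"
      by (intro nn_integral_cong nn_integral_add) simp_all
    also have "\<dots> = (\<integral>\<^sup>+ s. \<integral>\<^sup>+ t. ennreal ((norm (h s))\<^sup>2 / 2 * ?G s t) \<partial>lborel \<partial>lborel)
      + (\<integral>\<^sup>+ s. \<integral>\<^sup>+ t. ennreal ((norm (h t))\<^sup>2 / 2 * ?G s t) \<partial>lborel \<partial>lborel)"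
      unfolding normal_density_def by (intro nn_integral_add) simp_all
    also have "\<dots> = ennreal (sqrt (2 * pi) * \<epsilon> * (LINT t|lborel. (norm (h t))\<^sup>2))"
      unfolding half half' using \<epsilon> by (subst ennreal_plus[symmetric]) auto
    finally show ?thesis .
  qed
  finally show ?thesis using \<epsilon> by (simp add: ennreal_le_iff)
qed

text \<open>Substituting v = \<epsilon> y in the Gaussian mean contributes a factor \<epsilon> that
  cancels the one in \<open>fourier_gauss_mean\<close>. What is left is a weight tending to 1
  pointwise as \<epsilon> tends to 0, and Fatou's lemma gives the inequality half of Plancherel's
  theorem.\<close>

lemma fourier_L2_bound:
  assumes h: "integrable lborel h" and h2: "integrable lborel (\<lambda>t. (norm (h t))\<^sup>2)"
  shows "(\<integral>\<^sup>+ y. ennreal ((norm (fourier h y))\<^sup>2) \<partial>lborel) \<le> ennreal (2 * pi * (LINT t|lborel. (norm (h t))\<^sup>2))"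
proof -
  let ?N = "LINT t|lborel. (norm (h t))\<^sup>2"
  have [measurable]: "h \<in> borel_measurable borel" using borel_measurable_integrable[OF h] by simp
  interpret P: real_distribution std_normal_distribution by (rule real_dist_normal_dist)
  define \<epsilon> where "\<epsilon> n = 1 / real (Suc n)" for n
  have \<epsilon>: "\<epsilon> n > 0" for n by (simp add: \<epsilon>_def)
  let ?q = "\<lambda>n y. ennreal (sqrt (2 * pi)) * (ennreal (std_normal_density (\<epsilon> n * y)) * ennreal ((norm (fourier h y))\<^sup>2))"
  have bound: "(\<integral>\<^sup>+ y. ?q n y \<partial>lborel) \<le> ennreal (2 * pi * ?N)" for n
  proof -
    let ?g = "\<lambda>v. ennreal (std_normal_density v) * ennreal ((norm (fourier h (v / \<epsilon> n)))\<^sup>2)"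
    define J where "J = (\<integral>\<^sup>+ y. ennreal (std_normal_density (\<epsilon> n * y)) * ennreal ((norm (fourier h y))\<^sup>2) \<partial>lborel)"
    have int: "integrable std_normal_distribution (\<lambda>v. (norm (fourier h (v / \<epsilon> n)))\<^sup>2)"
      by (rule P.integrable_const_bound[where B = "(LINT t|lborel. norm (h t))\<^sup>2"])
         (auto intro!: power_mono norm_fourier_le)
    have "ennreal (\<epsilon> n) * J = (\<integral>\<^sup>+ v. ?g v \<partial>lborel)"
      using \<epsilon>[of n] by (subst nn_integral_real_affine[where c = "\<epsilon> n" and t = 0]) (auto simp: J_def)
    also have "\<dots> = (\<integral>\<^sup>+ v. ennreal ((norm (fourier h (v / \<epsilon> n)))\<^sup>2) \<partial>std_normal_distribution)"
      by (subst nn_integral_density) auto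
    also have "\<dots> \<le> ennreal (sqrt (2 * pi) * \<epsilon> n * ?N)"
      using fourier_gauss_mean[OF h h2 \<epsilon>[of n]] by (subst nn_integral_eq_integral[OF int]) (auto intro: ennreal_leI)
    finally have "ennreal (1 / \<epsilon> n) * (ennreal (\<epsilon> n) * J) \<le> ennreal (1 / \<epsilon> n) * ennreal (sqrt (2 * pi) * \<epsilon> n * ?N)"
      by (rule mult_left_mono) simp
    moreover have "ennreal (1 / \<epsilon> n) * (ennreal (\<epsilon> n) * J) = J"
      using \<epsilon>[of n] by (simp add: mult.assoc[symmetric] flip: ennreal_mult)
    moreover have "ennreal (1 / \<epsilon> n) * ennreal (sqrt (2 * pi) * \<epsilon> n * ?N) = ennreal (sqrt (2 * pi) * ?N)"
      using \<epsilon>[of n] by (subst ennreal_mult[symmetric]) auto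
    ultimately have J: "J \<le> ennreal (sqrt (2 * pi) * ?N)" by simp
    have "(\<integral>\<^sup>+ y. ?q n y \<partial>lborel) = ennreal (sqrt (2 * pi)) * J"
      unfolding J_def by (rule nn_integral_cmult) simp
    also have "\<dots> \<le> ennreal (sqrt (2 * pi)) * ennreal (sqrt (2 * pi) * ?N)"
      by (rule mult_left_mono[OF J]) simp
    also have "\<dots> = ennreal (2 * pi * ?N)"
      by (subst ennreal_mult[symmetric]) (auto simp: mult.assoc[symmetric])
    finally show ?thesis .
  qed
  have lim: "(\<lambda>n. ?q n y) \<longlonglongrightarrow> ennreal ((norm (fourier h y))\<^sup>2)" for y
  proof -
    have "\<epsilon> \<longlonglongrightarrow> 0" unfolding \<epsilon>_def by (rule LIMSEQ_Suc) (rule lim_1_over_n)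
    then have "(\<lambda>n. sqrt (2 * pi) * std_normal_density (\<epsilon> n * y)) \<longlonglongrightarrow> sqrt (2 * pi) * ((1 / sqrt (2 * pi)) * exp (- (0 * y)\<^sup>2 / 2))"
      unfolding std_normal_density_def by (intro tendsto_intros) auto
    then have "(\<lambda>n. ennreal (sqrt (2 * pi) * std_normal_density (\<epsilon> n * y) * (norm (fourier h y))\<^sup>2)) \<longlonglongrightarrow>
        ennreal (1 * (norm (fourier h y))\<^sup>2)"
      by (intro tendsto_ennrealI tendsto_mult tendsto_const) simp
    moreover have "ennreal (sqrt (2 * pi) * std_normal_density (\<epsilon> n * y) * (norm (fourier h y))\<^sup>2) = ?q n y" for n
      by (subst ennreal_mult, simp, simp, subst ennreal_mult) (simp_all add: mult.assoc)
    ultimately show ?thesis by simp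
  qed
  have "(\<integral>\<^sup>+ y. ennreal ((norm (fourier h y))\<^sup>2) \<partial>lborel) = (\<integral>\<^sup>+ y. liminf (\<lambda>n. ?q n y) \<partial>lborel)"
    by (intro nn_integral_cong lim_imp_Liminf[OF _ lim, symmetric]) simp
  also have "\<dots> \<le> liminf (\<lambda>n. \<integral>\<^sup>+ y. ?q n y \<partial>lborel)"
    by (rule nn_integral_liminf) measurable
  also have "\<dots> \<le> limsup (\<lambda>n. \<integral>\<^sup>+ y. ?q n y \<partial>lborel)"
    by (rule Liminf_le_Limsup) simp
  also have "\<dots> \<le> ennreal (2 * pi * ?N)"
    using bound by (intro Limsup_bounded) (auto simp: always_eventually)
  finally show ?thesis .
qed

section \<open>Interpolation between the L1 and the L2 bound\<close>

text \<open>Serves twice in \<open>hausdorff_young_unit\<close>: as the layer-cake formula for a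
  power, and to evaluate the integral over the level s once the order of integration has been
  exchanged.\<close>

lemma nn_integral_powr_atMost:
  assumes "c > 0" "x \<ge> 0"
  shows "(\<integral>\<^sup>+ s. ennreal (s powr (c - 1)) * indicator {0..x} s \<partial>lborel) = ennreal (x powr c / c)"
proof -
  have "((\<lambda>s. s powr (c - 1)) has_integral (x powr (c - 1 + 1) / (c - 1 + 1))) {0..x}"
    using assms by (intro has_integral_powr_from_0) auto
  then have "(\<integral>\<^sup>+ s. ennreal (indicator {0..x} s * s powr (c - 1)) \<partial>lborel) = ennreal (x powr c / c)"
    using assms by (subst nn_integral_has_integral_lebesgue[where I = "x powr c / c"]) auto
  moreover have "ennreal (indicator {0..x} s * s powr (c - 1)) = ennreal (s powr (c - 1)) * indicator {0..x} s" for s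
    by (auto simp: indicator_def)
  ultimately show ?thesis by simp
qed

text \<open>Joint measurability of the layer-cake indicator, whose endpoint varies with the other
  variable; the exchanges of integrals depend on it.\<close>

lemma measurable_indicator_Icc [measurable]:
  fixes f g :: "'a \<Rightarrow> real"
  assumes [measurable]: "f \<in> borel_measurable M" "g \<in> borel_measurable M"
  shows "(\<lambda>x. indicator {0..f x} (g x) :: ennreal) \<in> borel_measurable M"
  unfolding indicator_def atLeastAtMost_iff by measurable

text \<open>Marcinkiewicz' splitting at level \<open>s\<close>: the part of \<open>h\<close> with \<open>s \<bar>h\<bar>\<^sup>a\<^sup>-\<^sup>1 > 2\<close> has transform at most \<open>s / 2\<close>
  everywhere, so the other part, which is square integrable, carries the level set.\<close>

lemma fourier_level_set:
  assumes a: "1 < a" "a < 2" and s: "s > 0"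
    and h: "integrable lborel h" and ha: "integrable lborel (\<lambda>t. norm (h t) powr a)"
    and A: "(LINT t|lborel. norm (h t) powr a) \<le> 1"
  shows "(\<integral>\<^sup>+ y. indicator {y. s \<le> norm (fourier h y)} y \<partial>lborel)
    \<le> ennreal (8 * pi / s\<^sup>2) * (\<integral>\<^sup>+ t. ennreal ((norm (h t))\<^sup>2) * indicator {t. s * norm (h t) powr (a - 1) \<le> 2} t \<partial>lborel)"
proof -
  have [measurable]: "h \<in> borel_measurable borel" using borel_measurable_integrable[OF h] by simp
  let ?S = "{t. s * norm (h t) powr (a - 1) \<le> 2}"
  define u where "u t = (if t \<in> ?S then h t else 0)" for t
  define v where "v t = (if t \<in> ?S then 0 else h t)" for t
  have [measurable]: "u \<in> borel_measurable borel" "v \<in> borel_measurable borel"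
    unfolding u_def[abs_def] v_def[abs_def] by measurable
  have u: "integrable lborel u" and v: "integrable lborel v"
    by (rule Bochner_Integration.integrable_bound[OF h]; auto simp: u_def v_def)+
  \<comment> \<open>Off \<open>?S\<close> one has 1 < s |h|^(a-1) / 2; multiplying by |h| compares v
    with |h|^a. As |h|^a has integral at most 1, the L1 norm of v is at most s/2.\<close>
  have v_le: "norm (v t) \<le> s / 2 * norm (h t) powr a" for t
  proof (cases "t \<in> ?S \<or> h t = 0")
    case False
    then have "norm (h t) * 1 \<le> norm (h t) * (s * norm (h t) powr (a - 1) / 2)"
      by (intro mult_left_mono) auto
    also have "\<dots> = s / 2 * (norm (h t) powr 1 * norm (h t) powr (a - 1))" by simp
    also have "\<dots> = s / 2 * norm (h t) powr a" by (simp only: powr_add[symmetric]) simp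
    finally show ?thesis using s by (auto simp: v_def)
  qed (use s in \<open>auto simp: v_def\<close>)
  \<comment> \<open>Solving s |h|^(a-1) <= 2 for |h| gives this bound on u. Being bounded and
    integrable, u is square integrable.\<close>
  define K where "K = (2 / s) powr (1 / (a - 1))"
  have u_le: "norm (u t) \<le> K" for t
  proof (cases "t \<in> ?S \<and> h t \<noteq> 0")
    case True
    then have "norm (h t) powr (a - 1) \<le> 2 / s" using s by (simp add: field_simps)
    then have "(norm (h t) powr (a - 1)) powr (1 / (a - 1)) \<le> K"
      unfolding K_def using a by (intro powr_mono2) auto
    then show ?thesis using True a by (simp add: u_def powr_powr)
  qed (auto simp: u_def K_def)
  have u2: "integrable lborel (\<lambda>t. (norm (u t))\<^sup>2)"
  proof (rule Bochner_Integration.integrable_bound)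
    show "integrable lborel (\<lambda>t. K * norm (u t))" using u by auto
    show "AE t in lborel. norm ((norm (u t))\<^sup>2) \<le> norm (K * norm (u t))"
      using u_le order_trans[OF norm_ge_zero u_le] by (auto simp: power2_eq_square intro!: mult_right_mono)
  qed auto
  have "norm (fourier v y) \<le> s / 2" for y
  proof -
    have "norm (fourier v y) \<le> (LINT t|lborel. norm (v t))" by (rule norm_fourier_le)
    also have "\<dots> \<le> (LINT t|lborel. s / 2 * norm (h t) powr a)"
      using v ha v_le by (intro integral_mono) auto
    also have "\<dots> \<le> s / 2 * 1" using A s by (simp del: mult_1_right)
    finally show ?thesis by simp
  qed
  moreover have "fourier h y = fourier u y + fourier v y" for y
    using fourier_add[OF u v] by (simp add: u_def v_def if_distrib cong: if_cong)
  ultimately have "s / 2 \<le> norm (fourier u y)" if "s \<le> norm (fourier h y)" for y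
    using that norm_triangle_ineq[of "fourier u y" "fourier v y"] by (smt (verit) field_sum_of_halves)
  \<comment> \<open>Chebyshev's inequality for u at level s/2. Its factor 4/s^2 and the 2 pi of the
    L2 bound make up the constant 8 pi / s^2.\<close>
  then have lower: "1 \<le> 4 / s\<^sup>2 * (norm (fourier u y))\<^sup>2" if "s \<le> norm (fourier h y)" for y
    using power_mono[of "s / 2" "norm (fourier u y)" 2] s that by (auto simp: field_simps)
  have "(\<integral>\<^sup>+ y. indicator {y. s \<le> norm (fourier h y)} y \<partial>lborel)
      \<le> (\<integral>\<^sup>+ y. ennreal (4 / s\<^sup>2) * ennreal ((norm (fourier u y))\<^sup>2) \<partial>lborel)"
    using lower by (intro nn_integral_mono) (auto simp: indicator_def ennreal_mult[symmetric] simp flip: ennreal_1 simp del: ennreal_1)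
  also have "\<dots> = ennreal (4 / s\<^sup>2) * (\<integral>\<^sup>+ y. ennreal ((norm (fourier u y))\<^sup>2) \<partial>lborel)"
    by (rule nn_integral_cmult) simp
  also have "\<dots> \<le> ennreal (4 / s\<^sup>2) * ennreal (2 * pi * (LINT t|lborel. (norm (u t))\<^sup>2))"
    by (intro mult_left_mono fourier_L2_bound u u2) simp
  also have "\<dots> = ennreal (8 * pi / s\<^sup>2) * ennreal (LINT t|lborel. (norm (u t))\<^sup>2)"
    by (simp add: ennreal_mult[symmetric])
  also have "ennreal (LINT t|lborel. (norm (u t))\<^sup>2) = (\<integral>\<^sup>+ t. ennreal ((norm (h t))\<^sup>2) * indicator ?S t \<partial>lborel)"
    by (subst nn_integral_eq_integral[OF u2, symmetric]) (auto simp: u_def indicator_def intro!: nn_integral_cong)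
  finally show ?thesis .
qed

text \<open>Layer cake, then the level-set estimate, then exchange of integrals. For fixed t with
  h(t) nonzero the condition s |h|^(a-1) <= 2 confines s to [0, 2 |h|^(1-a)], where s^(b-3) is
  integrable because a < 2 means b > 2. The integral is a multiple of |h|^(2 + (1-a)(b-2)) = |h|^a.
  The factor 1/(b-2) is the usual blow-up of the interpolation constant at the endpoint.\<close>

lemma hausdorff_young_unit:
  assumes a: "1 < a" "a < 2" and b: "b = a / (a - 1)"
    and h: "integrable lborel h" and ha: "integrable lborel (\<lambda>t. norm (h t) powr a)"
    and A: "(LINT t|lborel. norm (h t) powr a) \<le> 1"
  shows "(\<integral>\<^sup>+ y. ennreal (norm (fourier h y) powr b) \<partial>lborel)
    \<le> ennreal (8 * pi * b * 2 powr (b - 2) / (b - 2))"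
proof -
  have [measurable]: "h \<in> borel_measurable borel" using borel_measurable_integrable[OF h] by simp
  have b2: "b > 2" using a by (simp add: b field_simps)
  have exponents: "(1 - a) * (b - 2) + 2 = a"
    using a unfolding b by (simp add: field_simps)
  let ?c = "8 * pi * b * 2 powr (b - 2) / (b - 2)"
  let ?I = "\<lambda>s t. indicator {t. s * norm (h t) powr (a - 1) \<le> 2} t :: ennreal"
  have "(\<integral>\<^sup>+ y. ennreal (norm (fourier h y) powr b) \<partial>lborel)
      = (\<integral>\<^sup>+ y. ennreal b * (\<integral>\<^sup>+ s. ennreal (s powr (b - 1)) * indicator {0..norm (fourier h y)} s \<partial>lborel) \<partial>lborel)"
    using b2 by (intro nn_integral_cong) (simp add: nn_integral_powr_atMost ennreal_mult[symmetric])
  also have "\<dots> = (\<integral>\<^sup>+ y. \<integral>\<^sup>+ s. ennreal b * (ennreal (s powr (b - 1)) * indicator {0..norm (fourier h y)} s) \<partial>lborel \<partial>lborel)"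
    by (intro nn_integral_cong nn_integral_cmult[symmetric]) simp
  also have "\<dots> = (\<integral>\<^sup>+ s. \<integral>\<^sup>+ y. ennreal b * (ennreal (s powr (b - 1)) * indicator {0..norm (fourier h y)} s) \<partial>lborel \<partial>lborel)"
    by (rule lborel_pair.Fubini') simp
  also have "\<dots> \<le> (\<integral>\<^sup>+ s. \<integral>\<^sup>+ t. ennreal ((norm (h t))\<^sup>2) * (ennreal (8 * pi * b) * (ennreal (s powr (b - 2 - 1)) * (?I s t * indicator {0..} s))) \<partial>lborel \<partial>lborel)"
  proof (rule nn_integral_mono)
    fix s :: real
    show "(\<integral>\<^sup>+ y. ennreal b * (ennreal (s powr (b - 1)) * indicator {0..norm (fourier h y)} s) \<partial>lborel)
      \<le> (\<integral>\<^sup>+ t. ennreal ((norm (h t))\<^sup>2) * (ennreal (8 * pi * b) * (ennreal (s powr (b - 2 - 1)) * (?I s t * indicator {0..} s))) \<partial>lborel)"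
    proof (cases "s > 0")
      case True
      have "(\<integral>\<^sup>+ y. ennreal b * (ennreal (s powr (b - 1)) * indicator {0..norm (fourier h y)} s) \<partial>lborel)
          = (\<integral>\<^sup>+ y. ennreal (b * s powr (b - 1)) * indicator {y. s \<le> norm (fourier h y)} y \<partial>lborel)"
        using True b2 by (intro nn_integral_cong) (auto simp: indicator_def ennreal_mult)
      also have "\<dots> = ennreal (b * s powr (b - 1)) * (\<integral>\<^sup>+ y. indicator {y. s \<le> norm (fourier h y)} y \<partial>lborel)"
        by (rule nn_integral_cmult) simp
      also have "\<dots> \<le> ennreal (b * s powr (b - 1)) * (ennreal (8 * pi / s\<^sup>2) * (\<integral>\<^sup>+ t. ennreal ((norm (h t))\<^sup>2) * ?I s t \<partial>lborel))"
        by (intro mult_left_mono fourier_level_set a True h ha A) simp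
      also have "\<dots> = ennreal (8 * pi * b * s powr (b - 2 - 1)) * (\<integral>\<^sup>+ t. ennreal ((norm (h t))\<^sup>2) * ?I s t \<partial>lborel)"
      proof -
        \<comment> \<open>The exponent b - 3 is kept as \<open>b - 2 - 1\<close> so that
          \<open>nn_integral_powr_atMost\<close> applies with c = b - 2.\<close>
        have "s powr (b - 1) = s powr (b - 2 - 1) * s powr 2" by (simp flip: powr_add)
        then have "b * s powr (b - 1) * (8 * pi / s\<^sup>2) = 8 * pi * b * s powr (b - 2 - 1)"
          using True by (simp add: powr_numeral)
        then show ?thesis using True b2 by (simp add: mult.assoc[symmetric] flip: ennreal_mult)
      qed
      also have "\<dots> = (\<integral>\<^sup>+ t. ennreal (8 * pi * b * s powr (b - 2 - 1)) * (ennreal ((norm (h t))\<^sup>2) * ?I s t) \<partial>lborel)"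
        by (rule nn_integral_cmult[symmetric]) simp
      also have "\<dots> = (\<integral>\<^sup>+ t. ennreal ((norm (h t))\<^sup>2) * (ennreal (8 * pi * b) * (ennreal (s powr (b - 2 - 1)) * (?I s t * indicator {0..} s))) \<partial>lborel)"
        using True b2 by (intro nn_integral_cong) (simp add: ennreal_mult mult_ac)
      finally show ?thesis .
    next
      \<comment> \<open>For negative s the indicator vanishes; at s = 0 the power does, since
        \<open>0 powr x = 0\<close>.\<close>
      case False
      have "(\<integral>\<^sup>+ y. ennreal b * (ennreal (s powr (b - 1)) * indicator {0..norm (fourier h y)} s) \<partial>lborel) = (\<integral>\<^sup>+ y. 0 \<partial>(lborel :: real measure))"
        using False by (intro nn_integral_cong) (cases "s = 0", auto)
      then show ?thesis by simp
    qed
  qed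
  also have "\<dots> = (\<integral>\<^sup>+ t. \<integral>\<^sup>+ s. ennreal ((norm (h t))\<^sup>2) * (ennreal (8 * pi * b) * (ennreal (s powr (b - 2 - 1)) * (?I s t * indicator {0..} s))) \<partial>lborel \<partial>lborel)"
    by (rule lborel_pair.Fubini'[symmetric]) simp
  also have "\<dots> = (\<integral>\<^sup>+ t. ennreal (?c * norm (h t) powr a) \<partial>lborel)"
  proof (intro nn_integral_cong)
    fix t
    show "(\<integral>\<^sup>+ s. ennreal ((norm (h t))\<^sup>2) * (ennreal (8 * pi * b) * (ennreal (s powr (b - 2 - 1)) * (?I s t * indicator {0..} s))) \<partial>lborel)
        = ennreal (?c * norm (h t) powr a)"
    proof (cases "h t = 0")
      case False
      let ?x = "2 * norm (h t) powr (1 - a)"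
      have "norm (h t) powr (1 - a) * norm (h t) powr (a - 1) = 1"
        using False by (simp flip: powr_add)
      then have "s * norm (h t) powr (a - 1) \<le> 2 \<longleftrightarrow> s \<le> ?x" for s
        using False by (simp add: field_simps powr_diff)
      then have ind: "?I s t * indicator {0..} s = indicator {0..?x} s" for s
        by (auto simp: indicator_def)
      have "(\<integral>\<^sup>+ s. ennreal ((norm (h t))\<^sup>2) * (ennreal (8 * pi * b) * (ennreal (s powr (b - 2 - 1)) * (?I s t * indicator {0..} s))) \<partial>lborel)
        = (\<integral>\<^sup>+ s. ennreal ((norm (h t))\<^sup>2 * (8 * pi * b)) * (ennreal (s powr (b - 2 - 1)) * indicator {0..?x} s) \<partial>lborel)"
        using b2 by (simp only: ind) (simp add: ennreal_mult mult.assoc)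
      also have "\<dots> = ennreal ((norm (h t))\<^sup>2 * (8 * pi * b)) * ennreal (?x powr (b - 2) / (b - 2))"
        using b2 by (subst nn_integral_cmult, simp, subst nn_integral_powr_atMost) auto
      also have "\<dots> = ennreal ((norm (h t))\<^sup>2 * (8 * pi * b) * (?x powr (b - 2) / (b - 2)))"
        using b2 by (intro ennreal_mult[symmetric]) auto
      also have "(norm (h t))\<^sup>2 * (8 * pi * b) * (?x powr (b - 2) / (b - 2)) = ?c * (norm (h t) powr ((1 - a) * (b - 2)) * norm (h t) powr 2)"
        using False by (simp add: powr_mult powr_powr powr_numeral)
      also have "norm (h t) powr ((1 - a) * (b - 2)) * norm (h t) powr 2 = norm (h t) powr a"
        by (simp only: powr_add[symmetric] exponents)
      finally show ?thesis .
    qed simp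
  qed
  also have "\<dots> = ennreal (?c * (LINT t|lborel. norm (h t) powr a))"
    using b2 ha by (subst nn_integral_eq_integral) auto
  also have "\<dots> \<le> ennreal (?c * 1)"
    using b2 A by (intro ennreal_leI mult_left_mono) auto
  finally show ?thesis by simp
qed

section \<open>The Laplace transform into Hardy spaces\<close>

text \<open>Concrete representatives of L_a on the half-line with a real exponent: Borel rather than
  Lebesgue measurable, so that product measurability and Fubini over \<open>lborel\<close> apply,
  and zero at every t <= 0, so that integrals run over the whole line.
  \<open>Lp_representative\<close> leads from \<open>Lp\<close> to this set.\<close>

definition Lpos :: "real \<Rightarrow> (real \<Rightarrow> complex) set" where
  "Lpos a = {f \<in> borel_measurable borel. (\<forall>t\<le>0. f t = 0) \<and> integrable lborel (\<lambda>t. norm (f t) powr a)}"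

text \<open>The a-th power of the L_a norm. Without the root it is a plain integral to which
  dominated convergence and changes of variables apply directly; the price is the constant in
  \<open>Lpos_add\<close>.\<close>

definition mass :: "real \<Rightarrow> (real \<Rightarrow> complex) \<Rightarrow> real" where
  "mass a f = (LINT t|lborel. norm (f t) powr a)"

lemma mass_nonneg: "0 \<le> mass a f"
  by (simp add: mass_def)

lemma Lpos_measurable: "f \<in> Lpos a \<Longrightarrow> f \<in> borel_measurable borel"
  by (simp add: Lpos_def)

lemma Lpos_zero: "f \<in> Lpos a \<Longrightarrow> t \<le> 0 \<Longrightarrow> f t = 0"
  by (simp add: Lpos_def)

lemma Lpos_integrable: "f \<in> Lpos a \<Longrightarrow> integrable lborel (\<lambda>t. norm (f t) powr a)"
  by (simp add: Lpos_def)

lemma norm_add_powr_le: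
  fixes x y :: "'a::real_normed_vector"
  assumes "a \<ge> 0"
  shows "norm (x + y) powr a \<le> 2 powr a * (norm x powr a + norm y powr a)"
proof -
  let ?m = "max (norm x) (norm y)"
  have "norm (x + y) \<le> 2 * ?m" using norm_triangle_ineq[of x y] by linarith
  then have "norm (x + y) powr a \<le> (2 * ?m) powr a"
    using assms by (intro powr_mono2) auto
  also have "\<dots> = 2 powr a * ?m powr a" by (simp add: powr_mult)
  also have "?m powr a \<le> norm x powr a + norm y powr a" by (auto simp: max_def)
  finally show ?thesis by simp
qed

lemma Lpos_add:
  assumes a: "a \<ge> 0" and f: "f \<in> Lpos a" and g: "g \<in> Lpos a"
  shows "(\<lambda>t. f t + g t) \<in> Lpos a"
    and "mass a (\<lambda>t. f t + g t) \<le> 2 powr a * (mass a f + mass a g)"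
proof -
  have [measurable]: "f \<in> borel_measurable borel" "g \<in> borel_measurable borel"
    using f g by (auto intro: Lpos_measurable)
  have int: "integrable lborel (\<lambda>t. 2 powr a * (norm (f t) powr a + norm (g t) powr a))"
    using f g by (auto intro: Lpos_integrable)
  have int': "integrable lborel (\<lambda>t. norm (f t + g t) powr a)"
    by (rule Bochner_Integration.integrable_bound[OF int]) (auto intro!: AE_I2 order_trans[OF norm_add_powr_le[OF a]])
  then show "(\<lambda>t. f t + g t) \<in> Lpos a" using f g by (auto simp: Lpos_def)
  have "mass a (\<lambda>t. f t + g t) \<le> (LINT t|lborel. 2 powr a * (norm (f t) powr a + norm (g t) powr a))"
    unfolding mass_def by (intro integral_mono int int' norm_add_powr_le a)
  also have "\<dots> = 2 powr a * (mass a f + mass a g)"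
    using f g by (simp add: mass_def Lpos_integrable)
  finally show "mass a (\<lambda>t. f t + g t) \<le> 2 powr a * (mass a f + mass a g)" .
qed

lemma Lpos_scale:
  assumes f: "f \<in> Lpos a"
  shows "(\<lambda>t. c *\<^sub>R f t) \<in> Lpos a" and "mass a (\<lambda>t. c *\<^sub>R f t) = \<bar>c\<bar> powr a * mass a f"
  using f by (auto simp: Lpos_def mass_def powr_mult)

lemma Lpos_diff:
  assumes a: "a \<ge> 0" and f: "f \<in> Lpos a" and g: "g \<in> Lpos a"
  shows "(\<lambda>t. f t - g t) \<in> Lpos a"
    and "mass a (\<lambda>t. f t - g t) \<le> 2 powr a * (mass a f + mass a g)"
proof -
  have "mass a (\<lambda>t. (-1) *\<^sub>R g t) = mass a g" using Lpos_scale(2)[OF g, of "-1"] by simp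
  then show "(\<lambda>t. f t - g t) \<in> Lpos a" "mass a (\<lambda>t. f t - g t) \<le> 2 powr a * (mass a f + mass a g)"
    using Lpos_add[OF a f Lpos_scale(1)[OF g, of "-1"]] by auto
qed

text \<open>Multiplied by an integrable weight, this splits a function of class L_a into a part
  dominated by the weight and a part dominated by its a-th power. It is the source of most
  integrable majorants below.\<close>

lemma norm_le_one_plus_powr: "a \<ge> 1 \<Longrightarrow> norm z \<le> 1 + norm z powr a" for z :: "'a::real_normed_vector"
  using powr_mono[of 1 a "norm z"] by (cases "norm z \<le> 1") (auto intro: order_trans add_increasing2)

lemma exp_decay_integrable:
  assumes "x > 0"
  shows "integrable lborel (\<lambda>t. indicator {0..} t * exp (- x * t) :: real)"
  using assms integrable_I0i_exp_mscale[of x] unfolding set_integrable_def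
  by (rule_tac integrable_cong_AE_imp[of lborel "\<lambda>t. indicator {0<..} t * exp (- x * t)"])
     (auto simp: mult_ac intro!: AE_I[where N = "{0}"] split: split_indicator)

text \<open>This makes the Laplace transform on a vertical line the Fourier integral of an L_1
  function, to which the Hausdorff-Young bound applies as proved.\<close>

lemma Lpos_damped_integrable:
  assumes a: "a \<ge> 1" and f: "f \<in> Lpos a" and x: "x > 0"
  shows "integrable lborel (\<lambda>t. exp (- x * t) *\<^sub>R f t)"
proof (rule Bochner_Integration.integrable_bound)
  have [measurable]: "f \<in> borel_measurable borel" using f by (rule Lpos_measurable)
  show "integrable lborel (\<lambda>t. indicator {0..} t * exp (- x * t) + norm (f t) powr a)"
    using exp_decay_integrable[OF x] Lpos_integrable[OF f] by auto
  show "(\<lambda>t. exp (- x * t) *\<^sub>R f t) \<in> borel_measurable lborel" by measurable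
  show "AE t in lborel. norm (exp (- x * t) *\<^sub>R f t) \<le> norm (indicator {0..} t * exp (- x * t) + norm (f t) powr a)"
  proof (intro AE_I2)
    fix t
    show "norm (exp (- x * t) *\<^sub>R f t) \<le> norm (indicator {0..} t * exp (- x * t) + norm (f t) powr a)"
    proof (cases "t \<le> 0")
      case False
      have "exp (- x * t) * norm (f t) \<le> exp (- x * t) * (1 + norm (f t) powr a)"
        by (intro mult_left_mono norm_le_one_plus_powr a) auto
      also have "\<dots> \<le> exp (- x * t) + 1 * norm (f t) powr a"
        unfolding distrib_left mult_1_right using x False by (intro add_left_mono mult_right_mono) auto
      finally show ?thesis using False by simp
    qed (simp add: Lpos_zero[OF f])
  qed
qed

lemma norm_exp_of_real: "norm (exp (- z * complex_of_real t)) = exp (- Re z * t)"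
  by (simp add: norm_exp_eq_Re)

lemma laplace_integrable:
  assumes a: "a \<ge> 1" and f: "f \<in> Lpos a" and z: "Re z > 0"
  shows "integrable lborel (\<lambda>t. f t * exp (- z * complex_of_real t))"
proof (rule Bochner_Integration.integrable_bound[OF Lpos_damped_integrable[OF a f z]])
  have [measurable]: "f \<in> borel_measurable borel" using f by (rule Lpos_measurable)
  show "(\<lambda>t. f t * exp (- z * complex_of_real t)) \<in> borel_measurable lborel" by measurable
qed (auto simp: norm_mult norm_exp_eq_Re)

lemma laplace_eq_lborel:
  assumes f: "f \<in> Lpos a" and z: "Re z > 0"
  shows "laplace f z = (LINT t|lborel. f t * exp (- z * complex_of_real t))"
proof -
  have [measurable]: "f \<in> borel_measurable borel" using f by (rule Lpos_measurable)
  have "laplace f z = (LINT t|lebesgue. indicator {0<..} t *\<^sub>R (f t * exp (- z * complex_of_real t)))"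
    using z by (simp add: laplace_def right_half_plane_def set_lebesgue_integral_def)
  also have "\<dots> = (LINT t|lborel. indicator {0<..} t *\<^sub>R (f t * exp (- z * complex_of_real t)))"
    by (rule integral_completion) measurable
  also have "\<dots> = (LINT t|lborel. f t * exp (- z * complex_of_real t))"
    using Lpos_zero[OF f] by (intro Bochner_Integration.integral_cong) (auto simp: indicator_def not_less)
  finally show ?thesis .
qed

lemma laplace_outside: "Re z \<le> 0 \<Longrightarrow> laplace f z = 0"
  by (simp add: laplace_def right_half_plane_def)

lemma laplace_add:
  assumes a: "a \<ge> 1" and f: "f \<in> Lpos a" and g: "g \<in> Lpos a"
  shows "laplace (\<lambda>t. f t + g t) z = laplace f z + laplace g z"
proof (cases "Re z > 0")
  case True
  then show ?thesis
    using laplace_integrable[OF a f] laplace_integrable[OF a g] Lpos_add(1)[OF _ f g] a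
    by (simp add: laplace_eq_lborel[where a = a] f g distrib_right)
qed (simp add: laplace_outside)

lemma laplace_scale:
  assumes f: "f \<in> Lpos a"
  shows "laplace (\<lambda>t. c *\<^sub>R f t) z = c *\<^sub>R laplace f z"
proof (cases "Re z > 0")
  case True
  then show ?thesis
    using Lpos_scale(1)[OF f] by (simp add: laplace_eq_lborel[where a = a] f)
qed (simp add: laplace_outside)

lemma laplace_diff:
  assumes a: "a \<ge> 1" and f: "f \<in> Lpos a" and g: "g \<in> Lpos a"
  shows "laplace (\<lambda>t. f t - g t) z = laplace f z - laplace g z"
  using laplace_add[OF a f Lpos_scale(1)[OF g, of "-1"], of z] laplace_scale[OF g, of "-1" z] by simp

lemma laplace_deriv:
  assumes a: "a \<ge> 1" and f: "f \<in> Lpos a" and z: "Re z > 0"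
  shows "(laplace f has_field_derivative
    (LINT t|lborel. - complex_of_real t * (f t * exp (- z * complex_of_real t)))) (at z)"
  unfolding DERIV_def
proof -
  have [measurable]: "f \<in> borel_measurable borel" using f by (rule Lpos_measurable)
  \<comment> \<open>The decay rate Re z equals 4r. The Taylor bound for the exponential costs
    exp(rt), and t <= exp(rt)/r costs another exp(rt), which leaves the majorant the decay
    exp(-2rt).\<close>
  define r where "r = Re z / 4"
  have r: "r > 0" using z by (simp add: r_def)
  have in_rhp: "Re (z + h) > 0" if "h \<in> ball 0 r" for h
  proof -
    have "norm h < Re z / 4" using that by (simp add: r_def)
    then show ?thesis using abs_Re_le_cmod[of h] z unfolding plus_complex.sel by linarith
  qed
  let ?q = "\<lambda>h t. f t * exp (- z * complex_of_real t) * ((exp (- h * complex_of_real t) - 1) / h)"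
  \<comment> \<open>Inside the ball the majorant is valid for every term of a sequence, as dominated
    convergence demands. The ball is an open neighbourhood of 0, so the limit is the one at
    0.\<close>
  have "((\<lambda>h. (laplace f (z + h) - laplace f z) / h) \<longlongrightarrow>
      (LINT t|lborel. - complex_of_real t * (f t * exp (- z * complex_of_real t)))) (at 0 within ball 0 r)"
    unfolding tendsto_at_iff_sequentially comp_def
  proof (intro allI impI)
    fix X :: "nat \<Rightarrow> complex"
    assume X: "\<forall>i. X i \<in> ball 0 r - {0}" and X0: "X \<longlonglongrightarrow> 0"
    have eq: "(laplace f (z + X i) - laplace f z) / X i = (LINT t|lborel. ?q (X i) t)" for i
    proof -
      have "Re (z + X i) > 0" using X in_rhp by blast
      then have "laplace f (z + X i) - laplace f z
          = (LINT t|lborel. f t * exp (- (z + X i) * complex_of_real t) - f t * exp (- z * complex_of_real t))"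
        using laplace_integrable[OF a f, of "z + X i"] laplace_integrable[OF a f z]
        by (simp only: laplace_eq_lborel[OF f] z Bochner_Integration.integral_diff)
      then have "(laplace f (z + X i) - laplace f z) / X i
          = (LINT t|lborel. (f t * exp (- (z + X i) * complex_of_real t) - f t * exp (- z * complex_of_real t)) / X i)"
        by simp
      also have "\<dots> = (LINT t|lborel. ?q (X i) t)"
      proof (intro Bochner_Integration.integral_cong refl)
        fix t
        have "exp (- (z + X i) * complex_of_real t) = exp (- z * complex_of_real t) * exp (- X i * complex_of_real t)"
          by (simp only: exp_add[symmetric]) (simp add: algebra_simps)
        then show "(f t * exp (- (z + X i) * complex_of_real t) - f t * exp (- z * complex_of_real t)) / X i = ?q (X i) t"
          by (simp only: diff_divide_distrib right_diff_distrib mult.assoc times_divide_eq_right mult_1_right)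
      qed
      finally show ?thesis .
    qed
    have "(\<lambda>i. LINT t|lborel. ?q (X i) t) \<longlonglongrightarrow> (LINT t|lborel. - complex_of_real t * (f t * exp (- z * complex_of_real t)))"
    proof (rule integral_dominated_convergence)
      show "integrable lborel (\<lambda>t. 1 / r * norm (exp (- (2 * r) * t) *\<^sub>R f t))"
        using Lpos_damped_integrable[OF a f, of "2 * r"] r by (intro integrable_mult_right integrable_norm) auto
      show "AE t in lborel. (\<lambda>i. ?q (X i) t) \<longlonglongrightarrow> - complex_of_real t * (f t * exp (- z * complex_of_real t))"
      proof (intro AE_I2)
        fix t
        have "((\<lambda>h. exp (- h * complex_of_real t)) has_field_derivative (- complex_of_real t)) (at 0)"
          by (auto intro!: derivative_eq_intros)
        then have "((\<lambda>h. (exp (- h * complex_of_real t) - 1) / h) \<longlongrightarrow> - complex_of_real t) (at 0)"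
          unfolding DERIV_def by simp
        moreover have "filterlim X (at 0) sequentially"
          using X X0 by (auto simp: filterlim_at)
        ultimately have "(\<lambda>i. (exp (- X i * complex_of_real t) - 1) / X i) \<longlonglongrightarrow> - complex_of_real t"
          by (rule filterlim_compose)
        then have "(\<lambda>i. ?q (X i) t) \<longlonglongrightarrow> f t * exp (- z * complex_of_real t) * (- complex_of_real t)"
          by (intro tendsto_mult tendsto_const)
        then show "(\<lambda>i. ?q (X i) t) \<longlonglongrightarrow> - complex_of_real t * (f t * exp (- z * complex_of_real t))"
          by (simp add: mult.commute)
      qed
      show "AE t in lborel. norm (?q (X i) t) \<le> 1 / r * norm (exp (- (2 * r) * t) *\<^sub>R f t)" for i
      proof (intro AE_I2)
        fix t
        show "norm (?q (X i) t) \<le> 1 / r * norm (exp (- (2 * r) * t) *\<^sub>R f t)"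
        proof (cases "t \<le> 0")
          case False
          then have t: "t > 0" by simp
          let ?w = "- X i * complex_of_real t"
          have Xi: "X i \<noteq> 0" "norm (X i) < r" using X by auto
          have "norm (exp ?w - 1) \<le> exp \<bar>Re ?w\<bar> * norm ?w"
            using Taylor_exp[of ?w 0] by simp
          also have "\<dots> \<le> exp (r * t) * norm ?w"
            using Xi t abs_Re_le_cmod[of "X i"] by (intro mult_right_mono) (auto simp: abs_mult)
          also have "norm ?w = norm (X i) * t" using t by (simp add: norm_mult)
          finally have "norm ((exp ?w - 1) / X i) \<le> exp (r * t) * t"
            using Xi by (simp add: norm_divide field_simps)
          also have "\<dots> \<le> exp (r * t) * (exp (r * t) / r)"
          proof (intro mult_left_mono)
            have "r * t \<le> exp (r * t)" using exp_ge_add_one_self[of "r * t"] by linarith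
            then show "t \<le> exp (r * t) / r" using r by (simp add: field_simps)
          qed simp
          finally have "norm (?q (X i) t) \<le> norm (f t) * exp (- Re z * t) * (exp (r * t) * (exp (r * t) / r))"
            unfolding norm_mult norm_exp_of_real by (intro mult_left_mono) auto
          also have "\<dots> = 1 / r * (exp (- Re z * t) * exp (r * t) * exp (r * t) * norm (f t))"
            by (simp only: divide_inverse mult_ac mult_1_left)
          also have "exp (- Re z * t) * exp (r * t) * exp (r * t) = exp (- (2 * r) * t)"
            unfolding exp_add[symmetric] by (simp add: r_def)
          also have "exp (- (2 * r) * t) * norm (f t) = norm (exp (- (2 * r) * t) *\<^sub>R f t)"
            by (simp only: norm_scaleR abs_exp_cancel)
          finally show ?thesis .
        qed (simp add: Lpos_zero[OF f])
      qed
    qed auto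
    then show "(\<lambda>i. (laplace f (z + X i) - laplace f z) / X i) \<longlonglongrightarrow>
        (LINT t|lborel. - complex_of_real t * (f t * exp (- z * complex_of_real t)))"
      by (simp only: eq)
  qed
  then show "((\<lambda>h. (laplace f (z + h) - laplace f z) / h) \<longlongrightarrow>
      (LINT t|lborel. - complex_of_real t * (f t * exp (- z * complex_of_real t)))) (at 0)"
    using r at_within_open[of 0 "ball (0 :: complex) r"] by (simp only: centre_in_ball open_ball)
qed

lemma laplace_holomorphic:
  assumes "a \<ge> 1" "f \<in> Lpos a"
  shows "laplace f \<in> holomorphic_rhp"
  unfolding holomorphic_rhp_def
proof (intro CollectI conjI allI impI)
  show "laplace f holomorphic_on right_half_plane"
    unfolding holomorphic_on_def right_half_plane_def
    using laplace_deriv[OF assms] field_differentiable_def has_field_derivative_at_within by blast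
qed (simp add: laplace_outside right_half_plane_def)

section \<open>Hausdorff-Young bounds on vertical lines\<close>

text \<open>At a = 2 the interpolation constant degenerates, and the L2 bound itself is
  used.\<close>

lemma hausdorff_young:
  assumes a: "1 < a" "a \<le> 2" and b: "b = a / (a - 1)"
  obtains K where "K > 0" "\<And>h. integrable lborel h \<Longrightarrow> integrable lborel (\<lambda>t. norm (h t) powr a) \<Longrightarrow> mass a h \<le> 1 \<Longrightarrow>
    (\<integral>\<^sup>+ y. ennreal (norm (fourier h y) powr b) \<partial>lborel) \<le> ennreal K"
proof (cases "a = 2")
  case True
  show thesis
  proof (rule that[of "2 * pi"])
    fix h :: "real \<Rightarrow> complex"
    assume h: "integrable lborel h" "integrable lborel (\<lambda>t. norm (h t) powr a)" "mass a h \<le> 1"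
    have "(\<integral>\<^sup>+ y. ennreal ((norm (fourier h y))\<^sup>2) \<partial>lborel) \<le> ennreal (2 * pi * (LINT t|lborel. (norm (h t))\<^sup>2))"
      using h True by (intro fourier_L2_bound) (simp_all add: powr_numeral)
    also have "\<dots> \<le> ennreal (2 * pi * 1)"
      using h(3) True by (intro ennreal_leI mult_left_mono) (simp_all add: mass_def powr_numeral)
    finally show "(\<integral>\<^sup>+ y. ennreal (norm (fourier h y) powr b) \<partial>lborel) \<le> ennreal (2 * pi)"
      using True b by (simp add: powr_numeral)
  qed simp
next
  case False
  then have "b > 2" using a by (simp add: b field_simps)
  then show thesis
    using False a hausdorff_young_unit[OF a(1) _ b]
    by (intro that[of "8 * pi * b * 2 powr (b - 2) / (b - 2)"]) (auto simp: mass_def)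
qed

lemma Lpos_damped:
  assumes f: "f \<in> Lpos a" and a: "a \<ge> 0" and x: "x \<ge> 0"
  shows "(\<lambda>t. exp (- x * t) *\<^sub>R f t) \<in> Lpos a" and "mass a (\<lambda>t. exp (- x * t) *\<^sub>R f t) \<le> mass a f"
proof -
  have [measurable]: "f \<in> borel_measurable borel" using f by (rule Lpos_measurable)
  have le: "norm (exp (- x * t) *\<^sub>R f t) powr a \<le> norm (f t) powr a" for t
  proof (cases "t \<le> 0")
    case False
    then have "exp (- x * t) * norm (f t) \<le> 1 * norm (f t)" using x by (intro mult_right_mono) auto
    then show ?thesis using a by (intro powr_mono2) auto
  qed (simp add: Lpos_zero[OF f])
  have int: "integrable lborel (\<lambda>t. norm (exp (- x * t) *\<^sub>R f t) powr a)"
    by (rule Bochner_Integration.integrable_bound[OF Lpos_integrable[OF f]]) (use le in auto)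
  show "(\<lambda>t. exp (- x * t) *\<^sub>R f t) \<in> Lpos a" using int f by (auto simp: Lpos_def)
  show "mass a (\<lambda>t. exp (- x * t) *\<^sub>R f t) \<le> mass a f"
    unfolding mass_def by (intro integral_mono int Lpos_integrable f le)
qed

lemma laplace_eq_fourier:
  assumes f: "f \<in> Lpos a" and x: "x > 0"
  shows "laplace f (Complex x y) = fourier (\<lambda>t. exp (- x * t) *\<^sub>R f t) y"
proof -
  have "f t * exp (- Complex x y * complex_of_real t) = iexp (- (y * t)) * (exp (- x * t) *\<^sub>R f t)" for t
  proof -
    have "- Complex x y * complex_of_real t = complex_of_real (- x * t) + \<i> * complex_of_real (- (y * t))"
      by (simp add: complex_eq_iff)
    then show ?thesis by (simp only: exp_add exp_of_real scaleR_conv_of_real mult_ac)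
  qed
  then show ?thesis using laplace_eq_lborel[OF f, of "Complex x y"] x by (simp add: fourier_def)
qed

lemma fourier_scale: "fourier (\<lambda>t. c *\<^sub>R h t) y = c *\<^sub>R fourier h y"
  by (simp add: fourier_def)

text \<open>The unit bound is applied to exp(-xt) f(t) / c. Damping does not increase the mass, so C
  serves all x at once, as the supremum over x in the Hardy norm requires. The condition
  \<open>mass a f \<le> c powr a\<close> says that c bounds the L_a norm; a positive c allows the
  division even if f has mass zero.\<close>

lemma laplace_hardy_mean:
  assumes a: "1 < a" "a \<le> 2" and b: "b = a / (a - 1)"
  obtains C where "C > 0"
    "\<And>f x. f \<in> Lpos a \<Longrightarrow> x > 0 \<Longrightarrow> integrable lborel (\<lambda>y. norm (laplace f (Complex x y)) powr b)"
    "\<And>f x c. f \<in> Lpos a \<Longrightarrow> x > 0 \<Longrightarrow> c > 0 \<Longrightarrow> mass a f \<le> c powr a \<Longrightarrow> hardy_mean b (laplace f) x \<le> C * c"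
proof -
  obtain K where K: "K > 0" "\<And>h. integrable lborel h \<Longrightarrow> integrable lborel (\<lambda>t. norm (h t) powr a) \<Longrightarrow> mass a h \<le> 1 \<Longrightarrow>
    (\<integral>\<^sup>+ y. ennreal (norm (fourier h y) powr b) \<partial>lborel) \<le> ennreal K"
    using hausdorff_young[OF a b] by metis
  have b2: "b > 1" using a by (simp add: b field_simps)
  have main: "integrable lborel (\<lambda>y. norm (laplace f (Complex x y)) powr b) \<and>
      (LINT y|lborel. norm (laplace f (Complex x y)) powr b) \<le> c powr b * K"
    if f: "f \<in> Lpos a" and x: "x > 0" and c: "c > 0" and m: "mass a f \<le> c powr a" for f x c
  proof -
    let ?h = "\<lambda>t. (1 / c) *\<^sub>R (exp (- x * t) *\<^sub>R f t)"
    have d: "(\<lambda>t. exp (- x * t) *\<^sub>R f t) \<in> Lpos a" "mass a (\<lambda>t. exp (- x * t) *\<^sub>R f t) \<le> mass a f"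
      using Lpos_damped[OF f] a x by auto
    have h: "?h \<in> Lpos a" by (rule Lpos_scale[OF d(1)])
    have [measurable]: "?h \<in> borel_measurable borel" using h by (rule Lpos_measurable)
    have "mass a ?h = (1 / c) powr a * mass a (\<lambda>t. exp (- x * t) *\<^sub>R f t)"
      using Lpos_scale(2)[OF d(1), of "1 / c"] c by simp
    also have "\<dots> \<le> (1 / c) powr a * c powr a" using d(2) m by (intro mult_left_mono) auto
    also have "\<dots> = 1" using c by (simp flip: powr_mult)
    finally have mh: "mass a ?h \<le> 1" .
    have F: "fourier ?h y = (1 / c) *\<^sub>R laplace f (Complex x y)" for y
      by (simp only: laplace_eq_fourier[OF f x] fourier_scale)
    have nn: "(\<integral>\<^sup>+ y. ennreal (norm (fourier ?h y) powr b) \<partial>lborel) \<le> ennreal K"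
      by (intro K Lpos_integrable h mh integrable_scaleR_right Lpos_damped_integrable[OF _ f x]) (use a in auto)
    have int: "integrable lborel (\<lambda>y. norm (fourier ?h y) powr b)"
    proof (rule integrableI_bounded)
      have [measurable]: "fourier ?h \<in> borel_measurable borel" by (rule fourier_measurable) fact
      show "(\<lambda>y. norm (fourier ?h y) powr b) \<in> borel_measurable lborel" by measurable
      show "(\<integral>\<^sup>+ y. ennreal (norm (norm (fourier ?h y) powr b)) \<partial>lborel) < \<infinity>"
        using order_le_less_trans[OF nn ennreal_less_top] by (simp only: real_norm_def abs_of_nonneg powr_ge_zero infinity_ennreal_def)
    qed
    have pw: "norm (laplace f (Complex x y)) powr b = c powr b * norm (fourier ?h y) powr b" for y
      unfolding F using c by (simp add: powr_mult[symmetric])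
    have "(LINT y|lborel. norm (fourier ?h y) powr b) \<le> K"
      using nn K(1) by (subst (asm) nn_integral_eq_integral[OF int]) auto
    then show ?thesis unfolding pw using int by (simp add: mult_left_mono)
  qed
  define C where "C = (K / (2 * pi)) powr (1 / b)"
  show thesis
  proof (rule that[of C])
    show "C > 0" using K(1) by (simp add: C_def)
    fix f :: "real \<Rightarrow> complex" and x :: real assume f: "f \<in> Lpos a" and x: "x > 0"
    \<comment> \<open>Any positive bound for the norm will do here; adding 1 keeps it positive when
      the mass is zero.\<close>
    have "mass a f \<le> ((mass a f + 1) powr (1 / a)) powr a"
      using mass_nonneg[of a f] a by (simp add: powr_powr)
    moreover have "(mass a f + 1) powr (1 / a) > 0" using mass_nonneg[of a f] by simp
    ultimately show "integrable lborel (\<lambda>y. norm (laplace f (Complex x y)) powr b)"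
      using main[OF f x] by blast
  next
    fix f :: "real \<Rightarrow> complex" and x c :: real
    assume f: "f \<in> Lpos a" "x > 0" and c: "c > 0" and m: "mass a f \<le> c powr a"
    have "hardy_mean b (laplace f) x \<le> (1 / (2 * pi) * (c powr b * K)) powr (1 / b)"
      unfolding hardy_mean_def using main[OF f c m] b2 by (intro powr_mono2 mult_left_mono) auto
    also have "1 / (2 * pi) * (c powr b * K) = (K / (2 * pi)) * c powr b" by simp
    also have "\<dots> powr (1 / b) = C * c"
      using K(1) c b2 unfolding C_def by (subst powr_mult) (auto simp: powr_powr)
    finally show "hardy_mean b (laplace f) x \<le> C * c" .
  qed
qed

lemma laplace_hardy_finite:
  assumes a: "1 < a" "a \<le> 2" and b: "b = ennreal (a / (a - 1))"
  obtains C where "C > 0" "\<And>f. f \<in> Lpos a \<Longrightarrow> laplace f \<in> hardy_space b"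
    "\<And>f c. f \<in> Lpos a \<Longrightarrow> c > 0 \<Longrightarrow> mass a f \<le> c powr a \<Longrightarrow> hardy_norm b (laplace f) \<le> C * c"
proof -
  have b': "enn2real b = a / (a - 1)" "b \<noteq> \<infinity>" using a by (simp_all add: b)
  obtain C where C: "C > 0"
    "\<And>f x. f \<in> Lpos a \<Longrightarrow> x > 0 \<Longrightarrow> integrable lborel (\<lambda>y. norm (laplace f (Complex x y)) powr enn2real b)"
    "\<And>f x c. f \<in> Lpos a \<Longrightarrow> x > 0 \<Longrightarrow> c > 0 \<Longrightarrow> mass a f \<le> c powr a \<Longrightarrow> hardy_mean (enn2real b) (laplace f) x \<le> C * c"
    using laplace_hardy_mean[OF a b'(1)] by metis
  show thesis
  proof (rule that[of C])
    show "C > 0" by fact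
    fix f assume f: "f \<in> Lpos a"
    have "mass a f \<le> ((mass a f + 1) powr (1 / a)) powr a" "(mass a f + 1) powr (1 / a) > 0"
      using mass_nonneg[of a f] a by (simp_all add: powr_powr)
    then have "bdd_above (hardy_mean (enn2real b) (laplace f) ` {0<..})"
      using C(3)[OF f] by (intro bdd_aboveI[of _ "C * (mass a f + 1) powr (1 / a)"]) auto
    then show "laplace f \<in> hardy_space b"
      using b' C(2)[OF f] laplace_holomorphic[OF _ f] a by (auto simp: hardy_space_def)
  next
    fix f and c :: real assume "f \<in> Lpos a" "c > 0" "mass a f \<le> c powr a"
    then show "hardy_norm b (laplace f) \<le> C * c"
      using b' C(3)[of f] by (auto simp: hardy_norm_def intro!: cSUP_least)
  qed
qed

section \<open>Density and strong continuity of dilations\<close>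

text \<open>For B > 0 this is the radial projection onto the closed disc of radius B. Written with
  \<open>max\<close>, it is visibly continuous, also at the origin.\<close>

definition clamp_norm :: "real \<Rightarrow> complex \<Rightarrow> complex" where
  "clamp_norm B z = (B / max B (norm z)) *\<^sub>R z"

lemma norm_clamp_norm: "B > 0 \<Longrightarrow> norm (clamp_norm B z) \<le> B" "B > 0 \<Longrightarrow> norm (clamp_norm B z) \<le> norm z"
  by (auto simp: clamp_norm_def max_def field_simps mult_left_mono)

lemma clamp_norm_eq: "B > 0 \<Longrightarrow> norm z \<le> B \<Longrightarrow> clamp_norm B z = z"
  by (auto simp: clamp_norm_def max_def)

lemma continuous_clamp_norm:
  assumes "B > 0"
  shows "continuous_on A (clamp_norm B)"
proof -
  have "max B (norm z) \<noteq> 0" for z :: complex using assms by (auto simp: max_def)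
  then show ?thesis unfolding clamp_norm_def[abs_def] by (intro continuous_intros) auto
qed

text \<open>A continuous trapezoid: for large m it vanishes off [1/m, m] and equals 1 on
  [2/m, m - 1]. It truncates to a compact subset of the open half-line.\<close>

definition cutoff :: "real \<Rightarrow> real \<Rightarrow> real" where
  "cutoff m t = max 0 (min 1 (min (m * t - 1) (m - t)))"

lemma cutoff_bounds: "0 \<le> cutoff m t" "cutoff m t \<le> 1"
  by (auto simp: cutoff_def)

lemma cutoff_zero: "m > 0 \<Longrightarrow> t \<notin> {1 / m..m} \<Longrightarrow> cutoff m t = 0"
  by (auto simp: cutoff_def field_simps max_def min_def not_le)

lemma continuous_cutoff: "continuous_on A (cutoff m)"
  unfolding cutoff_def[abs_def] by (intro continuous_intros)

lemma cutoff_eventually: "t > 0 \<Longrightarrow> \<forall>\<^sub>F n in sequentially. cutoff (real (Suc n)) t = 1"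
proof -
  assume t: "t > 0"
  have "\<forall>\<^sub>F n in sequentially. max (2 / t) (t + 1) \<le> real n"
    by (rule eventually_ge_at_top[THEN filterlim_real_sequentially[THEN filterlim_iff[THEN iffD1], rule_format]])
  then show ?thesis
  proof eventually_elim
    case (elim n)
    then have "2 \<le> real n * t" "t + 1 \<le> real n" using t by (auto simp: field_simps)
    then have "2 \<le> real (Suc n) * t" "t + 1 \<le> real (Suc n)" using t by (auto simp: distrib_right)
    then show ?case by (simp add: cutoff_def)
  qed
qed

lemma mass_tendsto_0:
  assumes a: "a > 0" and [measurable]: "\<And>n. u n \<in> borel_measurable borel"
    and w: "integrable lborel w" "\<And>n t. norm (u n t) powr a \<le> w t"
    and lim: "AE t in lborel. (\<lambda>n. u n t) \<longlonglongrightarrow> 0"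
  shows "(\<lambda>n. mass a (u n)) \<longlonglongrightarrow> 0"
proof -
  have "(\<lambda>n. LINT t|lborel. norm (u n t) powr a) \<longlonglongrightarrow> integral\<^sup>L lborel (\<lambda>t::real. 0 :: real)"
  proof (rule integral_dominated_convergence[where M = lborel and f = "\<lambda>_. 0" and s = "\<lambda>n t. norm (u n t) powr a" and w = w])
    show "AE t in lborel. (\<lambda>n. norm (u n t) powr a) \<longlonglongrightarrow> 0"
      using lim by eventually_elim (use a in \<open>auto intro!: tendsto_eq_intros tendsto_powr2\<close>)
  qed (use w in auto)
  then show ?thesis by (simp add: mass_def)
qed

lemma Lpos_bounded:
  assumes [measurable]: "g \<in> borel_measurable borel" and u: "u > 0" and supp: "\<And>t. t \<notin> {u..v} \<Longrightarrow> g t = 0"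
    and B: "\<And>t. norm (g t) \<le> B" and a: "a \<ge> 0"
  shows "g \<in> Lpos a"
proof -
  have le: "norm (g t) powr a \<le> B powr a * indicator {u..v} t" for t
    using supp[of t] B[of t] a by (cases "t \<in> {u..v}") (auto intro: powr_mono2)
  have "integrable lborel (\<lambda>t. B powr a * indicator {u..v} t)"
    by (intro integrable_mult_right integrable_real_indicator) (auto simp: emeasure_lborel_Icc_eq)
  then have "integrable lborel (\<lambda>t. norm (g t) powr a)"
    by (rule Bochner_Integration.integrable_bound) (use le in auto)
  then show ?thesis using supp u by (auto simp: Lpos_def)
qed

text \<open>The measurability notion \<open>measurable_on\<close> of gauge integration is defined by
  almost everywhere limits of continuous functions, and it agrees with Lebesgue measurability. This
  stands in for Lusin's theorem.\<close>

lemma borel_ae_limit_continuous: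
  fixes f :: "real \<Rightarrow> complex"
  assumes "f \<in> borel_measurable borel"
  obtains g where "\<And>n. continuous_on UNIV (g n)" "AE t in lborel. (\<lambda>n::nat. g n t) \<longlonglongrightarrow> f t"
proof -
  have "f \<in> borel_measurable (lebesgue_on UNIV)"
    using assms by (simp add: lebesgue_on_UNIV_eq measurable_completion)
  then have "Equivalence_Measurable_On_Borel.measurable_on f UNIV"
    by (simp add: measurable_on_iff_borel_measurable)
  then obtain N g where N: "negligible N" and g: "\<And>n. continuous_on UNIV (g n)"
    and lim: "\<And>t. t \<notin> N \<Longrightarrow> (\<lambda>n::nat. g n t) \<longlonglongrightarrow> f t"
    unfolding measurable_on_def by auto
  have "AE t in lebesgue. (\<lambda>n::nat. g n t) \<longlonglongrightarrow> f t"
    using N lim by (intro AE_I'[of N]) (auto simp: negligible_iff_null_sets)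
  then show thesis using g that by (auto simp: AE_completion_iff)
qed

text \<open>Two dominated limits. Truncating f in size and support converges to f under a multiple
  of |f|^a. Then f is replaced inside a fixed truncation by continuous functions converging to it
  almost everywhere; the truncated functions share a bound and a compact support, which supplies the
  majorant even though the continuous functions themselves are uncontrolled.\<close>

lemma Lpos_approx:
  assumes a: "a \<ge> 1" and f: "f \<in> Lpos a" and e: "e > 0"
  obtains g u v B where "continuous_on UNIV g" "0 < u" "\<And>t. t \<notin> {u..v} \<Longrightarrow> g t = 0" "\<And>t. norm (g t) \<le> B"
    "g \<in> Lpos a" "mass a (\<lambda>t. f t - g t) < e"
proof -
  have fm [measurable]: "f \<in> borel_measurable borel" using f by (rule Lpos_measurable)
  have [measurable]: "cutoff m \<in> borel_measurable borel" "B > 0 \<Longrightarrow> clamp_norm B \<in> borel_measurable borel" for m B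
    by (auto intro!: borel_measurable_continuous_onI continuous_cutoff continuous_clamp_norm)
  \<comment> \<open>Both truncations are continuous, so this operation preserves continuity of h and
    respects pointwise convergence in h.\<close>
  define tr where "tr n h t = cutoff (real (Suc n)) t *\<^sub>R clamp_norm (real (Suc n)) (h t)" for n :: nat and h and t :: real
  have tr_m [measurable]: "tr n h \<in> borel_measurable borel" if [measurable]: "h \<in> borel_measurable borel" for n h
    unfolding tr_def[abs_def] by measurable
  have tr_le: "norm (tr n h t) \<le> real (Suc n)" "norm (tr n h t) \<le> norm (h t)" for n h t
    using cutoff_bounds[of "real (Suc n)" t] norm_clamp_norm[of "real (Suc n)" "h t"]
      mult_mono[of "cutoff (real (Suc n)) t" 1 "norm (clamp_norm (real (Suc n)) (h t))" "real (Suc n)"]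
      mult_mono[of "cutoff (real (Suc n)) t" 1 "norm (clamp_norm (real (Suc n)) (h t))" "norm (h t)"]
    by (auto simp: tr_def)
  have tr_supp: "tr n h t = 0" if "t \<notin> {1 / real (Suc n)..real (Suc n)}" for n h t
    using cutoff_zero[of "real (Suc n)" t] that by (simp add: tr_def)
  have tr_Lpos: "tr n h \<in> Lpos a" if "h \<in> borel_measurable borel" for n h
    by (rule Lpos_bounded[OF tr_m[OF that], where u = "1 / real (Suc n)"]) (use tr_supp tr_le a in auto)
  define e' where "e' = e / (2 powr a * 2)"
  have e': "e' > 0" using e by (simp add: e'_def)
  have "(\<lambda>n. mass a (\<lambda>t. f t - tr n f t)) \<longlonglongrightarrow> 0"
  proof (rule mass_tendsto_0)
    show "integrable lborel (\<lambda>t. 2 powr a * norm (f t) powr a)" using Lpos_integrable[OF f] by simp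
    show "norm (f t - tr n f t) powr a \<le> 2 powr a * norm (f t) powr a" for n t
      using tr_le(2)[of n f t] norm_triangle_ineq4[of "f t" "tr n f t"] a
      by (subst powr_mult[symmetric]) (auto intro: powr_mono2)
    show "AE t in lborel. (\<lambda>n. f t - tr n f t) \<longlonglongrightarrow> 0"
    proof (intro AE_I2)
      fix t
      show "(\<lambda>n. f t - tr n f t) \<longlonglongrightarrow> 0"
      proof (cases "t \<le> 0")
        case True
        then have "tr n f t = 0" for n using tr_le(2)[of n f t] Lpos_zero[OF f] by simp
        then show ?thesis using True Lpos_zero[OF f] by simp
      next
        case False
        have "\<forall>\<^sub>F n in sequentially. norm (f t) \<le> real n"
          by (rule eventually_ge_at_top[THEN filterlim_real_sequentially[THEN filterlim_iff[THEN iffD1], rule_format]])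
        moreover have "\<forall>\<^sub>F n in sequentially. cutoff (real (Suc n)) t = 1"
          using cutoff_eventually False by simp
        ultimately have "\<forall>\<^sub>F n in sequentially. f t - tr n f t = 0"
          by eventually_elim (simp add: tr_def clamp_norm_eq)
        then show ?thesis by (simp add: tendsto_eventually)
      qed
    qed
  qed (use a in auto)
  then have "\<forall>\<^sub>F n in sequentially. mass a (\<lambda>t. f t - tr n f t) < e'"
    using e' order_tendstoD(2) by blast
  then obtain m where m: "mass a (\<lambda>t. f t - tr m f t) < e'"
    using eventually_happens' sequentially_bot by blast
  obtain g where g: "\<And>n. continuous_on UNIV (g n)" and lim: "AE t in lborel. (\<lambda>n::nat. g n t) \<longlonglongrightarrow> f t"
    using borel_ae_limit_continuous[OF fm] by metis
  have [measurable]: "g n \<in> borel_measurable borel" for n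
    by (intro borel_measurable_continuous_onI g)
  have "(\<lambda>n. mass a (\<lambda>t. tr m f t - tr m (g n) t)) \<longlonglongrightarrow> 0"
  proof (rule mass_tendsto_0)
    show "integrable lborel (\<lambda>t. (2 * real (Suc m)) powr a * indicator {1 / real (Suc m)..real (Suc m)} t)"
      by (intro integrable_mult_right integrable_real_indicator) (auto simp: emeasure_lborel_Icc_eq)
    show "norm (tr m f t - tr m (g n) t) powr a \<le> (2 * real (Suc m)) powr a * indicator {1 / real (Suc m)..real (Suc m)} t" for n t
    proof (cases "t \<in> {1 / real (Suc m)..real (Suc m)}")
      case True
      have "norm (tr m f t - tr m (g n) t) \<le> 2 * real (Suc m)"
        using tr_le(1)[of m f t] tr_le(1)[of m "g n" t] norm_triangle_ineq4[of "tr m f t" "tr m (g n) t"] by (simp only: mult_2)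
      then show ?thesis using True a by (auto intro: powr_mono2)
    qed (simp add: tr_supp)
    show "AE t in lborel. (\<lambda>n. tr m f t - tr m (g n) t) \<longlonglongrightarrow> 0"
      using lim
    proof eventually_elim
      case (elim t)
      have "continuous_on UNIV (clamp_norm (real (Suc m)))" by (rule continuous_clamp_norm) simp
      then have "(\<lambda>n. clamp_norm (real (Suc m)) (g n t)) \<longlonglongrightarrow> clamp_norm (real (Suc m)) (f t)"
        using elim by (rule continuous_on_tendsto_compose) auto
      then have "(\<lambda>n. tr m f t - tr m (g n) t) \<longlonglongrightarrow> tr m f t - tr m f t"
        unfolding tr_def by (intro tendsto_intros)
      then show ?case by simp
    qed
  qed (use a in auto)
  then have "\<forall>\<^sub>F n in sequentially. mass a (\<lambda>t. tr m f t - tr m (g n) t) < e'"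
    using e' order_tendstoD(2) by blast
  then obtain n where n: "mass a (\<lambda>t. tr m f t - tr m (g n) t) < e'"
    using eventually_happens' sequentially_bot by blast
  show thesis
  proof (rule that[of "tr m (g n)" "1 / real (Suc m)" "real (Suc m)" "real (Suc m)"])
    show "continuous_on UNIV (tr m (g n))"
      unfolding tr_def[abs_def]
      by (intro continuous_intros continuous_cutoff continuous_on_compose2[OF continuous_clamp_norm[of _ UNIV] g]) auto
    have "mass a (\<lambda>t. f t - tr m (g n) t) = mass a (\<lambda>t. (f t - tr m f t) + (tr m f t - tr m (g n) t))" by simp
    also have "\<dots> \<le> 2 powr a * (mass a (\<lambda>t. f t - tr m f t) + mass a (\<lambda>t. tr m f t - tr m (g n) t))"
      using a f fm by (intro Lpos_add Lpos_diff tr_Lpos) auto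
    also have "\<dots> < 2 powr a * (e' + e')" using m n by (intro mult_strict_left_mono add_strict_mono) auto
    also have "\<dots> = e" by (simp add: e'_def)
    finally show "mass a (\<lambda>t. f t - tr m (g n) t) < e" .
  qed (use tr_supp tr_le tr_Lpos in auto)
qed

text \<open>Treats translations (c = 1) and dilations (d = 0) together. The factor w compensates the
  Jacobian, and d >= 0 keeps the support in the half-line.\<close>

lemma mass_affine:
  assumes f: "f \<in> Lpos a" and c: "c > 0" and d: "d \<ge> 0" and w: "w \<ge> 0" "w powr a = c"
  shows "(\<lambda>s. w *\<^sub>R f (c * s - d)) \<in> Lpos a" and "mass a (\<lambda>s. w *\<^sub>R f (c * s - d)) = mass a f"
proof -
  have [measurable]: "f \<in> borel_measurable borel" using f by (rule Lpos_measurable)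
  have pw: "norm (w *\<^sub>R f (c * s - d)) powr a = c * norm (f (- d + c * s)) powr a" for s
    using w by (simp add: powr_mult add.commute)
  have int: "integrable lborel (\<lambda>s. norm (f (- d + c * s)) powr a)"
    using lborel_integrable_real_affine[OF Lpos_integrable[OF f], of c "- d"] c by simp
  have "f (c * s - d) = 0" if "s \<le> 0" for s
    using mult_nonneg_nonpos[of c s] that c d by (intro Lpos_zero[OF f]) auto
  then show "(\<lambda>s. w *\<^sub>R f (c * s - d)) \<in> Lpos a"
    unfolding Lpos_def mem_Collect_eq pw using int by auto
  show "mass a (\<lambda>s. w *\<^sub>R f (c * s - d)) = mass a f"
    unfolding mass_def pw
    using lborel_integral_real_affine[of c "\<lambda>t. norm (f t) powr a" "- d"] c by simp
qed

text \<open>The maps are isometries, so f may be replaced by a continuous g of compact support at a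
  cost uniform in n; for g the claim is dominated convergence.\<close>

lemma affine_continuity:
  fixes w c d :: "nat \<Rightarrow> real"
  assumes a: "a \<ge> 1" and f: "f \<in> Lpos a"
    and c: "\<And>n. c n > 0" and d: "\<And>n. d n \<ge> 0" and w: "\<And>n. w n \<ge> 0" "\<And>n. w n powr a = c n"
    and lim: "w \<longlonglongrightarrow> 1" "c \<longlonglongrightarrow> 1" "d \<longlonglongrightarrow> 0"
  shows "(\<lambda>n. mass a (\<lambda>s. w n *\<^sub>R f (c n * s - d n) - f s)) \<longlonglongrightarrow> 0"
proof (rule LIMSEQ_I)
  fix e :: real assume e: "e > 0"
  \<comment> \<open>Three errors: the transported f - g, the motion of g, and g - f. They are added
    by two nested uses of \<open>Lpos_add\<close>, each costing 2^a.\<close>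
  define e' where "e' = e / (2 powr a * (2 powr a * 3))"
  have e': "e' > 0" using e by (simp add: e'_def)
  obtain g u v B where g: "continuous_on UNIV g" "0 < u" "\<And>t. t \<notin> {u..v} \<Longrightarrow> g t = 0" "\<And>t. norm (g t) \<le> B"
    "g \<in> Lpos a" "mass a (\<lambda>t. f t - g t) < e'"
    using Lpos_approx[OF a f e'] by metis
  have [measurable]: "f \<in> borel_measurable borel" "g \<in> borel_measurable borel"
    using f g(5) by (auto intro: Lpos_measurable)
  have "\<forall>\<^sub>F n in sequentially. w n < 2" "\<forall>\<^sub>F n in sequentially. c n > 1 / 2" "\<forall>\<^sub>F n in sequentially. d n < 1"
    using order_tendstoD(2)[OF lim(1), of 2] order_tendstoD(1)[OF lim(2), of "1 / 2"] order_tendstoD(2)[OF lim(3), of 1]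
    by auto
  then have "\<forall>\<^sub>F n in sequentially. w n < 2 \<and> c n > 1 / 2 \<and> d n < 1"
    by eventually_elim auto
  then obtain N where N: "\<And>n. n \<ge> N \<Longrightarrow> w n < 2 \<and> c n > 1 / 2 \<and> d n < 1"
    unfolding eventually_sequentially by blast
  have B: "B \<ge> 0" using order_trans[OF norm_ge_zero g(4)] .
  have "(\<lambda>n. mass a (\<lambda>s. w (n + N) *\<^sub>R g (c (n + N) * s - d (n + N)) - g s)) \<longlonglongrightarrow> 0"
  proof (rule mass_tendsto_0)
    \<comment> \<open>For late n one has c > 1/2 and d < 1, so c s - d <= v forces s <= 2 (v + 1).
      Outside this interval both g(s) and its moved copy vanish.\<close>
    let ?J = "{0..2 * \<bar>v\<bar> + 2}"
    show "integrable lborel (\<lambda>s. (3 * B) powr a * indicator ?J s)" by simp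
    show "norm (w (n + N) *\<^sub>R g (c (n + N) * s - d (n + N)) - g s) powr a \<le> (3 * B) powr a * indicator ?J s" for n s
    proof (cases "s \<in> ?J")
      case True
      have "norm (w (n + N) *\<^sub>R g (c (n + N) * s - d (n + N)) - g s) \<le> w (n + N) * norm (g (c (n + N) * s - d (n + N))) + norm (g s)"
        using norm_triangle_ineq4[of "w (n + N) *\<^sub>R g (c (n + N) * s - d (n + N))" "g s"] w(1)[of "n + N"] by simp
      also have "\<dots> \<le> 2 * B + B"
        using N[of "n + N"] w(1)[of "n + N"] g(4) B by (intro add_mono mult_mono) auto
      finally show ?thesis using True a by (auto intro: powr_mono2)
    next
      case False
      have "g s = 0" using False g(2) by (intro g(3)) auto
      moreover have "g (c (n + N) * s - d (n + N)) = 0"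
      proof (cases "s < 0")
        case True
        then have "c (n + N) * s < 0" using c[of "n + N"] by (simp add: mult_pos_neg)
        then show ?thesis using d[of "n + N"] g(2) by (intro g(3)) auto
      next
        case s: False
        have "1 / 2 * s \<le> c (n + N) * s" using N[of "n + N"] s by (intro mult_right_mono) auto
        then show ?thesis using False s N[of "n + N"] by (intro g(3)) auto
      qed
      ultimately show ?thesis by simp
    qed
    show "AE s in lborel. (\<lambda>n. w (n + N) *\<^sub>R g (c (n + N) * s - d (n + N)) - g s) \<longlonglongrightarrow> 0"
    proof (intro AE_I2)
      fix s
      have "(\<lambda>n. c n * s - d n) \<longlonglongrightarrow> 1 * s - 0" by (intro tendsto_intros lim)
      then have "(\<lambda>n. g (c n * s - d n)) \<longlonglongrightarrow> g s"
        using continuous_on_tendsto_compose[OF g(1)] by simp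
      then have "(\<lambda>n. w n *\<^sub>R g (c n * s - d n) - g s) \<longlonglongrightarrow> 1 *\<^sub>R g s - g s"
        by (intro tendsto_intros lim)
      then show "(\<lambda>n. w (n + N) *\<^sub>R g (c (n + N) * s - d (n + N)) - g s) \<longlonglongrightarrow> 0"
        using LIMSEQ_ignore_initial_segment[of "\<lambda>n. w n *\<^sub>R g (c n * s - d n) - g s" _ N] by simp
    qed
  qed (use a in auto)
  then have "(\<lambda>n. mass a (\<lambda>s. w n *\<^sub>R g (c n * s - d n) - g s)) \<longlonglongrightarrow> 0"
    by (rule LIMSEQ_offset)
  then have "\<forall>\<^sub>F n in sequentially. mass a (\<lambda>s. w n *\<^sub>R g (c n * s - d n) - g s) < e'"
    using e' order_tendstoD(2) by blast
  then obtain M where M: "\<And>n. n \<ge> M \<Longrightarrow> mass a (\<lambda>s. w n *\<^sub>R g (c n * s - d n) - g s) < e'"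
    unfolding eventually_sequentially by blast
  have "norm (mass a (\<lambda>s. w n *\<^sub>R f (c n * s - d n) - f s) - 0) < e" if "n \<ge> M" for n
  proof -
    have fg: "(\<lambda>s. f s - g s) \<in> Lpos a" and gf: "(\<lambda>s. g s - f s) \<in> Lpos a"
      using a by (auto intro: Lpos_diff f g(5))
    have m_gf: "mass a (\<lambda>s. g s - f s) < e'" using g(6) by (simp add: mass_def norm_minus_commute)
    let ?D = "\<lambda>s. w n *\<^sub>R (f (c n * s - d n) - g (c n * s - d n))"
    let ?E = "\<lambda>s. w n *\<^sub>R g (c n * s - d n) - g s"
    have D: "?D \<in> Lpos a" "mass a ?D < e'"
      using mass_affine[OF fg c d w(1) w(2), of n n] g(6) by (auto simp: mass_def)
    have E: "?E \<in> Lpos a" "mass a ?E < e'"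
      using Lpos_diff(1)[OF _ mass_affine(1)[OF g(5) c d w] g(5), of n n] a M[OF that] by auto
    have F: "(\<lambda>s. ?E s + (g s - f s)) \<in> Lpos a" "mass a (\<lambda>s. ?E s + (g s - f s)) < 2 powr a * (2 * e')"
      using Lpos_add[OF _ E(1) gf] a E(2) m_gf by (auto intro: order_le_less_trans)
    have "mass a (\<lambda>s. w n *\<^sub>R f (c n * s - d n) - f s) = mass a (\<lambda>s. ?D s + (?E s + (g s - f s)))"
      by (simp add: algebra_simps)
    also have "\<dots> \<le> 2 powr a * (mass a ?D + mass a (\<lambda>s. ?E s + (g s - f s)))"
      using a by (intro Lpos_add D F) auto
    also have "\<dots> < 2 powr a * (e' + 2 powr a * (2 * e'))"
      using D F by (intro mult_strict_left_mono add_strict_mono) auto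
    also have "\<dots> \<le> 2 powr a * (2 powr a * e' + 2 powr a * (2 * e'))"
      using e' a ge_one_powr_ge_zero[of 2 a] by (intro mult_left_mono add_right_mono) (auto simp: mult_le_cancel_right1)
    also have "\<dots> = e" by (simp add: e'_def distrib_left[symmetric])
    finally show ?thesis using mass_nonneg[of a] by simp
  qed
  then show "\<exists>no. \<forall>n\<ge>no. norm (mass a (\<lambda>s. w n *\<^sub>R f (c n * s - d n) - f s) - 0) < e" by blast
qed

section \<open>The endpoint a = 1: Riemann-Lebesgue on the closed half-plane\<close>

text \<open>Shifts go to the right only, since these preserve support in the half-line. A failing
  \<delta> of the form 1/(n+1) for every n would give a sequence contradicting
  \<open>affine_continuity\<close>.\<close>

lemma translation_continuity:
  assumes f: "f \<in> Lpos a" and a: "a \<ge> 1" and e: "e > 0"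
  obtains \<delta> where "\<delta> > 0" "\<And>\<tau>. 0 \<le> \<tau> \<Longrightarrow> \<tau> < \<delta> \<Longrightarrow> mass a (\<lambda>s. f (s - \<tau>) - f s) < e"
proof (rule ccontr)
  assume "\<not> thesis"
  then have "\<exists>\<tau>. 0 \<le> \<tau> \<and> \<tau> < 1 / real (Suc n) \<and> mass a (\<lambda>s. f (s - \<tau>) - f s) \<ge> e" for n
    using that[of "1 / real (Suc n)"] by (auto simp: not_less[symmetric])
  then obtain \<tau> where \<tau>: "\<And>n. 0 \<le> \<tau> n" "\<And>n. \<tau> n < 1 / real (Suc n)"
      "\<And>n. mass a (\<lambda>s. f (s - \<tau> n) - f s) \<ge> e"
    by metis
  have "\<tau> \<longlonglongrightarrow> 0"
    by (rule tendsto_sandwich[OF _ _ tendsto_const LIMSEQ_Suc[OF lim_1_over_n]])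
       (use \<tau> in \<open>auto intro!: always_eventually less_imp_le\<close>)
  then have "(\<lambda>n. mass a (\<lambda>s. 1 *\<^sub>R f (1 * s - \<tau> n) - f s)) \<longlonglongrightarrow> 0"
    using \<tau> by (intro affine_continuity a f) auto
  then have "e \<le> 0"
    using \<tau>(3) by (intro LIMSEQ_le_const[of _ 0 e]) auto
  then show False using e by simp
qed

lemma Lpos_1_integrable: "f \<in> Lpos 1 \<Longrightarrow> integrable lborel f"
  by (rule Bochner_Integration.integrable_bound[OF Lpos_integrable]) (auto simp: Lpos_measurable)

lemma laplace_boundary_integrable:
  assumes f: "f \<in> Lpos 1" and z: "Re z \<ge> 0"
  shows "integrable lborel (\<lambda>t. f t * exp (- z * complex_of_real t))"
    and "norm (f t * exp (- z * complex_of_real t)) \<le> norm (f t)"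
    and "norm (LINT t|lborel. f t * exp (- z * complex_of_real t)) \<le> mass 1 f"
proof -
  have [measurable]: "f \<in> borel_measurable borel" using f by (rule Lpos_measurable)
  have le: "norm (f t * exp (- z * complex_of_real t)) \<le> norm (f t)" for t
  proof (cases "t \<le> 0")
    case False
    then have "norm (f t) * exp (- Re z * t) \<le> norm (f t) * 1" using z by (intro mult_left_mono) auto
    then show ?thesis by (simp add: norm_mult norm_exp_eq_Re)
  qed (simp add: Lpos_zero[OF f])
  then show "norm (f t * exp (- z * complex_of_real t)) \<le> norm (f t)" .
  show int: "integrable lborel (\<lambda>t. f t * exp (- z * complex_of_real t))"
    by (rule Bochner_Integration.integrable_bound[OF Lpos_1_integrable[OF f]]) (use le in auto)
  have "norm (LINT t|lborel. f t * exp (- z * complex_of_real t)) \<le> (LINT t|lborel. norm (f t * exp (- z * complex_of_real t)))"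
    by (rule integral_norm_bound)
  also have "\<dots> \<le> (LINT t|lborel. norm (f t))"
    using le int Lpos_1_integrable[OF f] by (intro integral_mono integrable_norm)
  finally show "norm (LINT t|lborel. f t * exp (- z * complex_of_real t)) \<le> mass 1 f"
    by (simp add: mass_def)
qed

text \<open>Shifting f by \<tau> multiplies its transform by exp(-z \<tau>), so |G(z)| |exp(-z
  \<tau>) - 1| is at most the L_1 distance between f and its shift. With \<tau> of order 1/|z| the
  second factor stays away from 0 while the distance tends to 0, uniformly over all directions in
  the closed half-plane.\<close>

lemma laplace_A0:
  assumes f: "f \<in> Lpos 1"
  shows "laplace f \<in> A0"
proof -
  have [measurable]: "f \<in> borel_measurable borel" using f by (rule Lpos_measurable)
  define G where "G z = (LINT t|lborel. f t * exp (- z * complex_of_real t))" for z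
  have cont: "continuous_on {z. Re z \<ge> 0} G"
    unfolding continuous_on_sequentially comp_def
  proof (intro allI ballI impI)
    fix X :: "nat \<Rightarrow> complex" and z assume z: "z \<in> {z. Re z \<ge> 0}" and X: "(\<forall>n. X n \<in> {z. Re z \<ge> 0}) \<and> X \<longlonglongrightarrow> z"
    show "(\<lambda>n. G (X n)) \<longlonglongrightarrow> G z"
      unfolding G_def
    proof (rule integral_dominated_convergence)
      show "integrable lborel (\<lambda>t. norm (f t))" using Lpos_1_integrable[OF f] by simp
      show "AE t in lborel. norm (f t * exp (- X n * complex_of_real t)) \<le> norm (f t)" for n
        using X laplace_boundary_integrable(2)[OF f] by auto
      show "AE t in lborel. (\<lambda>n. f t * exp (- X n * complex_of_real t)) \<longlonglongrightarrow> f t * exp (- z * complex_of_real t)"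
        using X by (intro AE_I2 tendsto_intros) auto
    qed auto
  qed
  have shift: "norm (G z) * norm (exp (- z * complex_of_real \<tau>) - 1) \<le> mass 1 (\<lambda>s. f (s - \<tau>) - f s)"
    if z: "Re z \<ge> 0" and \<tau>: "\<tau> \<ge> 0" for z \<tau>
  proof -
    have f\<tau>: "(\<lambda>s. f (s - \<tau>)) \<in> Lpos 1"
      using mass_affine(1)[OF f, of 1 \<tau> 1] \<tau> by simp
    have "(LINT s|lborel. f (s - \<tau>) * exp (- z * complex_of_real s))
        = (LINT s|lborel. exp (- z * complex_of_real \<tau>) * (f s * exp (- z * complex_of_real s)))"
    proof (subst lborel_integral_real_affine[of 1 _ \<tau>])
      have "exp (- z * complex_of_real (\<tau> + 1 * s)) = exp (- z * complex_of_real \<tau>) * exp (- z * complex_of_real s)" for s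
        by (simp only: exp_add[symmetric]) (simp add: algebra_simps)
      then show "\<bar>1\<bar> *\<^sub>R (LINT s|lborel. f (\<tau> + 1 * s - \<tau>) * exp (- z * complex_of_real (\<tau> + 1 * s)))
          = (LINT s|lborel. exp (- z * complex_of_real \<tau>) * (f s * exp (- z * complex_of_real s)))"
        by (simp only:) (simp add: mult_ac)
    qed simp
    then have "(LINT s|lborel. (f (s - \<tau>) - f s) * exp (- z * complex_of_real s)) = exp (- z * complex_of_real \<tau>) * G z - G z"
      using laplace_boundary_integrable(1)[OF f z] laplace_boundary_integrable(1)[OF f\<tau> z]
      by (simp add: left_diff_distrib G_def)
    then have "norm (exp (- z * complex_of_real \<tau>) * G z - G z) \<le> mass 1 (\<lambda>s. f (s - \<tau>) - f s)"
      using laplace_boundary_integrable(3)[OF Lpos_diff(1)[OF _ f\<tau> f] z] by simp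
    moreover have "exp (- z * complex_of_real \<tau>) * G z - G z = G z * (exp (- z * complex_of_real \<tau>) - 1)"
      by (simp add: algebra_simps)
    ultimately show ?thesis by (simp only: norm_mult)
  qed
  have lim: "(G \<longlongrightarrow> 0) (inf at_infinity (principal {z. Re z \<ge> 0}))"
    unfolding tendsto_iff eventually_inf_principal eventually_at_infinity
  proof (intro allI impI)
    fix e :: real assume e: "e > 0"
    obtain \<delta> where \<delta>: "\<delta> > 0" "\<And>\<tau>. 0 \<le> \<tau> \<Longrightarrow> \<tau> < \<delta> \<Longrightarrow> mass 1 (\<lambda>s. f (s - \<tau>) - f s) < e / 4"
      using translation_continuity[OF f, of "e / 4"] e by auto
    show "\<exists>b. \<forall>x. b \<le> norm x \<longrightarrow> x \<in> {z. 0 \<le> Re z} \<longrightarrow> dist (G x) 0 < e"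
    proof (intro exI[of _ "1 / \<delta>"] allI impI)
      fix z assume z: "1 / \<delta> \<le> norm z" "z \<in> {z. 0 \<le> Re z}"
      have nz: "norm z > 0" using z(1) \<delta>(1) by (auto intro: less_le_trans[of 0 "1 / \<delta>"])
      \<comment> \<open>This makes |z \<tau>| = 1/2, where |exp w - 1| is at least 1/4; and |z| >=
        1/\<delta> gives \<tau> < \<delta>.\<close>
      define \<tau> where "\<tau> = 1 / (2 * norm z)"
      have \<tau>: "\<tau> > 0" "\<tau> < \<delta>" "norm (z * complex_of_real \<tau>) = 1 / 2"
        using nz z(1) \<delta>(1) by (auto simp: \<tau>_def field_simps norm_mult norm_divide)
      have "1 / 4 \<le> norm (exp (- z * complex_of_real \<tau>) - 1)"
        using norm_exp_bounds(1)[of "- z * complex_of_real \<tau>"] \<tau>(3) by simp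
      then have "norm (G z) * (1 / 4) \<le> norm (G z) * norm (exp (- z * complex_of_real \<tau>) - 1)"
        by (intro mult_left_mono) auto
      also have "\<dots> < e / 4"
        using shift[of z \<tau>] \<delta>(2)[of \<tau>] z(2) \<tau> by auto
      finally show "dist (G z) 0 < e" by simp
    qed
  qed
  show ?thesis
    unfolding A0_def
  proof (intro CollectI conjI exI[of _ G])
    show "\<forall>z\<in>right_half_plane. G z = laplace f z"
      by (simp add: G_def right_half_plane_def laplace_eq_lborel[OF f])
  qed (use laplace_holomorphic[OF _ f] cont lim in auto)
qed

section \<open>All exponents together, and the dilation groups\<close>

text \<open>The case a = 1 is split off because the real quotient a / (a - 1) is 0 there by the
  convention on division by zero.\<close>

definition conj_exp :: "real \<Rightarrow> ennreal" where
  "conj_exp a = (if a = 1 then \<infinity> else ennreal (a / (a - 1)))"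

lemma laplace_bounded_gt:
  assumes a: "1 \<le> a" "a \<le> 2"
  obtains C where "C > 0" "\<And>f. f \<in> Lpos a \<Longrightarrow> laplace f \<in> hardy_space (conj_exp a)"
    "\<And>f c. f \<in> Lpos a \<Longrightarrow> c > 0 \<Longrightarrow> mass a f \<le> c powr a \<Longrightarrow> hardy_norm (conj_exp a) (laplace f) \<le> C * c"
proof (cases "a = 1")
  case True
  show thesis
  proof (rule that[of 1])
    fix f :: "real \<Rightarrow> complex" and c :: real assume f: "f \<in> Lpos a" and c: "c > 0" "mass a f \<le> c powr a"
    have "norm (laplace f z) \<le> c" if "z \<in> right_half_plane" for z
      using laplace_boundary_integrable(3)[of f z] f c that True
      by (simp add: laplace_eq_lborel[OF f] right_half_plane_def)
    \<comment> \<open>The half-plane must be seen to be nonempty before a real supremum over it can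
      be bounded.\<close>
    moreover have "(1 :: complex) \<in> right_half_plane" by (simp add: right_half_plane_def)
    ultimately show "hardy_norm (conj_exp a) (laplace f) \<le> 1 * c"
      using True by (auto simp: hardy_norm_def conj_exp_def intro!: cSUP_least)
  qed (use True laplace_A0 in \<open>auto simp: hardy_space_def conj_exp_def\<close>)
next
  case False
  then show thesis
    using laplace_hardy_finite[of a "conj_exp a"] a that by (auto simp: conj_exp_def)
qed

text \<open>The factor \<open>exp (\<tau> / a)\<close> makes this an isometry of \<open>L\<^sub>a\<close>.\<close>

definition dil :: "real \<Rightarrow> real \<Rightarrow> (real \<Rightarrow> complex) \<Rightarrow> real \<Rightarrow> complex" where
  "dil a \<tau> f s = exp (\<tau> / a) *\<^sub>R f (exp \<tau> * s)"

lemma exp_powr_cancel: "a > 0 \<Longrightarrow> exp (\<tau> / a) powr a = (exp \<tau> :: real)"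
  by (simp add: powr_def)

lemma dil_Lpos:
  assumes "f \<in> Lpos a" "a > 0"
  shows "dil a \<tau> f \<in> Lpos a" "mass a (dil a \<tau> f) = mass a f"
  using mass_affine[OF assms(1), of "exp \<tau>" 0 "exp (\<tau> / a)"] assms(2)
  by (auto simp: dil_def[abs_def] exp_powr_cancel)

lemma dil_continuity:
  assumes f: "f \<in> Lpos a" and a: "a \<ge> 1" and e: "e > 0"
  obtains \<delta> where "\<delta> > 0" "\<And>\<tau>. \<bar>\<tau>\<bar> < \<delta> \<Longrightarrow> mass a (\<lambda>s. dil a \<tau> f s - f s) < e"
proof (rule ccontr)
  assume "\<not> thesis"
  then have "\<exists>\<tau>. \<bar>\<tau>\<bar> < 1 / real (Suc n) \<and> mass a (\<lambda>s. dil a \<tau> f s - f s) \<ge> e" for n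
    using that[of "1 / real (Suc n)"] by (auto simp: not_less[symmetric])
  then obtain \<tau> where \<tau>: "\<And>n. \<bar>\<tau> n\<bar> < 1 / real (Suc n)" "\<And>n. mass a (\<lambda>s. dil a (\<tau> n) f s - f s) \<ge> e"
    by metis
  have "\<tau> \<longlonglongrightarrow> 0"
    by (rule Lim_null_comparison[OF _ LIMSEQ_Suc[OF lim_1_over_n]])
       (use \<tau> in \<open>auto intro!: always_eventually less_imp_le\<close>)
  then have "(\<lambda>n. exp (\<tau> n / a)) \<longlonglongrightarrow> exp (0 / a)" "(\<lambda>n. exp (\<tau> n)) \<longlonglongrightarrow> exp 0"
    using a by (intro tendsto_intros \<open>\<tau> \<longlonglongrightarrow> 0\<close>; simp)+
  then have "(\<lambda>n. mass a (\<lambda>s. exp (\<tau> n / a) *\<^sub>R f (exp (\<tau> n) * s - 0) - f s)) \<longlonglongrightarrow> 0"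
    using a by (intro affine_continuity f) (auto simp: exp_powr_cancel)
  then have "e \<le> 0"
    using \<tau>(2) by (intro LIMSEQ_le_const[of _ 0 e]) (auto simp: dil_def)
  then show False using e by simp
qed

lemma dil_dil: "dil a \<tau> (dil a \<sigma> f) = dil a (\<tau> + \<sigma>) f"
  by (simp add: dil_def fun_eq_iff exp_add[symmetric] add_divide_distrib mult.assoc[symmetric] add.commute)

text \<open>The substitution contributes exp \<tau>, and 1/b = 1 - 1/a turns the isometry factor on
  the Hardy side into the one on L_a. The exponent b enters only through 1/b, so b = \<infinity> is
  covered as well.\<close>

lemma laplace_dil:
  assumes f: "f \<in> Lpos a" and a: "a \<ge> 1" and b: "enn2real (1 / b) = 1 - 1 / a"
  shows "laplace (dil a \<tau> f) = dilation b \<tau> (laplace f)"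
proof (rule ext)
  fix z
  show "laplace (dil a \<tau> f) z = dilation b \<tau> (laplace f) z"
  proof (cases "Re z > 0")
    case True
    have "laplace f (exp (- \<tau>) *\<^sub>R z) = (LINT t|lborel. f t * exp (- (exp (- \<tau>) *\<^sub>R z) * complex_of_real t))"
      using True by (intro laplace_eq_lborel[OF f]) simp
    also have "\<dots> = exp \<tau> *\<^sub>R (LINT t|lborel. f (exp \<tau> * t) * exp (- z * complex_of_real t))"
      by (subst lborel_integral_real_affine[of "exp \<tau>" _ 0])
         (simp_all add: scaleR_conv_of_real exp_minus field_simps flip: exp_of_real)
    finally have "dilation b \<tau> (laplace f) z = (exp (- \<tau> * (1 - 1 / a)) * exp \<tau>) *\<^sub>R (LINT t|lborel. f (exp \<tau> * t) * exp (- z * complex_of_real t))"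
      by (simp add: dilation_def b)
    also have "exp (- \<tau> * (1 - 1 / a)) * exp \<tau> = exp (\<tau> / a)"
      by (simp add: exp_add[symmetric] algebra_simps)
    also have "exp (\<tau> / a) *\<^sub>R (LINT t|lborel. f (exp \<tau> * t) * exp (- z * complex_of_real t)) = laplace (dil a \<tau> f) z"
      using True dil_Lpos(1)[OF f, of \<tau>] a by (simp add: laplace_eq_lborel[where a = a] dil_def)
    finally show ?thesis by simp
  qed (simp add: laplace_outside dilation_def mult_le_0_iff not_less)
qed

section \<open>Weighted means\<close>

lemma powr_tangent_le:
  fixes x m a :: real
  assumes a: "a \<ge> 1" and x: "x \<ge> 0" and m: "m > 0"
  shows "m powr a + a * m powr (a - 1) * (x - m) \<le> x powr a"
proof (cases "x = 0")
  \<comment> \<open>The tangent argument below takes place on the open half-line, so x = 0 is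
    checked by hand.\<close>
  case True
  have "m powr a * 1 \<le> m powr a * a" using a by (intro mult_left_mono) auto
  moreover have "m powr (a - 1) * m = m powr a" using m by (simp add: powr_diff)
  ultimately show ?thesis using True by (simp add: mult_ac)
next
  case False
  have "(a * m powr (a - 1)) * (x - m) \<le> x powr a - m powr a"
  proof (rule convex_on_imp_above_tangent[OF powr_convex[OF a]])
    show "((\<lambda>x. x powr a) has_real_derivative a * m powr (a - 1)) (at m within {0<..})"
      using m by (auto intro!: derivative_eq_intros)
  qed (use False x m in \<open>auto simp: interior_open\<close>)
  then show ?thesis by simp
qed

text \<open>Jensen's inequality with an unnormalised weight: the tangent inequality at the weighted
  mean m of v is multiplied by w and integrated, whereupon the linear term cancels. The tangent
  point has to be positive, which is why a vanishing weight or mean is treated apart.\<close>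

lemma powr_weighted_mean_le:
  fixes w v :: "'a \<Rightarrow> real"
  assumes a: "a \<ge> 1" and w: "integrable M w" "\<And>t. w t \<ge> 0"
    and v: "v \<in> borel_measurable M" "\<And>t. v t \<ge> 0" and wv: "integrable M (\<lambda>t. w t * v t powr a)"
  shows "integrable M (\<lambda>t. w t * v t)"
    and "(LINT t|M. w t * v t) powr a \<le> (LINT t|M. w t) powr (a - 1) * (LINT t|M. w t * v t powr a)"
proof -
  have [measurable]: "w \<in> borel_measurable M" "v \<in> borel_measurable M" using w v by auto
  have le: "w t * v t \<le> w t + w t * v t powr a" for t
    using mult_left_mono[OF norm_le_one_plus_powr[OF a, of "v t"] w(2)[of t]] v(2)[of t] by (simp add: distrib_left)
  show int: "integrable M (\<lambda>t. w t * v t)"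
    by (rule Bochner_Integration.integrable_bound[OF Bochner_Integration.integrable_add[OF w(1) wv]])
       (use le w v in \<open>auto intro!: AE_I2 order_trans[OF le]\<close>)
  let ?V = "LINT t|M. w t" and ?I = "LINT t|M. w t * v t"
  have V: "?V \<ge> 0" and I: "?I \<ge> 0" using w v by (auto intro: Bochner_Integration.integral_nonneg)
  show "?I powr a \<le> ?V powr (a - 1) * (LINT t|M. w t * v t powr a)"
  proof (cases "?V = 0 \<or> ?I = 0")
    case True
    have "?I = 0"
    proof (cases "?V = 0")
      case True
      then have "AE t in M. w t = 0" using integral_nonneg_eq_0_iff_AE[OF w(1)] w(2) by auto
      then have "?I = (LINT t|M. 0)" by (intro integral_cong_AE) auto
      then show ?thesis by simp
    qed (use True in auto)
    then show ?thesis using w v by (simp add: Bochner_Integration.integral_nonneg)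
  next
    case False
    define m where "m = ?I / ?V"
    have m: "m > 0" using False V I by (simp add: m_def)
    have "m powr a * ?V = (LINT t|M. m powr a * w t + a * m powr (a - 1) * (w t * v t - m * w t))"
      using w(1) int False by (simp add: m_def)
    also have "\<dots> \<le> (LINT t|M. w t * v t powr a)"
    proof (rule integral_mono)
      fix t
      show "m powr a * w t + a * m powr (a - 1) * (w t * v t - m * w t) \<le> w t * v t powr a"
        using mult_left_mono[OF powr_tangent_le[OF a v(2)[of t] m] w(2)[of t]] by (simp add: algebra_simps)
    qed (use w(1) int wv in auto)
    finally have "?V powr (a - 1) * (m powr a * ?V) \<le> ?V powr (a - 1) * (LINT t|M. w t * v t powr a)"
      by (intro mult_left_mono) auto
    moreover have "?V powr (a - 1) * (m powr a * ?V) = (m * ?V) powr a"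
      using False V m by (simp add: powr_mult powr_diff)
    moreover have "m * ?V = ?I" using False by (simp add: m_def)
    ultimately show ?thesis by simp
  qed
qed

text \<open>A Minkowski integral inequality: Jensen pointwise in s, then Fubini, giving W^(a-1)
  times W B. The same integrability over the product yields absolute convergence for almost every s
  and lets the Laplace transform pass under the mean. At the exceptional s the value of
  \<open>K\<close> is the default 0 of a divergent integral.\<close>

lemma Lpos_weighted_mean:
  fixes U :: "real \<times> real \<Rightarrow> complex" and w :: "real \<Rightarrow> real"
  assumes a: "a \<ge> 1" and w: "integrable lborel w" "\<And>t. w t \<ge> 0" and W: "(LINT t|lborel. w t) \<le> W"
    and U [measurable]: "U \<in> borel_measurable (borel \<Otimes>\<^sub>M borel)"
    and u: "\<And>t. (\<lambda>s. U (t, s)) \<in> Lpos a" and B: "\<And>t. mass a (\<lambda>s. U (t, s)) \<le> B"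
  defines "K \<equiv> \<lambda>s. LINT t|lborel. w t *\<^sub>R U (t, s)"
  shows "K \<in> Lpos a" and "mass a K \<le> W powr a * B"
    and "AE s in lborel. integrable lborel (\<lambda>t. w t *\<^sub>R U (t, s))"
    and "Re z > 0 \<Longrightarrow> integrable lborel (\<lambda>t. w t *\<^sub>R laplace (\<lambda>s. U (t, s)) z)"
    and "Re z > 0 \<Longrightarrow> laplace K z = (LINT t|lborel. w t *\<^sub>R laplace (\<lambda>s. U (t, s)) z)"
proof -
  have [measurable]: "w \<in> borel_measurable borel" using w by auto
  have B0: "B \<ge> 0" using order_trans[OF mass_nonneg B] .
  have V: "(LINT t|lborel. w t) \<ge> 0" using w(2) by (simp add: Bochner_Integration.integral_nonneg)
  have pw: "integrable (lborel \<Otimes>\<^sub>M lborel) (\<lambda>(t, s). w t * norm (U (t, s)) powr a)"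
  proof (rule lborel_pair.Fubini_integrable)
    show "integrable lborel (\<lambda>t. LINT s|lborel. norm (case (t, s) of (t, s) \<Rightarrow> w t * norm (U (t, s)) powr a))"
    proof (rule Bochner_Integration.integrable_bound)
      show "integrable lborel (\<lambda>t. B * w t)" using w by simp
      have "(LINT s|lborel. norm (w t * norm (U (t, s)) powr a)) = w t * mass a (\<lambda>s. U (t, s))" for t
        using w by (simp add: mass_def abs_mult)
      moreover have "norm (w t * mass a (\<lambda>s. U (t, s))) \<le> norm (B * w t)" for t
        using mult_left_mono[OF B[of t] w(2)[of t]] w(2)[of t] B0 mass_nonneg[of a "\<lambda>s. U (t, s)"]
        by (simp add: abs_mult mult.commute)
      ultimately show "AE t in lborel. norm (LINT s|lborel. norm (case (t, s) of (t, s) \<Rightarrow> w t * norm (U (t, s)) powr a)) \<le> norm (B * w t)"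
        by (simp only: prod.case) simp
    qed measurable
    show "AE t in lborel. integrable lborel (\<lambda>s. case (t, s) of (t, s) \<Rightarrow> w t * norm (U (t, s)) powr a)"
      using Lpos_integrable[OF u] by auto
  qed measurable
  have ae: "AE s in lborel. integrable lborel (\<lambda>t. w t * norm (U (t, s)) powr a)"
    using lborel_pair.AE_integrable_snd[OF pw] .
  have ae': "AE s in lborel. integrable lborel (\<lambda>t. w t *\<^sub>R U (t, s)) \<and>
      norm (K s) powr a \<le> W powr (a - 1) * (LINT t|lborel. w t * norm (U (t, s)) powr a)"
    using ae
  proof eventually_elim
    case (elim s)
    note J = powr_weighted_mean_le[OF a w, of "\<lambda>t. norm (U (t, s))", OF _ _ elim]
    have int: "integrable lborel (\<lambda>t. w t * norm (U (t, s)))" by (rule J) auto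
    have int': "integrable lborel (\<lambda>t. w t *\<^sub>R U (t, s))"
      by (rule Bochner_Integration.integrable_bound[OF int]) (use w in auto)
    have "norm (K s) \<le> (LINT t|lborel. w t * norm (U (t, s)))"
      unfolding K_def using w(2) integral_norm_bound[of lborel "\<lambda>t. w t *\<^sub>R U (t, s)"] by simp
    then have "norm (K s) powr a \<le> (LINT t|lborel. w t * norm (U (t, s))) powr a"
      using a by (intro powr_mono2) auto
    also have "\<dots> \<le> (LINT t|lborel. w t) powr (a - 1) * (LINT t|lborel. w t * norm (U (t, s)) powr a)"
      by (rule J) auto
    also have "\<dots> \<le> W powr (a - 1) * (LINT t|lborel. w t * norm (U (t, s)) powr a)"
      using a V W w(2) by (intro mult_right_mono powr_mono2) (auto intro: Bochner_Integration.integral_nonneg)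
    finally show ?case using int' by simp
  qed
  then show "AE s in lborel. integrable lborel (\<lambda>t. w t *\<^sub>R U (t, s))" by auto
  have [measurable]: "K \<in> borel_measurable borel" unfolding K_def by measurable
  have int_snd: "integrable lborel (\<lambda>s. W powr (a - 1) * (LINT t|lborel. w t * norm (U (t, s)) powr a))"
    using lborel_pair.integrable_snd[OF pw] by simp
  have intK: "integrable lborel (\<lambda>s. norm (K s) powr a)"
    by (rule Bochner_Integration.integrable_bound[OF int_snd]) (use ae' in auto)
  have "K s = 0" if "s \<le> 0" for s
    using Lpos_zero[OF u that] by (simp add: K_def)
  then show K: "K \<in> Lpos a" using intK by (simp add: Lpos_def)
  have "mass a K \<le> (LINT s|lborel. W powr (a - 1) * (LINT t|lborel. w t * norm (U (t, s)) powr a))"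
    unfolding mass_def using ae' by (intro integral_mono_AE intK int_snd) auto
  also have "\<dots> = W powr (a - 1) * (LINT t|lborel. w t * mass a (\<lambda>s. U (t, s)))"
    using lborel_pair.Fubini_integral[OF pw] by (simp add: mass_def)
  also have "\<dots> \<le> W powr (a - 1) * (LINT t|lborel. w t * B)"
  proof (intro mult_left_mono integral_mono)
    show "integrable lborel (\<lambda>t. w t * mass a (\<lambda>s. U (t, s)))"
      using lborel_pair.integrable_fst[OF pw] by (simp add: mass_def)
  qed (use w B in auto)
  also have "\<dots> \<le> W powr (a - 1) * (W * B)"
    using W B0 by (intro mult_left_mono) (auto intro: mult_right_mono)
  also have "\<dots> = W powr a * B"
    using V W by (cases "W = 0") (auto simp: powr_diff)
  finally show "mass a K \<le> W powr a * B" .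
  assume z: "Re z > 0"
  \<comment> \<open>Second half of the majorant for exchanging the two integrals: |U| exp(-Re z s)
    is at most |U|^a + exp(-Re z s) for s > 0, and both terms are integrable against w.\<close>
  have pe: "integrable (lborel \<Otimes>\<^sub>M lborel) (\<lambda>(t, s). w t * (indicator {0..} s * exp (- Re z * s)))"
  proof (rule lborel_pair.Fubini_integrable)
    show "integrable lborel (\<lambda>t. LINT s|lborel. norm (case (t, s) of (t, s) \<Rightarrow> w t * (indicator {0..} s * exp (- Re z * s))))"
      using w by (simp add: abs_mult)
    show "AE t in lborel. integrable lborel (\<lambda>s. case (t, s) of (t, s) \<Rightarrow> w t * (indicator {0..} s * exp (- Re z * s)))"
      using exp_decay_integrable[OF z] by auto
  qed measurable
  have pl: "integrable (lborel \<Otimes>\<^sub>M lborel) (\<lambda>(t, s). w t *\<^sub>R (U (t, s) * exp (- z * complex_of_real s)))"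
  proof (rule Bochner_Integration.integrable_bound[OF Bochner_Integration.integrable_add[OF pw pe]])
    show "AE p in lborel \<Otimes>\<^sub>M lborel. norm (case p of (t, s) \<Rightarrow> w t *\<^sub>R (U (t, s) * exp (- z * complex_of_real s)))
      \<le> norm ((case p of (t, s) \<Rightarrow> w t * norm (U (t, s)) powr a) + (case p of (t, s) \<Rightarrow> w t * (indicator {0..} s * exp (- Re z * s))))"
    proof (intro AE_I2, clarify)
      fix t s
      show "norm (w t *\<^sub>R (U (t, s) * exp (- z * complex_of_real s)))
        \<le> norm (w t * norm (U (t, s)) powr a + w t * (indicator {0..} s * exp (- Re z * s)))"
      proof (cases "s \<le> 0")
        case False
        have "norm (U (t, s)) * exp (- Re z * s) \<le> (1 + norm (U (t, s)) powr a) * exp (- Re z * s)"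
          by (intro mult_right_mono norm_le_one_plus_powr a) auto
        also have "\<dots> \<le> exp (- Re z * s) + norm (U (t, s)) powr a * 1"
          unfolding distrib_right mult_1_left using False z by (intro add_left_mono mult_left_mono) auto
        finally have "w t * (norm (U (t, s)) * exp (- Re z * s)) \<le> w t * (norm (U (t, s)) powr a + exp (- Re z * s))"
          using w(2) by (intro mult_left_mono) auto
        then show ?thesis using False w(2)[of t] by (simp add: norm_mult norm_exp_eq_Re distrib_left)
      qed (use Lpos_zero[OF u, of s t] in auto)
    qed
  qed measurable
  have eq: "(LINT s|lborel. w t *\<^sub>R (U (t, s) * exp (- z * complex_of_real s))) = w t *\<^sub>R laplace (\<lambda>s. U (t, s)) z" for t
    by (simp add: laplace_eq_lborel[OF u z])
  show "integrable lborel (\<lambda>t. w t *\<^sub>R laplace (\<lambda>s. U (t, s)) z)"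
    using lborel_pair.integrable_fst[OF pl] by (simp only: eq)
  have "laplace K z = (LINT s|lborel. LINT t|lborel. w t *\<^sub>R (U (t, s) * exp (- z * complex_of_real s)))"
    by (subst laplace_eq_lborel[OF K z], unfold K_def, intro Bochner_Integration.integral_cong refl)
       (simp flip: mult_scaleR_left)
  also have "\<dots> = (LINT t|lborel. w t *\<^sub>R laplace (\<lambda>s. U (t, s)) z)"
    using lborel_pair.Fubini_integral[OF pl] by (simp only: eq)
  finally show "laplace K z = (LINT t|lborel. w t *\<^sub>R laplace (\<lambda>s. U (t, s)) z)" .
qed

section \<open>Uniqueness of Bochner integrals in Hardy spaces\<close>

text \<open>Linear algebra relative to a carrier set, matching the pointwise operations used in
  \<open>has_bochner_integral_in\<close>.\<close>

definition subspace_in :: "('b \<Rightarrow> 'c::real_vector) set \<Rightarrow> bool" where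
  "subspace_in V \<longleftrightarrow> (\<lambda>z. 0) \<in> V \<and> (\<forall>F\<in>V. \<forall>G\<in>V. (\<lambda>z. F z + G z) \<in> V) \<and> (\<forall>F\<in>V. \<forall>c. (\<lambda>z. c *\<^sub>R F z) \<in> V)"

definition linear_in :: "('b \<Rightarrow> 'c::real_vector) set \<Rightarrow> (('b \<Rightarrow> 'c) \<Rightarrow> 'd::real_vector) \<Rightarrow> bool" where
  "linear_in V l \<longleftrightarrow> (\<forall>F\<in>V. \<forall>G\<in>V. l (\<lambda>z. F z + G z) = l F + l G) \<and> (\<forall>F\<in>V. \<forall>c. l (\<lambda>z. c *\<^sub>R F z) = c *\<^sub>R l F)"

lemma subspace_inD:
  assumes "subspace_in V"
  shows "(\<lambda>z. 0) \<in> V" "F \<in> V \<Longrightarrow> G \<in> V \<Longrightarrow> (\<lambda>z. F z + G z) \<in> V" "F \<in> V \<Longrightarrow> (\<lambda>z. c *\<^sub>R F z) \<in> V"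
  using assms by (auto simp: subspace_in_def)

lemma linear_inD:
  assumes "linear_in V l"
  shows "F \<in> V \<Longrightarrow> G \<in> V \<Longrightarrow> l (\<lambda>z. F z + G z) = l F + l G" "F \<in> V \<Longrightarrow> l (\<lambda>z. c *\<^sub>R F z) = c *\<^sub>R l F"
  using assms by (auto simp: linear_in_def)

lemma subspace_in_diff:
  assumes V: "subspace_in V" and "F \<in> V" "G \<in> V"
  shows "(\<lambda>z. F z - G z) \<in> V"
  using subspace_inD(2)[OF V assms(2) subspace_inD(3)[OF V assms(3), of "-1"]] by simp

lemma linear_in_diff:
  assumes V: "subspace_in V" and l: "linear_in V l" and "F \<in> V" "G \<in> V"
  shows "l (\<lambda>z. F z - G z) = l F - l G"
  using linear_inD(1)[OF l assms(3) subspace_inD(3)[OF V assms(4), of "-1"]] linear_inD(2)[OF l assms(4), of "-1"]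
  by simp

lemma linear_in_sum:
  assumes V: "subspace_in V" and l: "linear_in V l" and "finite A" "A \<subseteq> V"
  shows "(\<lambda>z. \<Sum>F\<in>A. c F *\<^sub>R F z) \<in> V \<and> l (\<lambda>z. \<Sum>F\<in>A. c F *\<^sub>R F z) = (\<Sum>F\<in>A. c F *\<^sub>R l F)"
  using assms(3,4)
proof (induction A)
  case empty
  have "l (\<lambda>z. 0) = 0" using linear_inD(2)[OF l subspace_inD(1)[OF V], of 0] by simp
  then show ?case using subspace_inD(1)[OF V] by simp
next
  case (insert F A)
  have F: "F \<in> V" and IH: "(\<lambda>z. \<Sum>F\<in>A. c F *\<^sub>R F z) \<in> V" "l (\<lambda>z. \<Sum>F\<in>A. c F *\<^sub>R F z) = (\<Sum>F\<in>A. c F *\<^sub>R l F)"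
    using insert.IH insert.prems by auto
  note cF = subspace_inD(3)[OF V F, of "c F"]
  show ?case
    using subspace_inD(2)[OF V cF IH(1)] linear_inD(1)[OF l cF IH(1)] linear_inD(2)[OF l F, of "c F"] IH(2) insert.hyps
    by simp
qed

text \<open>Neither \<open>l \<circ> g\<close> nor \<open>t \<mapsto> N (g t - s\<^sub>n t)\<close> is known to be measurable. Hence \<open>h\<close>, which is taken as the
  limit of \<open>l \<circ> s\<^sub>n\<close>, and only monotonicity of the (lower) integral \<open>\<integral>\<^sup>+\<close> is used on norms.\<close>

lemma has_bochner_integral_in_functional:
  fixes l :: "('b \<Rightarrow> 'c::real_vector) \<Rightarrow> complex"
  assumes H: "has_bochner_integral_in V N M g I"
    and V: "subspace_in V" and l: "linear_in V l"
    and C: "C > 0" "\<And>F. F \<in> V \<Longrightarrow> norm (l F) \<le> C * N F"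
  obtains h where "AE t in M. h t = l (g t)" "has_bochner_integral M h (l I)"
proof -
  obtain s where gV: "g ` space M \<subseteq> V" and I: "I \<in> V"
    and s: "\<And>n. simple_function M (s n)" "\<And>n. s n ` space M \<subseteq> V" "\<And>n. emeasure M {t \<in> space M. s n t \<noteq> (\<lambda>z. 0)} \<noteq> \<infinity>"
    and ae: "AE t in M. (\<lambda>n::nat. N (\<lambda>z. g t z - s n t z)) \<longlonglongrightarrow> 0"
    and nn: "(\<lambda>n. \<integral>\<^sup>+ t. ennreal (N (\<lambda>z. g t z - s n t z)) \<partial>M) \<longlonglongrightarrow> 0"
    and lim: "(\<lambda>n. N (\<lambda>z. I z - simple_integral_in M (s n) z)) \<longlonglongrightarrow> 0"
    using H unfolding has_bochner_integral_in_def simple_integrable_in_def by blast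
  have l0: "l (\<lambda>z. 0) = 0" using linear_in_sum[OF V l, of "{}"] by simp
  define r where "r n t = l (s n t)" for n t
  have r: "Bochner_Integration.simple_bochner_integrable M (r n)" for n
  proof (rule simple_bochner_integrable.intros)
    show "simple_function M (r n)" unfolding r_def by (rule simple_function_compose1[OF s(1)])
    have "emeasure M {t \<in> space M. r n t \<noteq> 0} \<le> emeasure M {t \<in> space M. s n t \<noteq> (\<lambda>z. 0)}"
    proof (rule emeasure_mono)
      have "{t \<in> space M. s n t \<noteq> (\<lambda>z. 0)} = s n -` (- {\<lambda>z. 0}) \<inter> space M" by auto
      then show "{t \<in> space M. s n t \<noteq> (\<lambda>z. 0)} \<in> sets M" using simple_functionD(2)[OF s(1)] by simp
    qed (auto simp: r_def l0)
    then show "emeasure M {t \<in> space M. r n t \<noteq> 0} \<noteq> \<infinity>" using s(3)[of n] by (auto simp: top_unique)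
  qed
  have r_integral: "simple_integral_in M (s n) \<in> V"
      "l (simple_integral_in M (s n)) = Bochner_Integration.simple_bochner_integral M (r n)" for n
  proof -
    have fin: "finite (s n ` space M)" using s(1) by (rule simple_functionD)
    have "Bochner_Integration.simple_bochner_integral M (r n) = (\<Sum>F\<in>s n ` space M. measure M {t \<in> space M. s n t = F} *\<^sub>R l F)"
      by (rule simple_bochner_integral_partition[OF r s(1)]) (auto simp: r_def)
    then show "simple_integral_in M (s n) \<in> V" "l (simple_integral_in M (s n)) = Bochner_Integration.simple_bochner_integral M (r n)"
      using linear_in_sum[OF V l fin s(2)] unfolding simple_integral_in_def by auto
  qed
  have diff_le: "norm (l (g t) - r n t) \<le> C * N (\<lambda>z. g t z - s n t z)" if t: "t \<in> space M" for n t
  proof -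
    have "g t \<in> V" "s n t \<in> V" using gV s(2) t by auto
    then show ?thesis unfolding r_def
      using C(2)[OF subspace_in_diff[OF V]] by (simp add: linear_in_diff[OF V l, symmetric])
  qed
  define h where "h t = lim (\<lambda>n. r n t)" for t
  have [measurable]: "r n \<in> borel_measurable M" for n
    using r[of n] by (intro borel_measurable_simple_function) (auto elim: simple_bochner_integrable.cases)
  have [measurable]: "h \<in> borel_measurable M" unfolding h_def by (rule borel_measurable_lim_metric) simp
  have hg: "AE t in M. h t = l (g t)"
    using ae AE_space
  proof eventually_elim
    case (elim t)
    have "(\<lambda>n. l (g t) - r n t) \<longlonglongrightarrow> 0"
    proof (rule Lim_null_comparison)
      show "(\<lambda>n. C * N (\<lambda>z. g t z - s n t z)) \<longlonglongrightarrow> 0" using tendsto_mult_left[OF elim(1), of C] by simp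
    qed (use diff_le elim in \<open>auto intro: always_eventually\<close>)
    then have "(\<lambda>n. l (g t) - (l (g t) - r n t)) \<longlonglongrightarrow> l (g t) - 0" by (intro tendsto_intros)
    then show ?case by (simp add: h_def limI)
  qed
  have "has_bochner_integral M h (l I)"
  proof (rule has_bochner_integral.intros)
    show "h \<in> borel_measurable M" by measurable
    show "Bochner_Integration.simple_bochner_integrable M (r n)" for n by (rule r)
    \<comment> \<open>The constant C is divided out of the measurable left-hand side. On the right
      the integrand may fail to be measurable, and a factor could not be pulled out of its
      integral.\<close>
    have "(\<lambda>n. \<integral>\<^sup>+ t. ennreal (norm (h t - r n t) / C) \<partial>M) \<longlonglongrightarrow> 0"
    proof (rule tendsto_sandwich[OF _ _ tendsto_const nn])
      show "\<forall>\<^sub>F n in sequentially. (\<integral>\<^sup>+ t. ennreal (norm (h t - r n t) / C) \<partial>M) \<le> (\<integral>\<^sup>+ t. ennreal (N (\<lambda>z. g t z - s n t z)) \<partial>M)"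
      proof (rule always_eventually, rule allI, rule nn_integral_mono_AE)
        fix n
        show "AE t in M. ennreal (norm (h t - r n t) / C) \<le> ennreal (N (\<lambda>z. g t z - s n t z))"
          using hg AE_space
        proof eventually_elim
          case (elim t)
          then show ?case using diff_le[of t n] C(1) by (intro ennreal_leI) (simp add: field_simps)
        qed
      qed
    qed simp
    then have "(\<lambda>n. ennreal C * (\<integral>\<^sup>+ t. ennreal (norm (h t - r n t) / C) \<partial>M)) \<longlonglongrightarrow> ennreal C * 0"
      by (intro ennreal_tendsto_cmult) simp
    moreover have "ennreal C * (\<integral>\<^sup>+ t. ennreal (norm (h t - r n t) / C) \<partial>M) = (\<integral>\<^sup>+ t. ennreal (norm (h t - r n t)) \<partial>M)" for n
      using C(1) by (subst nn_integral_cmult[symmetric]) (auto simp flip: ennreal_mult)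
    ultimately show "(\<lambda>n. \<integral>\<^sup>+ t. ennreal (norm (h t - r n t)) \<partial>M) \<longlonglongrightarrow> 0" by simp
    have "(\<lambda>n. l I - l (simple_integral_in M (s n))) \<longlonglongrightarrow> 0"
    proof (rule Lim_null_comparison)
      show "(\<lambda>n. C * N (\<lambda>z. I z - simple_integral_in M (s n) z)) \<longlonglongrightarrow> 0" using tendsto_mult_left[OF lim, of C] by simp
      show "\<forall>\<^sub>F n in sequentially. norm (l I - l (simple_integral_in M (s n))) \<le> C * N (\<lambda>z. I z - simple_integral_in M (s n) z)"
        using C(2)[OF subspace_in_diff[OF V I r_integral(1)]]
        by (intro always_eventually allI) (simp add: linear_in_diff[OF V l I r_integral(1), symmetric])
    qed
    then have "(\<lambda>n. l I - (l I - l (simple_integral_in M (s n)))) \<longlonglongrightarrow> l I - 0" by (intro tendsto_intros)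
    then show "(\<lambda>n. Bochner_Integration.simple_bochner_integral M (r n)) \<longlonglongrightarrow> l I" by (simp add: r_integral(2))
  qed
  with hg show thesis by (rule that)
qed

text \<open>The two measurable versions of \<open>l \<circ> g\<close> agree almost everywhere, hence
  so do their ordinary Bochner integrals, which are l I and l J.\<close>

lemma has_bochner_integral_in_functional_unique:
  fixes l :: "('b \<Rightarrow> 'c::real_vector) \<Rightarrow> complex"
  assumes "has_bochner_integral_in V N M g I" "has_bochner_integral_in V N M g J"
    and "subspace_in V" "linear_in V l" "C > 0" "\<And>F. F \<in> V \<Longrightarrow> norm (l F) \<le> C * N F"
  shows "l I = l J"
proof -
  obtain h where h: "AE t in M. h t = l (g t)" "has_bochner_integral M h (l I)"
    using has_bochner_integral_in_functional[OF assms(1,3-6)] by blast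
  obtain k where k: "AE t in M. k t = l (g t)" "has_bochner_integral M k (l J)"
    using has_bochner_integral_in_functional[OF assms(2,3-6)] by blast
  have "AE t in M. h t = k t" using h(1) k(1) by eventually_elim simp
  moreover have "h \<in> borel_measurable M" "k \<in> borel_measurable M"
    using h(2) k(2) by (auto elim: has_bochner_integral.cases)
  ultimately show ?thesis
    using h(2) k(2) by (metis has_bochner_integral_cong_AE has_bochner_integral_eq)
qed

section \<open>Bounded functionals on the Hardy spaces\<close>

lemma vertical_line_continuous:
  assumes F: "F \<in> holomorphic_rhp" and x: "x > 0"
  shows "continuous_on A (\<lambda>y. F (Complex x y))"
proof -
  have "continuous_on right_half_plane F"
    using F by (auto simp: holomorphic_rhp_def intro: holomorphic_on_imp_continuous_on)
  moreover have "continuous_on A (\<lambda>y. Complex x y)"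
    unfolding Complex_eq by (intro continuous_intros)
  ultimately show ?thesis
    by (rule continuous_on_compose2) (use x in \<open>auto simp: right_half_plane_def\<close>)
qed

lemma vertical_line_measurable:
  assumes "F \<in> holomorphic_rhp" "x > 0"
  shows "(\<lambda>y. F (Complex x y)) \<in> borel_measurable borel"
  using vertical_line_continuous[OF assms] by (rule borel_measurable_continuous_onI)

lemma subspace_holomorphic_rhp: "subspace_in holomorphic_rhp"
  by (auto simp: subspace_in_def holomorphic_rhp_def intro!: holomorphic_intros holomorphic_on_scaleR)

lemma hardy_mean_le_iff:
  assumes r: "r > 0" and B: "B \<ge> 0"
  shows "hardy_mean r F x \<le> B \<longleftrightarrow> (LINT y|lborel. norm (F (Complex x y)) powr r) \<le> 2 * pi * B powr r"
proof -
  let ?J = "LINT y|lborel. norm (F (Complex x y)) powr r"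
  have J: "?J \<ge> 0" by simp
  have "hardy_mean r F x \<le> B \<longleftrightarrow> (1 / (2 * pi) * ?J) powr (1 / r) \<le> (B powr r) powr (1 / r)"
    using r B by (simp add: hardy_mean_def powr_powr)
  also have "\<dots> \<longleftrightarrow> 1 / (2 * pi) * ?J \<le> B powr r"
  proof
    assume "(1 / (2 * pi) * ?J) powr (1 / r) \<le> (B powr r) powr (1 / r)"
    then show "1 / (2 * pi) * ?J \<le> B powr r"
      using powr_less_mono2[of "1 / r" "B powr r" "1 / (2 * pi) * ?J"] r
      by (meson not_le powr_ge_zero zero_less_divide_1_iff)
  next
    assume "1 / (2 * pi) * ?J \<le> B powr r"
    then show "(1 / (2 * pi) * ?J) powr (1 / r) \<le> (B powr r) powr (1 / r)"
      using r J by (intro powr_mono2) auto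
  qed
  finally show ?thesis by (simp add: field_simps)
qed

text \<open>Boundedness of the means with the root removed; closure under sums then follows from the
  crude inequality \<open>norm_add_powr_le\<close>.\<close>

lemma hardy_space_finite_iff:
  assumes r: "r > 0"
  shows "F \<in> hardy_space (ennreal r) \<longleftrightarrow> F \<in> holomorphic_rhp \<and>
    (\<exists>B. \<forall>x>0. integrable lborel (\<lambda>y. norm (F (Complex x y)) powr r) \<and> (LINT y|lborel. norm (F (Complex x y)) powr r) \<le> B)"
proof -
  have "bdd_above (hardy_mean r F ` {0<..}) \<longleftrightarrow> (\<exists>B. \<forall>x>0. (LINT y|lborel. norm (F (Complex x y)) powr r) \<le> B)"
  proof
    assume "bdd_above (hardy_mean r F ` {0<..})"
    then obtain B where "\<And>x. x > 0 \<Longrightarrow> hardy_mean r F x \<le> B" by (auto simp: bdd_above_def)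
    then have "\<And>x. x > 0 \<Longrightarrow> hardy_mean r F x \<le> max 0 B" by (simp add: max.coboundedI2)
    then show "\<exists>B. \<forall>x>0. (LINT y|lborel. norm (F (Complex x y)) powr r) \<le> B"
      using hardy_mean_le_iff[OF r, of "max 0 B"] by auto
  next
    assume "\<exists>B. \<forall>x>0. (LINT y|lborel. norm (F (Complex x y)) powr r) \<le> B"
    then obtain B where B: "\<And>x. x > 0 \<Longrightarrow> (LINT y|lborel. norm (F (Complex x y)) powr r) \<le> B" by auto
    have "hardy_mean r F x \<le> (1 / (2 * pi) * B) powr (1 / r)" if "x > 0" for x
      unfolding hardy_mean_def using B[OF that] r by (intro powr_mono2 mult_left_mono) auto
    then show "bdd_above (hardy_mean r F ` {0<..})"
      by (intro bdd_aboveI[of _ "(1 / (2 * pi) * B) powr (1 / r)"]) auto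
  qed
  then show ?thesis using r by (auto simp: hardy_space_def)
qed

lemma subspace_hardy_finite:
  assumes r: "r > 0"
  shows "subspace_in (hardy_space (ennreal r))"
  unfolding subspace_in_def
proof (intro conjI ballI allI)
  note S = subspace_inD[OF subspace_holomorphic_rhp]
  show "(\<lambda>z. 0) \<in> hardy_space (ennreal r)"
    using S(1) r by (auto simp: hardy_space_finite_iff)
  fix F assume F: "F \<in> hardy_space (ennreal r)"
  then obtain B where B: "F \<in> holomorphic_rhp" "\<And>x. x > 0 \<Longrightarrow> integrable lborel (\<lambda>y. norm (F (Complex x y)) powr r)"
    "\<And>x. x > 0 \<Longrightarrow> (LINT y|lborel. norm (F (Complex x y)) powr r) \<le> B"
    by (auto simp: hardy_space_finite_iff[OF r])
  show "(\<lambda>z. c *\<^sub>R F z) \<in> hardy_space (ennreal r)" for c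
    unfolding hardy_space_finite_iff[OF r]
    using B S(3)[OF B(1), of c] by (auto simp: powr_mult intro!: exI[of _ "\<bar>c\<bar> powr r * B"] mult_left_mono)
  fix G assume G: "G \<in> hardy_space (ennreal r)"
  then obtain D where D: "G \<in> holomorphic_rhp" "\<And>x. x > 0 \<Longrightarrow> integrable lborel (\<lambda>y. norm (G (Complex x y)) powr r)"
    "\<And>x. x > 0 \<Longrightarrow> (LINT y|lborel. norm (G (Complex x y)) powr r) \<le> D"
    by (auto simp: hardy_space_finite_iff[OF r])
  show "(\<lambda>z. F z + G z) \<in> hardy_space (ennreal r)"
    unfolding hardy_space_finite_iff[OF r]
  proof (intro conjI exI[of _ "2 powr r * (B + D)"] allI impI)
    show FG: "(\<lambda>z. F z + G z) \<in> holomorphic_rhp" by (rule S(2)[OF B(1) D(1)])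
    fix x :: real assume x: "x > 0"
    have [measurable]: "(\<lambda>y. F (Complex x y) + G (Complex x y)) \<in> borel_measurable borel"
      using vertical_line_measurable[OF FG x] .
    let ?b = "\<lambda>y. 2 powr r * (norm (F (Complex x y)) powr r + norm (G (Complex x y)) powr r)"
    have int: "integrable lborel ?b" using B(2)[OF x] D(2)[OF x] by auto
    have le: "norm (F (Complex x y) + G (Complex x y)) powr r \<le> ?b y" for y
      using r by (intro norm_add_powr_le) auto
    show int': "integrable lborel (\<lambda>y. norm (F (Complex x y) + G (Complex x y)) powr r)"
      by (rule Bochner_Integration.integrable_bound[OF int]) (use le in auto)
    have "(LINT y|lborel. norm (F (Complex x y) + G (Complex x y)) powr r) \<le> (LINT y|lborel. ?b y)"
      by (intro integral_mono int int' le)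
    also have "\<dots> = 2 powr r * ((LINT y|lborel. norm (F (Complex x y)) powr r) + (LINT y|lborel. norm (G (Complex x y)) powr r))"
      using B(2)[OF x] D(2)[OF x] by simp
    also have "\<dots> \<le> 2 powr r * (B + D)" using B(3)[OF x] D(3)[OF x] by (intro mult_left_mono add_mono) auto
    finally show "(LINT y|lborel. norm (F (Complex x y) + G (Complex x y)) powr r) \<le> 2 powr r * (B + D)" .
  qed
qed

lemma subspace_A0: "subspace_in A0"
  unfolding subspace_in_def
proof (intro conjI ballI allI)
  note S = subspace_inD[OF subspace_holomorphic_rhp]
  show "(\<lambda>z. 0) \<in> A0"
    using S(1) by (auto simp: A0_def intro!: exI[of _ "\<lambda>z. 0"])
  fix F assume "F \<in> A0"
  then obtain F' where F: "F \<in> holomorphic_rhp" "continuous_on {z. Re z \<ge> 0} F'" "\<And>z. z \<in> right_half_plane \<Longrightarrow> F' z = F z"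
    "(F' \<longlongrightarrow> 0) (inf at_infinity (principal {z. Re z \<ge> 0}))"
    by (auto simp: A0_def)
  have "((\<lambda>z. c *\<^sub>R F' z) \<longlongrightarrow> c *\<^sub>R 0) (inf at_infinity (principal {z. Re z \<ge> 0}))" for c
    by (intro tendsto_intros F)
  then show "(\<lambda>z. c *\<^sub>R F z) \<in> A0" for c
    unfolding A0_def using S(3)[OF F(1)] F
    by (auto intro!: exI[of _ "\<lambda>z. c *\<^sub>R F' z"] continuous_intros)
  fix G assume "G \<in> A0"
  then obtain G' where G: "G \<in> holomorphic_rhp" "continuous_on {z. Re z \<ge> 0} G'" "\<And>z. z \<in> right_half_plane \<Longrightarrow> G' z = G z"
    "(G' \<longlongrightarrow> 0) (inf at_infinity (principal {z. Re z \<ge> 0}))"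
    by (auto simp: A0_def)
  have "((\<lambda>z. F' z + G' z) \<longlongrightarrow> 0 + 0) (inf at_infinity (principal {z. Re z \<ge> 0}))"
    by (intro tendsto_intros F G)
  then show "(\<lambda>z. F z + G z) \<in> A0"
    unfolding A0_def using S(2)[OF F(1) G(1)] F G
    by (auto intro!: exI[of _ "\<lambda>z. F' z + G' z"] continuous_intros)
qed

text \<open>The norm on \<open>A0\<close> is a real supremum, which bounds its terms only once the
  set is known to be bounded. The extension is below 1 far out and continuous on the compact
  rest.\<close>

lemma A0_bounded:
  assumes "F \<in> A0"
  shows "bdd_above ((\<lambda>z. norm (F z)) ` right_half_plane)"
proof -
  let ?P = "{z :: complex. Re z \<ge> 0}"
  obtain G where G: "continuous_on ?P G" "\<And>z. z \<in> right_half_plane \<Longrightarrow> G z = F z"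
    "(G \<longlongrightarrow> 0) (inf at_infinity (principal ?P))"
    using assms by (auto simp: A0_def)
  have "\<forall>\<^sub>F z in inf at_infinity (principal ?P). dist (G z) 0 < 1"
    using G(3) by (rule tendstoD) simp
  then obtain R where R: "\<And>z. R \<le> norm z \<Longrightarrow> z \<in> ?P \<Longrightarrow> norm (G z) < 1"
    unfolding eventually_inf_principal eventually_at_infinity by auto
  have "closed ?P" by (rule closed_halfspace_Re_ge)
  then have "compact (?P \<inter> cball 0 R)" by (intro closed_Int_compact) auto
  then have "compact (G ` (?P \<inter> cball 0 R))"
    by (intro compact_continuous_image continuous_on_subset[OF G(1)]) auto
  then have "bounded (G ` (?P \<inter> cball 0 R))" by (rule compact_imp_bounded)
  then obtain B where "\<forall>x\<in>G ` (?P \<inter> cball 0 R). norm x \<le> B" unfolding bounded_iff by blast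
  then have B: "norm (G z) \<le> B" if "z \<in> ?P \<inter> cball 0 R" for z using that by blast
  have "norm (F z) \<le> max 1 B" if z: "z \<in> right_half_plane" for z
  proof (cases "R \<le> norm z")
    case True
    then show ?thesis using R[of z] z G(2)[OF z] by (auto simp: right_half_plane_def)
  next
    case False
    then show ?thesis using B[of z] z G(2)[OF z] by (auto simp: right_half_plane_def)
  qed
  then show ?thesis by (intro bdd_aboveI[of _ "max 1 B"]) auto
qed

text \<open>Apply |w| <= 1 + |w|^r to w = F / \<mu> and multiply by \<mu>. The constant term
  integrates to (d - c) \<mu>, and the power term to at most 2 pi \<mu>, because
  \<open>hardy_mean\<close> carries the factor 1/(2 pi). Here \<mu> lies strictly above the norm, so
  that it is positive even if the norm is 0; letting it decrease gives the claim.\<close>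

lemma vertical_segment_le_hardy_norm:
  assumes r: "r \<ge> 1" and F: "F \<in> hardy_space (ennreal r)" and x: "x > 0" and cd: "c \<le> d"
  shows "norm (LINT y|lborel. indicator {c..d} y *\<^sub>R F (Complex x y)) \<le> (d - c + 2 * pi) * hardy_norm (ennreal r) F"
proof -
  let ?K = "d - c + 2 * pi"
  have K: "?K > 0" using cd pi_gt_zero by linarith
  obtain Fh: "F \<in> holomorphic_rhp" and int: "integrable lborel (\<lambda>y. norm (F (Complex x y)) powr r)"
    and bdd: "bdd_above (hardy_mean r F ` {0<..})"
    using F x r by (auto simp: hardy_space_def)
  have [measurable]: "(\<lambda>y. F (Complex x y)) \<in> borel_measurable borel"
    using vertical_line_measurable[OF Fh x] .
  let ?N = "hardy_norm (ennreal r) F"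
  have mean: "hardy_mean r F x \<le> ?N"
    using bdd x r by (auto simp: hardy_norm_def intro: cSUP_upper)
  have N: "?N \<ge> 0" using mean by (rule order_trans[rotated]) (simp add: hardy_mean_def)
  have seg: "norm (LINT y|lborel. indicator {c..d} y *\<^sub>R F (Complex x y)) \<le> ?K * \<mu>" if \<mu>: "\<mu> > ?N" for \<mu>
  proof -
    have l0: "\<mu> > 0" using \<mu> N by simp
    have J: "(LINT y|lborel. norm (F (Complex x y)) powr r) \<le> 2 * pi * \<mu> powr r"
      using mean \<mu> l0 r hardy_mean_le_iff[of r \<mu> F x] by auto
    have le: "norm (indicator {c..d} y *\<^sub>R F (Complex x y)) \<le> \<mu> * indicator {c..d} y + \<mu> powr (1 - r) * norm (F (Complex x y)) powr r" for y
    proof -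
      have "norm (F (Complex x y) /\<^sub>R \<mu>) \<le> 1 + norm (F (Complex x y) /\<^sub>R \<mu>) powr r"
        by (rule norm_le_one_plus_powr[OF r])
      then have "\<mu> * (norm (F (Complex x y)) / \<mu>) \<le> \<mu> * (1 + (norm (F (Complex x y)) / \<mu>) powr r)"
        using l0 by (intro mult_left_mono) (auto simp: divide_inverse mult.commute)
      also have "\<dots> = \<mu> + \<mu> powr (1 - r) * norm (F (Complex x y)) powr r"
        using l0 by (simp add: powr_divide powr_diff distrib_left)
      finally show ?thesis using l0 by (auto simp: indicator_def)
    qed
    have int2: "integrable lborel (\<lambda>y. \<mu> * indicator {c..d} y + \<mu> powr (1 - r) * norm (F (Complex x y)) powr r)"
      using int cd by auto
    have int1: "integrable lborel (\<lambda>y. norm (indicator {c..d} y *\<^sub>R F (Complex x y)))"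
      by (rule Bochner_Integration.integrable_bound[OF int2])
         (use le in \<open>auto intro!: AE_I2 order_trans[OF _ abs_ge_self]\<close>)
    have "norm (LINT y|lborel. indicator {c..d} y *\<^sub>R F (Complex x y)) \<le> (LINT y|lborel. norm (indicator {c..d} y *\<^sub>R F (Complex x y)))"
      by (rule integral_norm_bound)
    also have "\<dots> \<le> (LINT y|lborel. \<mu> * indicator {c..d} y + \<mu> powr (1 - r) * norm (F (Complex x y)) powr r)"
      by (intro integral_mono int1 int2 le)
    also have "\<dots> = \<mu> * (d - c) + \<mu> powr (1 - r) * (LINT y|lborel. norm (F (Complex x y)) powr r)"
      using int cd by (simp add: measure_def)
    also have "\<dots> \<le> \<mu> * (d - c) + \<mu> powr (1 - r) * (2 * pi * \<mu> powr r)"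
      by (intro add_left_mono mult_left_mono J) simp
    also have "\<dots> = ?K * \<mu>" using l0 by (simp add: powr_diff algebra_simps)
    finally show ?thesis .
  qed
  have "norm (LINT y|lborel. indicator {c..d} y *\<^sub>R F (Complex x y)) / ?K \<le> \<mu>" if "\<mu> > ?N" for \<mu>
    by (subst pos_divide_le_eq[OF K], subst mult.commute, rule seg[OF that])
  then have "norm (LINT y|lborel. indicator {c..d} y *\<^sub>R F (Complex x y)) / ?K \<le> ?N"
    by (rule dense_ge)
  then show ?thesis using K by (simp add: field_simps)
qed

text \<open>The primitive based at y - 1 vanishes near y, and its derivative at y is f(y).\<close>

lemma continuous_eq_zero_if_integrals_zero:
  fixes f :: "real \<Rightarrow> complex"
  assumes f: "continuous_on UNIV f" and 0: "\<And>c d. c \<le> d \<Longrightarrow> (LINT y|lborel. indicator {c..d} y *\<^sub>R f y) = 0"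
  shows "f y = 0"
proof -
  have cont: "continuous_on A f" for A using f by (rule continuous_on_subset) simp
  have I0: "integral {y - 1..u} f = 0" if "u \<in> {y - 1..y + 1}" for u
  proof -
    have "set_integrable lborel {y - 1..u} f" by (rule borel_integrable_atLeastAtMost'[OF cont])
    then have "(LINT x:{y - 1..u}|lborel. f x) = integral {y - 1..u} f" by (rule set_borel_integral_eq_integral)
    then show ?thesis using 0[of "y - 1" u] that by (simp add: set_lebesgue_integral_def)
  qed
  have "((\<lambda>u. integral {y - 1..u} f) has_vector_derivative f y) (at y within {y - 1..y + 1})"
    by (rule integral_has_vector_derivative[OF cont]) auto
  then have "((\<lambda>u. 0) has_vector_derivative f y) (at y within {y - 1..y + 1})"
    by (rule has_vector_derivative_transform[rotated 2]) (use I0 in auto)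
  moreover have "((\<lambda>u. 0) has_vector_derivative 0) (at y within {y - 1..y + 1})" by (rule has_vector_derivative_const)
  ultimately show ?thesis
    by (intro vector_derivative_unique_within_closed_interval[of "y - 1" "y + 1" y]) auto
qed

text \<open>In \<open>A0\<close> the point evaluations are bounded by the supremum norm. For finite
  r the segment functionals are used on the vertical line through z: their bound comes from the mean
  on that single line, and a continuous function there is determined by them.\<close>

lemma has_bochner_integral_hardy_unique:
  assumes b: "b = \<infinity> \<or> (\<exists>r\<ge>1. b = ennreal r)"
    and I: "has_bochner_integral_in (hardy_space b) (hardy_norm b) M g I"
    and J: "has_bochner_integral_in (hardy_space b) (hardy_norm b) M g J"
  shows "I = J"
  using b
proof
  assume b: "b = \<infinity>"
  have IJ: "I \<in> A0" "J \<in> A0"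
    using I J b by (auto simp: has_bochner_integral_in_def hardy_space_def)
  show ?thesis
  proof (rule ext)
    fix z
    show "I z = J z"
    proof (cases "z \<in> right_half_plane")
      case True
      show ?thesis
      proof (rule has_bochner_integral_in_functional_unique[OF I J, of "\<lambda>F. F z" 1])
        show "subspace_in (hardy_space b)" using subspace_A0 b by (simp add: hardy_space_def)
        show "linear_in (hardy_space b) (\<lambda>F. F z)" by (simp add: linear_in_def)
        show "norm (F z) \<le> 1 * hardy_norm b F" if "F \<in> hardy_space b" for F
          using that b A0_bounded[of F] True by (auto simp: hardy_space_def hardy_norm_def intro: cSUP_upper)
      qed simp
    next
      case False
      then show ?thesis using IJ by (simp add: A0_def holomorphic_rhp_def)
    qed
  qed
next
  assume "\<exists>r\<ge>1. b = ennreal r"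
  then obtain r where r: "r \<ge> 1" and b: "b = ennreal r" by auto
  have S: "subspace_in (hardy_space b)" using r b by (simp add: subspace_hardy_finite)
  have IJ: "I \<in> hardy_space b" "J \<in> hardy_space b"
    using I J by (auto simp: has_bochner_integral_in_def)
  have hol: "F \<in> holomorphic_rhp" if "F \<in> hardy_space b" for F
    using that r b by (simp add: hardy_space_def)
  have int: "integrable lborel (\<lambda>y. indicator {c..d} y *\<^sub>R F (Complex x y))" if "F \<in> hardy_space b" "x > 0" for F x and c d :: real
    using borel_integrable_atLeastAtMost'[OF vertical_line_continuous[OF hol[OF that(1)] that(2)], of c d]
    by (simp add: set_integrable_def)
  show ?thesis
  proof (rule ext)
    fix z
    show "I z = J z"
    proof (cases "Re z > 0")
      case True
      let ?l = "\<lambda>c d F. LINT y|lborel. indicator {c..d} y *\<^sub>R F (Complex (Re z) y)"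
      have eq: "?l c d I = ?l c d J" if cd: "c \<le> d" for c d
      proof (rule has_bochner_integral_in_functional_unique[OF I J S, of "?l c d" "d - c + 2 * pi"])
        show "linear_in (hardy_space b) (?l c d)"
          unfolding linear_in_def
        proof (intro conjI ballI allI)
          fix F and e :: real
          show "?l c d (\<lambda>z. e *\<^sub>R F z) = e *\<^sub>R ?l c d F"
            by (subst scaleR_left_commute) (simp del: scaleR_scaleR)
        qed (use int True in \<open>simp add: scaleR_add_right\<close>)
        show "d - c + 2 * pi > 0" using cd pi_gt_zero by linarith
        show "norm (?l c d F) \<le> (d - c + 2 * pi) * hardy_norm b F" if "F \<in> hardy_space b" for F
          using vertical_segment_le_hardy_norm[OF r _ True cd, of F] that b by simp
      qed
      have "I (Complex (Re z) (Im z)) - J (Complex (Re z) (Im z)) = 0"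
      proof (rule continuous_eq_zero_if_integrals_zero)
        show "continuous_on UNIV (\<lambda>y. I (Complex (Re z) y) - J (Complex (Re z) y))"
          using IJ hol True by (intro continuous_intros vertical_line_continuous)
        show "(LINT y|lborel. indicator {c..d} y *\<^sub>R (I (Complex (Re z) y) - J (Complex (Re z) y))) = 0" if "c \<le> d" for c d
          using eq[OF that] int[OF IJ(1) True, of c d] int[OF IJ(2) True, of c d] by (simp add: scaleR_diff_right)
      qed
      then show ?thesis by simp
    next
      case False
      then show ?thesis using IJ[THEN hol] by (simp add: holomorphic_rhp_def right_half_plane_def)
    qed
  qed
qed

section \<open>Bochner integrals of dilations\<close>

lemma hardy_norm_nonneg:
  assumes b: "b = \<infinity> \<or> (\<exists>r\<ge>1. b = ennreal r)" and F: "F \<in> hardy_space b"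
  shows "hardy_norm b F \<ge> 0"
  using b
proof
  assume b: "b = \<infinity>"
  have "norm (F 1) \<le> hardy_norm b F"
    using F b A0_bounded[of F] by (auto simp: hardy_space_def hardy_norm_def right_half_plane_def intro!: cSUP_upper)
  then show ?thesis by (rule order_trans[rotated]) simp
next
  assume "\<exists>r\<ge>1. b = ennreal r"
  then obtain r where r: "r \<ge> 1" and b: "b = ennreal r" by auto
  then have "hardy_mean r F 1 \<le> hardy_norm b F"
    using F by (auto simp: hardy_space_def hardy_norm_def intro!: cSUP_upper)
  then show ?thesis by (rule order_trans[rotated]) (simp add: hardy_mean_def)
qed

lemma conj_exp_cases:
  assumes "1 \<le> a"
  shows "conj_exp a = \<infinity> \<or> (\<exists>r\<ge>1. conj_exp a = ennreal r)"
  using assms by (auto simp: conj_exp_def field_simps intro!: exI[of _ "a / (a - 1)"])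

text \<open>Letting the bound decrease to c admits c = 0, which occurs when the error estimate in
  \<open>laplace_dil_bochner\<close> vanishes at some t.\<close>

lemma laplace_bounded:
  assumes a: "1 \<le> a" "a \<le> 2"
  obtains C where "C > 0" "\<And>f. f \<in> Lpos a \<Longrightarrow> laplace f \<in> hardy_space (conj_exp a)"
    "\<And>f c. f \<in> Lpos a \<Longrightarrow> c \<ge> 0 \<Longrightarrow> mass a f \<le> c powr a \<Longrightarrow> hardy_norm (conj_exp a) (laplace f) \<le> C * c"
proof -
  obtain C where C: "C > 0" "\<And>f. f \<in> Lpos a \<Longrightarrow> laplace f \<in> hardy_space (conj_exp a)"
    "\<And>f c. f \<in> Lpos a \<Longrightarrow> c > 0 \<Longrightarrow> mass a f \<le> c powr a \<Longrightarrow> hardy_norm (conj_exp a) (laplace f) \<le> C * c"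
    using laplace_bounded_gt[OF a] by metis
  show thesis
  proof (rule that[OF C(1,2)])
    fix f c assume f: "f \<in> Lpos a" and c: "c \<ge> 0" "mass a f \<le> c powr a"
    have "hardy_norm (conj_exp a) (laplace f) / C \<le> d" if d: "d > c" for d
    proof -
      have "c powr a \<le> d powr a" using c(1) d a by (intro powr_mono2) auto
      then have "hardy_norm (conj_exp a) (laplace f) \<le> C * d" using c d by (intro C(3) f) auto
      then show ?thesis using C(1) by (simp add: field_simps)
    qed
    then have "hardy_norm (conj_exp a) (laplace f) / C \<le> c" by (rule dense_ge)
    then show "hardy_norm (conj_exp a) (laplace f) \<le> C * c" using C(1) by (simp add: field_simps)
  qed
qed

text \<open>A triangle inequality for upper bounds x and y of the norms. One factor 2 of the 4 comes
  from \<open>Lpos_add\<close>, the other from adding two equal powers, since 2 <= 2^a.\<close>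

lemma mass_add_le:
  assumes a: "a \<ge> 1" and f: "f \<in> Lpos a" "x \<ge> 0" "mass a f \<le> x powr a"
    and g: "g \<in> Lpos a" "y \<ge> 0" "mass a g \<le> y powr a"
  shows "mass a (\<lambda>t. f t + g t) \<le> (4 * (x + y)) powr a"
proof -
  have "mass a (\<lambda>t. f t + g t) \<le> 2 powr a * (mass a f + mass a g)"
    using a by (intro Lpos_add f g) auto
  also have "\<dots> \<le> 2 powr a * ((x + y) powr a + (x + y) powr a)"
  proof (intro mult_left_mono add_mono)
    show "mass a f \<le> (x + y) powr a" using f g a by (intro order_trans[OF f(3)] powr_mono2) auto
    show "mass a g \<le> (x + y) powr a" using f g a by (intro order_trans[OF g(3)] powr_mono2) auto
  qed simp
  also have "\<dots> = 2 powr a * 2 * (x + y) powr a" by simp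
  also have "\<dots> \<le> 2 powr a * 2 powr a * (x + y) powr a"
    using powr_mono[of 1 a 2] a by (intro mult_right_mono mult_left_mono) auto
  also have "\<dots> = (4 * (x + y)) powr a"
    using f(2) g(2) by (simp add: powr_mult[symmetric] mult.assoc[symmetric])
  finally show ?thesis .
qed

lemma simple_function_lebesgue_on:
  fixes f :: "real \<Rightarrow> 'a"
  assumes "simple_function borel f" "A \<in> sets borel"
  shows "simple_function (lebesgue_on A) f"
  unfolding simple_function_def
proof (intro conjI ballI)
  show "finite (f ` space (lebesgue_on A))"
    by (rule finite_subset[OF _ simple_functionD(1)[OF assms(1)]]) auto
  fix x
  have "f -` {x} \<inter> A \<in> sets borel" using simple_functionD(2)[OF assms(1), of "{x}"] assms(2) by auto
  then have "f -` {x} \<inter> A \<in> sets lebesgue" by (rule sets_completionI_sets[of _ lborel, simplified])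
  then show "f -` {x} \<inter> space (lebesgue_on A) \<in> sets (lebesgue_on A)"
    using assms(2) by (auto simp: sets_restrict_space)
qed

section \<open>Discretising the weight and the dilation parameter\<close>

lemma simple_function_approx_below:
  fixes k :: "real \<Rightarrow> real"
  assumes "k \<in> borel_measurable borel" "\<And>t. k t \<ge> 0"
  obtains \<kappa> where "\<And>n. simple_function borel (\<kappa> n)" "\<And>n t. 0 \<le> \<kappa> n t" "\<And>n t. \<kappa> n t \<le> k t"
    "\<And>t. (\<lambda>n::nat. \<kappa> n t) \<longlonglongrightarrow> k t"
proof -
  obtain \<kappa> where inc: "incseq \<kappa>" and s: "\<And>n. simple_function borel (\<kappa> n)" and bdd: "\<And>t. bdd_above (range (\<lambda>n. \<kappa> n t))"
    and nonneg: "\<And>n t. 0 \<le> \<kappa> n t" and k: "k = (SUP n. \<kappa> n)"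
    using borel_measurable_implies_simple_function_sequence_real[OF assms] by metis
  have kt: "k t = (SUP n. \<kappa> n t)" for t unfolding k by (simp add: image_image)
  have inc': "incseq (\<lambda>n. \<kappa> n t)" for t using inc by (auto simp: incseq_def le_fun_def)
  show thesis
    using s nonneg cSUP_upper[OF _ bdd] LIMSEQ_incseq_SUP[OF bdd inc'] by (intro that[of \<kappa>]) (auto simp: kt)
qed

text \<open>A modulus of continuity at the identity, at the scale 1/(n+1) of \<open>grid n\<close>.
  The supremum is finite because dilations preserve the mass, and its a-th root is taken so that
  \<epsilon> is on the scale of norms, as \<open>mass_add_le\<close> expects.\<close>

lemma dil_modulus:
  assumes f: "f \<in> Lpos a" and a: "a \<ge> 1"
  obtains \<epsilon> where "\<epsilon> \<longlonglongrightarrow> 0" "\<And>n. \<epsilon> n \<ge> 0"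
    "\<And>n \<tau>. \<bar>\<tau>\<bar> \<le> 1 / real (Suc n) \<Longrightarrow> mass a (\<lambda>s. dil a \<tau> f s - f s) \<le> \<epsilon> n powr a"
proof -
  let ?m = "\<lambda>\<tau>. mass a (\<lambda>s. dil a \<tau> f s - f s)"
  define S where "S n = (SUP \<tau>\<in>{\<tau>. \<bar>\<tau>\<bar> \<le> 1 / real (Suc n)}. ?m \<tau>)" for n
  have "?m \<tau> \<le> 2 powr a * (mass a f + mass a f)" for \<tau>
    using Lpos_diff(2)[OF _ dil_Lpos(1)[OF f] f, of \<tau>] dil_Lpos(2)[OF f, of \<tau>] a by simp
  then have bdd: "bdd_above (?m ` A)" for A by (intro bdd_aboveI) auto
  have le_S: "?m \<tau> \<le> S n" if "\<bar>\<tau>\<bar> \<le> 1 / real (Suc n)" for \<tau> n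
    unfolding S_def using that by (intro cSUP_upper bdd) auto
  have S0: "S n \<ge> 0" for n using le_S[of 0 n] mass_nonneg[of a "\<lambda>s. dil a 0 f s - f s"] by simp
  have "S \<longlonglongrightarrow> 0"
  proof (rule LIMSEQ_I)
    fix e :: real assume e: "e > 0"
    obtain \<delta> where \<delta>: "\<delta> > 0" "\<And>\<tau>. \<bar>\<tau>\<bar> < \<delta> \<Longrightarrow> ?m \<tau> < e / 2"
      using dil_continuity[OF f a, of "e / 2"] e by auto
    obtain N where N: "1 / real (Suc N) < \<delta>" using \<delta>(1) nat_approx_posE by blast
    have "norm (S n - 0) < e" if n: "n \<ge> N" for n
    proof -
      have "1 / real (Suc n) \<le> 1 / real (Suc N)" using n by (simp add: frac_le)
      then have "S n \<le> e / 2"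
        unfolding S_def using N by (intro cSUP_least less_imp_le[OF \<delta>(2)]) (auto intro: exI[of _ 0])
      then show ?thesis using S0[of n] e by simp
    qed
    then show "\<exists>no. \<forall>n\<ge>no. norm (S n - 0) < e" by blast
  qed
  then have "(\<lambda>n. S n powr (1 / a)) \<longlonglongrightarrow> 0"
    using a S0 by (intro tendsto_eq_rhs[OF tendsto_powr2[OF _ tendsto_const[of "1 / a"]]]) (auto intro: always_eventually)
  then show thesis
    using a le_S S0 by (intro that[of "\<lambda>n. S n powr (1 / a)"]) (auto simp: powr_powr)
qed

text \<open>Rounding down to multiples of 1/(n+1). Restricting to (0, n] leaves finitely many
  values, so this is a simple function.\<close>

definition grid :: "nat \<Rightarrow> real \<Rightarrow> real" where
  "grid n t = (if 0 < t \<and> t \<le> real n then of_int \<lfloor>real (Suc n) * t\<rfloor> / real (Suc n) else 0)"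

lemma grid_measurable [measurable]: "grid n \<in> borel_measurable borel"
  unfolding grid_def[abs_def] by measurable

lemma simple_function_grid: "simple_function borel (grid n)"
proof (rule simple_function_borel_measurable)
  have "grid n ` space borel \<subseteq> insert 0 ((\<lambda>i. of_int i / real (Suc n)) ` {0..\<lfloor>real (Suc n) * real n\<rfloor>})"
    by (auto simp: grid_def intro!: imageI floor_mono mult_left_mono)
  then show "finite (grid n ` space borel)" by (rule finite_subset) auto
qed measurable

lemma grid_approx:
  assumes "0 < t" "t \<le> real n"
  shows "\<bar>t - grid n t\<bar> \<le> 1 / real (Suc n)"
proof -
  have "\<bar>real (Suc n) * t - of_int \<lfloor>real (Suc n) * t\<rfloor>\<bar> \<le> 1" by linarith
  then have "\<bar>real (Suc n) * t - of_int \<lfloor>real (Suc n) * t\<rfloor>\<bar> / real (Suc n) \<le> 1 / real (Suc n)"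
    by (intro divide_right_mono) auto
  also have "\<bar>real (Suc n) * t - of_int \<lfloor>real (Suc n) * t\<rfloor>\<bar> / real (Suc n) = \<bar>(real (Suc n) * t - of_int \<lfloor>real (Suc n) * t\<rfloor>) / real (Suc n)\<bar>"
    by (simp add: abs_divide)
  also have "(real (Suc n) * t - of_int \<lfloor>real (Suc n) * t\<rfloor>) / real (Suc n) = t - grid n t"
    using assms by (simp add: grid_def diff_divide_distrib)
  finally show ?thesis .
qed

lemma dil_measurable [measurable]:
  assumes [measurable]: "f \<in> borel_measurable borel" "\<tau> \<in> borel_measurable M" "s \<in> borel_measurable M"
  shows "(\<lambda>x. dil a (\<tau> x) f (s x)) \<in> borel_measurable M"
  unfolding dil_def by measurable

text \<open>The simple approximant at t is the transform of \<rho>_n(t) times the dilation at the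
  grid point below t. Its error splits into a weight error (k - \<rho>_n) X and a rounding error
  \<rho>_n Z; in L_a these are at most (k - \<rho>_n) m and k \<epsilon>_n. One split proves all
  three limits: at each t, after integrating the norms over t, and, by
  \<open>Lpos_weighted_mean\<close>, for the integrals themselves. The bound on \<sigma> keeps the
  rounding error within the mesh; the values 1 and -1 serve the two operators.\<close>

lemma laplace_dil_bochner:
  fixes k :: "real \<Rightarrow> real"
  assumes a: "1 \<le> a" "a \<le> 2" and f: "f \<in> Lpos a"
    and k: "integrable lborel k" "\<And>t. k t \<ge> 0" "\<And>t. t \<le> 0 \<Longrightarrow> k t = 0" and \<sigma>: "\<bar>\<sigma>\<bar> \<le> 1"
  shows "has_bochner_integral_in (hardy_space (conj_exp a)) (hardy_norm (conj_exp a)) (lebesgue_on {0<..})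
    (\<lambda>t. laplace (\<lambda>s. k t *\<^sub>R dil a (\<sigma> * t) f s)) (laplace (\<lambda>s. LINT t|lborel. k t *\<^sub>R dil a (\<sigma> * t) f s))"
proof -
  let ?V = "hardy_space (conj_exp a)" and ?N = "hardy_norm (conj_exp a)" and ?M = "lebesgue_on {0<..} :: real measure"
  have a0: "a \<ge> 0" "a > 0" using a by auto
  have [measurable]: "f \<in> borel_measurable borel" using f by (rule Lpos_measurable)
  have k_m [measurable]: "k \<in> borel_measurable borel" using k by auto
  obtain C where C: "C > 0" "\<And>f. f \<in> Lpos a \<Longrightarrow> laplace f \<in> ?V"
    "\<And>f c. f \<in> Lpos a \<Longrightarrow> c \<ge> 0 \<Longrightarrow> mass a f \<le> c powr a \<Longrightarrow> ?N (laplace f) \<le> C * c"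
    using laplace_bounded[OF a] by metis
  have N_nonneg: "?N F \<ge> 0" if "F \<in> ?V" for F
    using hardy_norm_nonneg[OF conj_exp_cases[OF a(1)] that] .
  obtain \<kappa> where \<kappa>: "\<And>n. simple_function borel (\<kappa> n)" "\<And>n t. 0 \<le> \<kappa> n t" "\<And>n t. \<kappa> n t \<le> k t"
    "\<And>t. (\<lambda>n::nat. \<kappa> n t) \<longlonglongrightarrow> k t"
    using simple_function_approx_below[OF k_m k(2)] by metis
  obtain \<epsilon> where \<epsilon>: "\<epsilon> \<longlonglongrightarrow> 0" "\<And>n. \<epsilon> n \<ge> 0"
    "\<And>n \<tau>. \<bar>\<tau>\<bar> \<le> 1 / real (Suc n) \<Longrightarrow> mass a (\<lambda>s. dil a \<tau> f s - f s) \<le> \<epsilon> n powr a"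
    using dil_modulus[OF f a(1)] by metis
  define m where "m = mass a f powr (1 / a)"
  have m: "m \<ge> 0" "mass a f = m powr a"
    using mass_nonneg[of a f] a by (auto simp: m_def powr_powr)
  define J :: "nat \<Rightarrow> real set" where "J n = {0<..real n}" for n
  \<comment> \<open>Cutting off to (0, n] makes the support of the approximant finite in measure and
    confines it to where \<open>grid n\<close> is close to t.\<close>
  define \<rho> where "\<rho> n t = indicator (J n) t * \<kappa> n t" for n t
  have \<rho>_simple: "simple_function borel (\<rho> n)" for n
    unfolding \<rho>_def by (intro simple_function_mult \<kappa>(1) simple_function_indicator) (auto simp: J_def)
  have \<rho>: "0 \<le> \<rho> n t" "\<rho> n t \<le> k t" "t \<notin> J n \<Longrightarrow> \<rho> n t = 0" for n t
    using \<kappa>(2,3)[of n t] k(2)[of t] by (auto simp: \<rho>_def indicator_def)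
  have [measurable]: "\<rho> n \<in> borel_measurable borel" "J n \<in> sets borel" for n
    using \<rho>_simple by (auto intro: borel_measurable_simple_function simp: J_def)
  have \<rho>_lim: "(\<lambda>n. \<rho> n t) \<longlonglongrightarrow> k t" for t
  proof (cases "t > 0")
    case True
    have "\<forall>\<^sub>F n in sequentially. t \<le> real n"
      by (rule eventually_ge_at_top[THEN filterlim_real_sequentially[THEN filterlim_iff[THEN iffD1], rule_format]])
    then have "\<forall>\<^sub>F n in sequentially. \<kappa> n t = \<rho> n t"
      by eventually_elim (use True in \<open>auto simp: \<rho>_def J_def\<close>)
    then show ?thesis by (rule Lim_transform_eventually[OF \<kappa>(4)])
  next
    case False
    then have "\<rho> n t = 0" for n by (intro \<rho>(3)) (auto simp: J_def)
    then show ?thesis using k(3)[of t] False by simp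
  qed
  have \<rho>_int: "integrable lborel (\<rho> n)" for n
    by (rule Bochner_Integration.integrable_bound[OF k(1)]) (use \<rho> k(2) in \<open>auto intro!: AE_I2\<close>)
  define W where "W = (LINT t|lborel. k t)"
  define e where "e n = (LINT t|lborel. k t - \<rho> n t)" for n
  have W: "W \<ge> 0" "(LINT t|lborel. \<rho> n t) \<le> W" for n
    unfolding W_def using k \<rho> \<rho>_int by (auto intro!: integral_mono Bochner_Integration.integral_nonneg)
  have e: "e n \<ge> 0" "e \<longlonglongrightarrow> 0" for n
  proof -
    show "e n \<ge> 0" unfolding e_def using \<rho> by (intro Bochner_Integration.integral_nonneg) auto
    have "(\<lambda>n. LINT t|lborel. k t - \<rho> n t) \<longlonglongrightarrow> integral\<^sup>L lborel (\<lambda>t::real. 0 :: real)"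
    proof (rule integral_dominated_convergence[where w = k])
      show "AE t in lborel. (\<lambda>n. k t - \<rho> n t) \<longlonglongrightarrow> 0"
      proof (intro AE_I2)
        fix t show "(\<lambda>n. k t - \<rho> n t) \<longlonglongrightarrow> 0"
          using tendsto_diff[OF tendsto_const[of "k t"] \<rho>_lim[of t]] by simp
      qed
    qed (use k \<rho> in auto)
    then show "e \<longlonglongrightarrow> 0" unfolding e_def by simp
  qed
  define X where "X t s = dil a (\<sigma> * t) f s" for t s
  define Y where "Y n t s = dil a (\<sigma> * grid n t) f s" for n t s
  define Z where "Z n t s = indicator (J n) t *\<^sub>R (X t s - Y n t s)" for n t s
  have X: "X t \<in> Lpos a" "mass a (X t) = m powr a" for t
    using dil_Lpos[OF f a0(2), of "\<sigma> * t"] m(2) by (simp_all add: X_def[abs_def])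
  have Y: "Y n t \<in> Lpos a" "mass a (Y n t) = m powr a" for n t
    using dil_Lpos[OF f a0(2), of "\<sigma> * grid n t"] m(2) by (simp_all add: Y_def[abs_def])
  have Z: "Z n t \<in> Lpos a" "mass a (Z n t) \<le> \<epsilon> n powr a" for n t
  proof -
    have XY: "(\<lambda>s. X t s - Y n t s) \<in> Lpos a" by (rule Lpos_diff(1)[OF a0(1) X(1) Y(1)])
    show "Z n t \<in> Lpos a" unfolding Z_def by (rule Lpos_scale(1)[OF XY])
    show "mass a (Z n t) \<le> \<epsilon> n powr a"
    proof (cases "t \<in> J n")
      case True
      define \<tau> where "\<tau> = \<sigma> * (t - grid n t)"
      have "\<bar>\<tau>\<bar> \<le> 1 * (1 / real (Suc n))"
        unfolding \<tau>_def abs_mult using True \<sigma> grid_approx[of t n] by (intro mult_mono) (auto simp: J_def)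
      then have le: "mass a (\<lambda>s. dil a \<tau> f s - f s) \<le> \<epsilon> n powr a" by (intro \<epsilon>(3)) simp
      \<comment> \<open>By the group law the dilation at the grid point factors out of X - Y. It is
        an isometry, so only the small dilation by \<tau> is left to estimate.\<close>
      have "X t = dil a (\<sigma> * grid n t) (dil a \<tau> f)"
        unfolding dil_dil by (simp add: X_def[abs_def] \<tau>_def algebra_simps)
      then have "Z n t = dil a (\<sigma> * grid n t) (\<lambda>s. dil a \<tau> f s - f s)"
        using True by (simp add: fun_eq_iff Z_def Y_def dil_def[of a "\<sigma> * grid n t"] scaleR_diff_right)
      then show ?thesis
        using dil_Lpos(2)[OF Lpos_diff(1)[OF a0(1) dil_Lpos(1)[OF f a0(2)] f] a0(2)] le by simp
    next
      case False
      then have "mass a (Z n t) = 0" by (simp add: Z_def mass_def)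
      then show ?thesis by simp
    qed
  qed
  define g where "g t = laplace (\<lambda>s. k t *\<^sub>R X t s)" for t
  define S where "S n t = laplace (\<lambda>s. \<rho> n t *\<^sub>R Y n t s)" for n t
  have gV: "g t \<in> ?V" for t unfolding g_def by (intro C(2) Lpos_scale X)
  have SV: "S n t \<in> ?V" for n t unfolding S_def by (intro C(2) Lpos_scale Y)
  \<comment> \<open>Off \<open>J n\<close> the factor \<rho> vanishes, so the indicator inside Z
    changes nothing there.\<close>
  have split: "k t *\<^sub>R X t s - \<rho> n t *\<^sub>R Y n t s = (k t - \<rho> n t) *\<^sub>R X t s + \<rho> n t *\<^sub>R Z n t s" for n t s
    using \<rho>(3)[of t n] by (auto simp: Z_def indicator_def algebra_simps)
  have N_bound: "?N (\<lambda>z. g t z - S n t z) \<le> C * (4 * ((k t - \<rho> n t) * m + k t * \<epsilon> n))"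
      "0 \<le> ?N (\<lambda>z. g t z - S n t z)" for n t
  proof -
    have A: "(\<lambda>s. (k t - \<rho> n t) *\<^sub>R X t s) \<in> Lpos a" "mass a (\<lambda>s. (k t - \<rho> n t) *\<^sub>R X t s) \<le> ((k t - \<rho> n t) * m) powr a"
      using Lpos_scale[OF X(1), of "k t - \<rho> n t" t] X(2)[of t] \<rho>(2)[of n t] m(1) by (auto simp: powr_mult)
    have B: "(\<lambda>s. \<rho> n t *\<^sub>R Z n t s) \<in> Lpos a" "mass a (\<lambda>s. \<rho> n t *\<^sub>R Z n t s) \<le> (k t * \<epsilon> n) powr a"
    proof -
      show "(\<lambda>s. \<rho> n t *\<^sub>R Z n t s) \<in> Lpos a" by (rule Lpos_scale[OF Z(1)])
      have "mass a (\<lambda>s. \<rho> n t *\<^sub>R Z n t s) = \<rho> n t powr a * mass a (Z n t)"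
        using Lpos_scale(2)[OF Z(1), of "\<rho> n t" n t] \<rho>(1)[of n t] by simp
      also have "\<dots> \<le> k t powr a * \<epsilon> n powr a"
        using \<rho>[where n = n and t = t] a0 Z(2) mass_nonneg by (intro mult_mono powr_mono2) auto
      finally show "mass a (\<lambda>s. \<rho> n t *\<^sub>R Z n t s) \<le> (k t * \<epsilon> n) powr a"
        using k(2)[of t] \<epsilon>(2)[of n] by (simp add: powr_mult)
    qed
    have D: "(\<lambda>z. g t z - S n t z) = laplace (\<lambda>s. (k t - \<rho> n t) *\<^sub>R X t s + \<rho> n t *\<^sub>R Z n t s)"
    proof
      fix z
      show "g t z - S n t z = laplace (\<lambda>s. (k t - \<rho> n t) *\<^sub>R X t s + \<rho> n t *\<^sub>R Z n t s) z"
        unfolding g_def S_def split[symmetric]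
        by (rule laplace_diff[OF a(1) Lpos_scale(1)[OF X(1)] Lpos_scale(1)[OF Y(1)], symmetric])
    qed
    have nn: "0 \<le> (k t - \<rho> n t) * m" "0 \<le> k t * \<epsilon> n" using \<rho>(2)[of n t] m k(2) \<epsilon>(2) by auto
    show "?N (\<lambda>z. g t z - S n t z) \<le> C * (4 * ((k t - \<rho> n t) * m + k t * \<epsilon> n))"
      unfolding D
      by (rule C(3)[OF Lpos_add(1)[OF a0(1) A(1) B(1)] _ mass_add_le[OF a(1) A(1) nn(1) A(2) B(1) nn(2) B(2)]]) (use nn in auto)
    show "0 \<le> ?N (\<lambda>z. g t z - S n t z)"
      unfolding D by (intro N_nonneg C(2) Lpos_add(1)[OF a0(1) A(1) B(1)])
  qed
  have N_lim: "(\<lambda>n. ?N (\<lambda>z. g t z - S n t z)) \<longlonglongrightarrow> 0" for t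
  proof (rule tendsto_sandwich[OF _ _ tendsto_const])
    have "(\<lambda>n. C * (4 * ((k t - \<rho> n t) * m + k t * \<epsilon> n))) \<longlonglongrightarrow> C * (4 * ((k t - k t) * m + k t * 0))"
      by (intro tendsto_intros \<rho>_lim \<epsilon>)
    then show "(\<lambda>n. C * (4 * ((k t - \<rho> n t) * m + k t * \<epsilon> n))) \<longlonglongrightarrow> 0" by simp
  qed (use N_bound in \<open>auto intro!: always_eventually\<close>)
  have err_lim: "(\<lambda>n. C * (4 * (e n * m + W * \<epsilon> n))) \<longlonglongrightarrow> 0"
  proof -
    have "(\<lambda>n. C * (4 * (e n * m + W * \<epsilon> n))) \<longlonglongrightarrow> C * (4 * (0 * m + W * 0))"
      by (intro tendsto_intros e(2) \<epsilon>)
    then show ?thesis by simp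
  qed
  have NN_lim: "(\<lambda>n. \<integral>\<^sup>+ t. ennreal (?N (\<lambda>z. g t z - S n t z)) \<partial>?M) \<longlonglongrightarrow> 0"
  proof (rule tendsto_sandwich[OF _ _ tendsto_const])
    show "(\<lambda>n. ennreal (C * (4 * (e n * m + W * \<epsilon> n)))) \<longlonglongrightarrow> 0"
      using tendsto_ennrealI[OF err_lim] by simp
    show "\<forall>\<^sub>F n in sequentially. (\<integral>\<^sup>+ t. ennreal (?N (\<lambda>z. g t z - S n t z)) \<partial>?M) \<le> ennreal (C * (4 * (e n * m + W * \<epsilon> n)))"
    proof (rule always_eventually, rule allI)
      fix n
      let ?b = "\<lambda>t. C * (4 * ((k t - \<rho> n t) * m + k t * \<epsilon> n))"
      have b0: "?b t \<ge> 0" for t using C(1) \<rho>(2)[of n t] m k(2) \<epsilon>(2) by auto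
      have int_b: "integrable lborel ?b" using k(1) \<rho>_int by auto
      have "(\<integral>\<^sup>+ t. ennreal (?N (\<lambda>z. g t z - S n t z)) \<partial>?M) \<le> (\<integral>\<^sup>+ t. ennreal (?b t) \<partial>?M)"
        using N_bound by (intro nn_integral_mono ennreal_leI) auto
      also have "\<dots> = (\<integral>\<^sup>+ t. ennreal (?b t) * indicator {0<..} t \<partial>lebesgue)"
        by (rule nn_integral_restrict_space) simp
      also have "\<dots> \<le> (\<integral>\<^sup>+ t. ennreal (?b t) \<partial>lebesgue)"
        by (intro nn_integral_mono) (auto simp: indicator_def)
      also have "\<dots> = (\<integral>\<^sup>+ t. ennreal (?b t) \<partial>lborel)" by (rule nn_integral_completion)
      also have "\<dots> = ennreal (LINT t|lborel. ?b t)"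
        using b0 by (intro nn_integral_eq_integral int_b) auto
      also have "(LINT t|lborel. ?b t) = C * (4 * (e n * m + W * \<epsilon> n))"
        unfolding e_def W_def using k(1) \<rho>_int[of n] by simp
      finally show "(\<integral>\<^sup>+ t. ennreal (?N (\<lambda>z. g t z - S n t z)) \<partial>?M) \<le> ennreal (C * (4 * (e n * m + W * \<epsilon> n)))" .
    qed
  qed simp
  \<comment> \<open>The approximant depends on t only through the pair (\<rho>_n(t), grid point),
    hence takes finitely many values among functions.\<close>
  have S_simple: "simple_function ?M (S n)" for n
    unfolding S_def Y_def
    by (intro simple_function_lebesgue_on simple_function_compose2[OF \<rho>_simple simple_function_grid,
          of "\<lambda>x \<theta>. laplace (\<lambda>s. x *\<^sub>R dil a (\<sigma> * \<theta>) f s)"]) auto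
  have S_zero: "S n t = (\<lambda>z. 0)" if "t \<notin> J n" for n t
    using \<rho>(3)[OF that] laplace_scale[OF Y(1), of 0] by (simp add: S_def fun_eq_iff)
  have S_int: "simple_integrable_in ?V ?M (S n)" for n
    unfolding simple_integrable_in_def
  proof (intro conjI S_simple)
    show "S n ` space ?M \<subseteq> ?V" using SV by auto
    have "emeasure ?M {t \<in> space ?M. S n t \<noteq> (\<lambda>z. 0)} \<le> emeasure ?M (J n)"
    proof (rule emeasure_mono)
      show "{t \<in> space ?M. S n t \<noteq> (\<lambda>z. 0)} \<subseteq> J n" using S_zero by auto
      show "J n \<in> sets ?M" by (auto simp: J_def sets_restrict_space)
    qed
    also have "\<dots> = emeasure lebesgue (J n)"
      by (rule emeasure_restrict_space) (auto simp: J_def)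
    also have "\<dots> < \<infinity>" by (simp add: J_def)
    finally show "emeasure ?M {t \<in> space ?M. S n t \<noteq> (\<lambda>z. 0)} \<noteq> \<infinity>" by simp
  qed
  \<comment> \<open>These integrate the two sides of \<open>split\<close> over t: H - K_n = A_n +
    B_n wherever all four integrals converge.\<close>
  define H where "H s = (LINT t|lborel. k t *\<^sub>R X t s)" for s
  define K where "K n s = (LINT t|lborel. \<rho> n t *\<^sub>R Y n t s)" for n s
  define A where "A n s = (LINT t|lborel. (k t - \<rho> n t) *\<^sub>R X t s)" for n s
  define B where "B n s = (LINT t|lborel. \<rho> n t *\<^sub>R Z n t s)" for n s
  have meas: "(\<lambda>p. X (fst p) (snd p)) \<in> borel_measurable (borel \<Otimes>\<^sub>M borel)"
      "(\<lambda>p. Y n (fst p) (snd p)) \<in> borel_measurable (borel \<Otimes>\<^sub>M borel)"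
      "(\<lambda>p. Z n (fst p) (snd p)) \<in> borel_measurable (borel \<Otimes>\<^sub>M borel)" for n
    unfolding X_def Y_def Z_def by measurable
  have kr_int: "integrable lborel (\<lambda>t. k t - \<rho> n t)" for n using k(1) \<rho>_int by auto
  note WH = Lpos_weighted_mean[OF a(1) k(1,2) order_refl meas(1), unfolded fst_conv snd_conv, OF X(1) eq_refl[OF X(2)], folded H_def W_def]
  have WK: "K n \<in> Lpos a" "AE s in lborel. integrable lborel (\<lambda>t. \<rho> n t *\<^sub>R Y n t s)"
      "Re z > 0 \<Longrightarrow> laplace (K n) z = (LINT t|lborel. \<rho> n t *\<^sub>R laplace (Y n t) z)" for n z
    by (rule Lpos_weighted_mean[OF a(1) \<rho>_int[of n] \<rho>(1)[of n] W(2)[of n] meas(2)[of n], unfolded fst_conv snd_conv,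
      OF Y(1) eq_refl[OF Y(2)], folded K_def]; assumption?)+
  have WA: "A n \<in> Lpos a" "mass a (A n) \<le> (e n * m) powr a"
      "AE s in lborel. integrable lborel (\<lambda>t. (k t - \<rho> n t) *\<^sub>R X t s)" for n
    using Lpos_weighted_mean[OF a(1) kr_int _ eq_refl[OF e_def[symmetric]] meas(1), unfolded fst_conv snd_conv, OF _ X(1) eq_refl[OF X(2)], folded A_def, of n]
      \<rho>(2) m(1) e(1) by (simp_all add: powr_mult)
  have WB: "B n \<in> Lpos a" "mass a (B n) \<le> (W * \<epsilon> n) powr a"
      "AE s in lborel. integrable lborel (\<lambda>t. \<rho> n t *\<^sub>R Z n t s)" for n
    using Lpos_weighted_mean[OF a(1) \<rho>_int[of n] \<rho>(1)[of n] W(2)[of n] meas(3)[of n], unfolded fst_conv snd_conv, OF Z, folded B_def]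
      W(1) \<epsilon>(2) by (simp_all add: powr_mult)
  \<comment> \<open>At a fixed z the finite sum is the ordinary integral of the scalar simple
    function S_n(t)(z); Fubini, in the form of the weighted mean, identifies it with the transform
    of K_n.\<close>
  have S_integral: "simple_integral_in ?M (S n) z = laplace (K n) z" for n z
  proof (cases "Re z > 0")
    case True
    have sb: "Bochner_Integration.simple_bochner_integrable ?M (\<lambda>t. S n t z)"
    proof (rule simple_bochner_integrable.intros)
      show sf: "simple_function ?M (\<lambda>t. S n t z)"
        by (rule simple_function_compose1[OF S_simple, of "\<lambda>F. F z"])
      have "emeasure ?M {t \<in> space ?M. S n t z \<noteq> 0} \<le> emeasure ?M {t \<in> space ?M. S n t \<noteq> (\<lambda>z. 0)}"
      proof (rule emeasure_mono)
        have "{t \<in> space ?M. S n t \<noteq> (\<lambda>z. 0)} = S n -` (- {\<lambda>z. 0}) \<inter> space ?M" by auto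
        then show "{t \<in> space ?M. S n t \<noteq> (\<lambda>z. 0)} \<in> sets ?M" using simple_functionD(2)[OF S_simple] by simp
      qed auto
      then show "emeasure ?M {t \<in> space ?M. S n t z \<noteq> 0} \<noteq> \<infinity>"
        using S_int[of n] by (auto simp: simple_integrable_in_def top_unique)
    qed
    have "simple_integral_in ?M (S n) z = Bochner_Integration.simple_bochner_integral ?M (\<lambda>t. S n t z)"
      unfolding simple_integral_in_def
      by (rule simple_bochner_integral_partition[OF sb S_simple, symmetric]) auto
    also have "\<dots> = integral\<^sup>L ?M (\<lambda>t. S n t z)" by (rule simple_bochner_integrable_eq_integral[OF sb])
    also have "\<dots> = (LINT t|lebesgue. indicator {0<..} t *\<^sub>R S n t z)"
      by (rule integral_restrict_space) simp
    also have "\<dots> = (LINT t|lebesgue. S n t z)"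
      using S_zero by (intro Bochner_Integration.integral_cong refl) (auto simp: indicator_def J_def)
    also have "\<dots> = (LINT t|lborel. S n t z)"
    proof (rule integral_completion)
      have "simple_function borel (\<lambda>t. S n t z)"
        unfolding S_def Y_def
        by (rule simple_function_compose2[OF \<rho>_simple simple_function_grid, of "\<lambda>x \<theta>. laplace (\<lambda>s. x *\<^sub>R dil a (\<sigma> * \<theta>) f s) z"])
      then show "(\<lambda>t. S n t z) \<in> borel_measurable lborel"
        by (simp add: borel_measurable_simple_function)
    qed
    also have "\<dots> = laplace (K n) z"
      using WK(3)[OF True, of n] by (simp add: S_def laplace_scale[OF Y(1)])
    finally show ?thesis .
  qed (auto simp: simple_integral_in_def laplace_outside S_def intro!: sum.neutral)
  have I_lim: "(\<lambda>n. ?N (\<lambda>z. laplace H z - simple_integral_in ?M (S n) z)) \<longlonglongrightarrow> 0"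
  proof (rule tendsto_sandwich[OF _ _ tendsto_const err_lim])
    have D: "(\<lambda>z. laplace H z - simple_integral_in ?M (S n) z) = laplace (\<lambda>s. H s - K n s)" for n
      using laplace_diff[OF a(1) WH(1) WK(1)] by (simp add: S_integral fun_eq_iff)
    have HK: "(\<lambda>s. H s - K n s) \<in> Lpos a" for n by (rule Lpos_diff(1)[OF a0(1) WH(1) WK(1)])
    show "\<forall>\<^sub>F n in sequentially. 0 \<le> ?N (\<lambda>z. laplace H z - simple_integral_in ?M (S n) z)"
      unfolding D by (intro always_eventually allI N_nonneg C(2) HK)
    show "\<forall>\<^sub>F n in sequentially. ?N (\<lambda>z. laplace H z - simple_integral_in ?M (S n) z) \<le> C * (4 * (e n * m + W * \<epsilon> n))"
    proof (rule always_eventually, rule allI)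
      fix n
      have nn: "0 \<le> e n * m" "0 \<le> W * \<epsilon> n" using e(1) m(1) W(1) \<epsilon>(2) by auto
      have AB: "(\<lambda>s. A n s + B n s) \<in> Lpos a" by (rule Lpos_add(1)[OF a0(1) WA(1) WB(1)])
      \<comment> \<open>The integrals defining H, K, A and B converge for almost every s only, which
        is enough because \<open>mass\<close> ignores null sets.\<close>
      have "AE s in lborel. H s - K n s = A n s + B n s"
        using WH(3) WK(2)[of n] WA(3)[of n] WB(3)[of n]
      proof eventually_elim
        case (elim s)
        then have "H s - K n s = (LINT t|lborel. k t *\<^sub>R X t s - \<rho> n t *\<^sub>R Y n t s)"
          by (simp add: H_def K_def)
        also have "\<dots> = A n s + B n s" unfolding split using elim by (simp add: A_def B_def)
        finally show ?case .
      qed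
      then have "mass a (\<lambda>s. H s - K n s) = mass a (\<lambda>s. A n s + B n s)"
        unfolding mass_def using Lpos_measurable[OF HK] Lpos_measurable[OF AB]
        by (intro integral_cong_AE) auto
      also have "\<dots> \<le> (4 * (e n * m + W * \<epsilon> n)) powr a"
        by (rule mass_add_le[OF a(1) WA(1) nn(1) WA(2) WB(1) nn(2) WB(2)])
      finally show "?N (\<lambda>z. laplace H z - simple_integral_in ?M (S n) z) \<le> C * (4 * (e n * m + W * \<epsilon> n))"
        unfolding D using nn by (intro C(3) HK) auto
    qed
  qed
  have "has_bochner_integral_in ?V ?N ?M g (laplace H)"
    unfolding has_bochner_integral_in_def
    using gV C(2)[OF WH(1)] S_int N_lim NN_lim I_lim by (intro conjI exI[of _ S]) auto
  then show ?thesis by (simp add: g_def[abs_def] H_def[abs_def] X_def)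
qed

section \<open>The Cesaro operators\<close>

text \<open>This is \<open>phi\<close> with c in place of 1/r, extended by 0 to t <= 0 so that
  integrals can be taken over the whole line.\<close>

definition cesaro_weight :: "real \<Rightarrow> real \<Rightarrow> real \<Rightarrow> real" where
  "cesaro_weight \<alpha> c t = indicator {0<..} t * (\<alpha> * (1 - exp (- t)) powr (\<alpha> - 1) * exp (- t * c))"

text \<open>The right-hand side adds up three bounds: 1 if \<alpha> >= 1; the value at t = 1 if
  \<alpha> < 1 and t >= 1; and for \<alpha> < 1 and t < 1 the power of t/2, since 1 - exp(-t) >= t/2
  there.\<close>

lemma one_minus_exp_powr_le:
  fixes \<alpha> t :: real
  assumes t: "t > 0"
  shows "(1 - exp (- t)) powr (\<alpha> - 1) \<le> 1 + (1 - exp (- 1)) powr (\<alpha> - 1) + (1 / 2) powr (\<alpha> - 1) * (t powr (\<alpha> - 1) * indicator {0..1} t)"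
proof -
  let ?y = "1 - exp (- t)"
  have y: "0 < ?y" "?y < 1" using t by auto
  have nn: "0 \<le> (1 - exp (- 1)) powr (\<alpha> - 1)" "0 \<le> (1 / 2) powr (\<alpha> - 1) * (t powr (\<alpha> - 1) * indicator {0..1} t)"
    by auto
  consider "\<alpha> \<ge> 1" | "\<alpha> < 1" "t \<ge> 1" | "\<alpha> < 1" "t < 1" by linarith
  then show ?thesis
  proof cases
    case 1
    then have "?y powr (\<alpha> - 1) \<le> 1" using y by (intro powr_le1) auto
    then show ?thesis using nn by linarith
  next
    case 2
    then have "?y powr (\<alpha> - 1) \<le> (1 - exp (- 1)) powr (\<alpha> - 1)" by (intro powr_mono2') auto
    then show ?thesis using nn by linarith
  next
    case 3
    have "exp (- t) \<le> 1 / (1 + t)"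
      using exp_ge_add_one_self[of t] t by (simp add: exp_minus field_simps)
    also have "\<dots> \<le> 1 - t / 2" using 3 t by (simp add: field_simps)
    finally have "1 / 2 * t \<le> ?y" by simp
    then have "?y powr (\<alpha> - 1) \<le> (1 / 2 * t) powr (\<alpha> - 1)" using 3 t by (intro powr_mono2') auto
    also have "\<dots> = (1 / 2) powr (\<alpha> - 1) * (t powr (\<alpha> - 1) * indicator {0..1} t)"
      using 3 t by (subst powr_mult) auto
    finally show ?thesis using nn by linarith
  qed
qed

text \<open>Positivity of \<alpha> makes t^(\<alpha>-1) integrable at 0; positivity of c provides
  the decay at infinity.\<close>

lemma cesaro_weight_integrable:
  assumes \<alpha>: "\<alpha> > 0" and c: "c > 0"
  shows "integrable lborel (cesaro_weight \<alpha> c)"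
proof -
  let ?D = "1 + (1 - exp (- 1)) powr (\<alpha> - 1)" and ?E = "(1 / 2) powr (\<alpha> - 1)"
  let ?b = "\<lambda>t. \<alpha> * (?D * (indicator {0..} t * exp (- c * t)) + ?E * (t powr (\<alpha> - 1) * indicator {0..1} t))"
  have p: "integrable lborel (\<lambda>t. t powr (\<alpha> - 1) * indicator {0..1} t)"
  proof (rule integrableI_bounded)
    have "(\<integral>\<^sup>+ t. ennreal (norm (t powr (\<alpha> - 1) * indicator {0..1} t)) \<partial>lborel) = (\<integral>\<^sup>+ t. ennreal (t powr (\<alpha> - 1)) * indicator {0..1} t \<partial>lborel)"
      by (intro nn_integral_cong) (auto simp: indicator_def)
    also have "\<dots> = ennreal (1 powr \<alpha> / \<alpha>)" using \<alpha> by (intro nn_integral_powr_atMost) auto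
    finally show "(\<integral>\<^sup>+ t. ennreal (norm (t powr (\<alpha> - 1) * indicator {0..1} t)) \<partial>lborel) < \<infinity>" by simp
  qed measurable
  have int: "integrable lborel ?b"
    using exp_decay_integrable[OF c] p by (intro integrable_mult_right Bochner_Integration.integrable_add)
  have le: "norm (cesaro_weight \<alpha> c t) \<le> ?b t" for t
  proof (cases "t > 0")
    case True
    have "(1 - exp (- t)) powr (\<alpha> - 1) * exp (- c * t) \<le> (?D + ?E * (t powr (\<alpha> - 1) * indicator {0..1} t)) * exp (- c * t)"
      using one_minus_exp_powr_le[OF True, of \<alpha>] by (intro mult_right_mono) auto
    also have "\<dots> \<le> ?D * exp (- c * t) + ?E * (t powr (\<alpha> - 1) * indicator {0..1} t) * 1"
      unfolding distrib_right[of ?D] using True c by (intro add_left_mono mult_left_mono) auto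
    finally have "\<alpha> * ((1 - exp (- t)) powr (\<alpha> - 1) * exp (- c * t)) \<le> \<alpha> * (?D * exp (- c * t) + ?E * (t powr (\<alpha> - 1) * indicator {0..1} t) * 1)"
      using \<alpha> by (intro mult_left_mono) auto
    then show ?thesis using True \<alpha> by (simp add: cesaro_weight_def abs_mult mult_ac)
  next
    case False
    then show ?thesis using \<alpha> by (simp add: cesaro_weight_def)
  qed
  show ?thesis
  proof (rule Bochner_Integration.integrable_bound[OF int])
    show "cesaro_weight \<alpha> c \<in> borel_measurable lborel" unfolding cesaro_weight_def[abs_def] by measurable
    show "AE t in lborel. norm (cesaro_weight \<alpha> c t) \<le> norm (?b t)"
      using le by (intro AE_I2) (rule order_trans[OF le], simp)
  qed
qed

section \<open>The real operators as means of dilations\<close>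

text \<open>The second property is tailored to the operators: for fixed s or z, the integrals in
  \<open>cesaro\<close>, \<open>cesaro_adj\<close> and \<open>laplace\<close> pair f with a Borel
  kernel E supported in the half-line. Even a divergent pairing is preserved, both integrals then
  being 0.\<close>

lemma Lp_representative:
  assumes f: "f \<in> Lp p" and p: "p \<noteq> \<infinity>"
  obtains f0 where "f0 \<in> Lpos (enn2real p)"
    "\<And>E. E \<in> borel_measurable borel \<Longrightarrow> (\<And>t. t \<le> 0 \<Longrightarrow> E t = 0) \<Longrightarrow>
      (LINT t|lebesgue. E t * f t) = (LINT t|lborel. E t * f0 t)"
proof -
  let ?a = "enn2real p"
  have fm: "f \<in> borel_measurable (lebesgue_on {0<..})" and fi: "integrable (lebesgue_on {0<..}) (\<lambda>t. norm (f t) powr ?a)"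
    using f p by (auto simp: Lp_def)
  define F where "F t = indicat_real {0<..} t *\<^sub>R f t" for t
  have Fm: "F \<in> borel_measurable lebesgue"
    using fm by (simp add: F_def[abs_def] borel_measurable_restrict_space_iff)
  obtain g where g [measurable]: "g \<in> borel_measurable borel" and Fg: "AE t in lborel. F t = g t"
  proof -
    have "(\<lambda>t. Re (F t)) \<in> borel_measurable lebesgue" "(\<lambda>t. Im (F t)) \<in> borel_measurable lebesgue"
      using Fm by measurable
    then obtain u v where uv: "u \<in> borel_measurable lborel" "AE t in lborel. Re (F t) = u t"
        "v \<in> borel_measurable lborel" "AE t in lborel. Im (F t) = v t"
      using completion_ex_borel_measurable_real by metis
    show thesis
    proof (rule that[of "\<lambda>t. Complex (u t) (v t)"])
      show "(\<lambda>t. Complex (u t) (v t)) \<in> borel_measurable borel"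
        unfolding borel_measurable_complex_iff using uv by simp
      show "AE t in lborel. F t = Complex (u t) (v t)"
        using uv(2,4) by eventually_elim (simp add: complex_eq_iff)
    qed
  qed
  define f0 where "f0 t = indicat_real {0<..} t *\<^sub>R g t" for t
  have [measurable]: "f0 \<in> borel_measurable borel" unfolding f0_def[abs_def] by measurable
  have ae: "AE t in lebesgue. F t = f0 t"
    using AE_completion[OF Fg] by eventually_elim (auto simp: F_def f0_def indicator_def split: if_splits)
  have "integrable lebesgue (\<lambda>t. indicat_real {0<..} t *\<^sub>R (norm (f t) powr ?a))"
    using fi by (simp add: integrable_restrict_space)
  then have "integrable lebesgue (\<lambda>t. norm (F t) powr ?a)"
    by (rule Bochner_Integration.integrable_cong[THEN iffD1, rotated 2]) (auto simp: F_def indicator_def)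
  then have "integrable lebesgue (\<lambda>t. norm (f0 t) powr ?a)"
  proof (rule integrable_cong_AE_imp)
    show "AE t in lebesgue. norm (F t) powr ?a = norm (f0 t) powr ?a" using ae by eventually_elim simp
  qed (simp add: measurable_completion)
  then have "integrable lborel (\<lambda>t. norm (f0 t) powr ?a)"
    by (subst (asm) integrable_completion) auto
  then have f0: "f0 \<in> Lpos ?a" by (auto simp: Lpos_def f0_def)
  show thesis
  proof (rule that[OF f0])
    fix E :: "real \<Rightarrow> complex" assume E [measurable]: "E \<in> borel_measurable borel" and E0: "\<And>t. t \<le> 0 \<Longrightarrow> E t = 0"
    have "(LINT t|lebesgue. E t * f t) = (LINT t|lebesgue. E t * F t)"
      using E0 by (intro Bochner_Integration.integral_cong) (auto simp: F_def indicator_def not_less)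
    also have "\<dots> = (LINT t|lebesgue. E t * f0 t)"
    proof (rule integral_cong_AE)
      have "E \<in> borel_measurable lebesgue" by (simp add: measurable_completion)
      then show "(\<lambda>t. E t * F t) \<in> borel_measurable lebesgue" using Fm by measurable
      show "(\<lambda>t. E t * f0 t) \<in> borel_measurable lebesgue" by (simp add: measurable_completion)
      show "AE t in lebesgue. E t * F t = E t * f0 t" using ae by eventually_elim simp
    qed
    also have "\<dots> = (LINT t|lborel. E t * f0 t)" by (rule integral_completion) simp
    finally show "(LINT t|lebesgue. E t * f t) = (LINT t|lborel. E t * f0 t)" .
  qed
qed

text \<open>Absolute integrability transfers through the substitution in both directions, so in the
  divergent case both sides are 0 by convention. That case matters, since a fractional integral of
  an L_p function may diverge at exceptional s.\<close>

lemma set_lebesgue_integral_substitution: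
  fixes F :: "real \<Rightarrow> complex" and g g' :: "real \<Rightarrow> real"
  assumes S: "S \<in> sets lebesgue" and g: "\<And>x. x \<in> S \<Longrightarrow> (g has_real_derivative g' x) (at x within S)"
    and inj: "inj_on g S"
  shows "(LINT u:g ` S|lebesgue. F u) = (LINT t:S|lebesgue. \<bar>g' t\<bar> *\<^sub>R F (g t))"
proof (cases "F absolutely_integrable_on g ` S")
  case True
  then have "(\<lambda>x. \<bar>g' x\<bar> *\<^sub>R F (g x)) absolutely_integrable_on S \<and> integral S (\<lambda>x. \<bar>g' x\<bar> *\<^sub>R F (g x)) = integral (g ` S) F"
    using has_absolute_integral_change_of_variables_real[OF S g inj, of F "integral (g ` S) F"] by simp
  then show ?thesis using True by (simp add: set_lebesgue_integral_eq_integral)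
next
  case False
  then have "\<not> (\<lambda>x. \<bar>g' x\<bar> *\<^sub>R F (g x)) absolutely_integrable_on S"
    using absolutely_integrable_change_of_variables_real[OF S g inj, of F] by simp
  then show ?thesis
    using False unfolding set_lebesgue_integral_def set_integrable_def
    by (metis not_integrable_integral_eq)
qed

lemma cesaro_adj_representative:
  assumes f0: "f0 \<in> Lpos a" and s: "s > 0" and a: "a \<ge> 1"
    and rep: "\<And>E. E \<in> borel_measurable borel \<Longrightarrow> (\<And>t. t \<le> 0 \<Longrightarrow> E t = 0) \<Longrightarrow>
      (LINT t|lebesgue. E t * f t) = (LINT t|lborel. E t * f0 t)"
  shows "cesaro_adj \<alpha> f s = (LINT t|lborel. cesaro_weight \<alpha> (1 / a) t *\<^sub>R dil a (1 * t) f0 s)"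
proof -
  have [measurable]: "f0 \<in> borel_measurable borel" using f0 by (rule Lpos_measurable)
  let ?w = "\<lambda>u. (u - s) powr (\<alpha> - 1) / u powr \<alpha>"
  let ?E = "\<lambda>u. complex_of_real (indicator {s<..} u * ?w u)"
  have "(LINT u:{s<..}|lebesgue. ?w u *\<^sub>R f u) = (LINT u|lebesgue. ?E u * f u)"
    by (simp add: set_lebesgue_integral_def scaleR_conv_of_real mult.assoc)
  also have "\<dots> = (LINT u|lborel. ?E u * f0 u)" by (rule rep) (use s in auto)
  also have "\<dots> = (LINT u|lebesgue. ?E u * f0 u)" by (rule integral_completion[symmetric]) simp
  also have "\<dots> = (LINT u:{s<..}|lebesgue. ?w u *\<^sub>R f0 u)"
    by (simp add: set_lebesgue_integral_def scaleR_conv_of_real mult.assoc)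
  also have "\<dots> = (LINT u:(\<lambda>t. s * exp t) ` {0<..}|lebesgue. ?w u *\<^sub>R f0 u)"
  proof (rule arg_cong[where f = "\<lambda>A. LINT u:A|lebesgue. ?w u *\<^sub>R f0 u"])
    show "{s<..} = (\<lambda>t. s * exp t) ` {0<..}"
    proof (intro equalityI subsetI)
      fix u assume "u \<in> {s<..}"
      then have "u = s * exp (ln (u / s))" "ln (u / s) \<in> {0<..}" using s by auto
      then show "u \<in> (\<lambda>t. s * exp t) ` {0<..}" by (rule image_eqI)
    qed (use s in auto)
  qed
  also have "(LINT u:(\<lambda>t. s * exp t) ` {0<..}|lebesgue. ?w u *\<^sub>R f0 u)
      = (LINT t:{0<..}|lebesgue. \<bar>s * exp t\<bar> *\<^sub>R (?w (s * exp t) *\<^sub>R f0 (s * exp t)))"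
    using s by (intro set_lebesgue_integral_substitution) (auto intro!: derivative_eq_intros inj_onI)
  also have "\<dots> = (LINT t:{0<..}|lebesgue. (1 - exp (- t)) powr (\<alpha> - 1) *\<^sub>R f0 (exp t * s))"
  proof (intro set_lebesgue_integral_cong allI impI)
    fix t :: real assume "t \<in> {0<..}"
    then have t: "t > 0" by simp
    \<comment> \<open>With u = s exp t the kernel times the Jacobian is u (u-s)^(\<alpha>-1) /
      u^\<alpha>, where all powers of u cancel and (1 - exp(-t))^(\<alpha>-1) remains.\<close>
    have "s * exp t - s = (s * exp t) * (1 - exp (- t))" by (simp add: algebra_simps flip: exp_add)
    then have "(s * exp t - s) powr (\<alpha> - 1) = (s * exp t) powr (\<alpha> - 1) * (1 - exp (- t)) powr (\<alpha> - 1)"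
      using s t by (simp add: powr_mult)
    moreover have "(s * exp t) powr (\<alpha> - 1) = (s * exp t) powr \<alpha> / (s * exp t)"
      using s by (simp add: powr_diff)
    ultimately have "\<bar>s * exp t\<bar> * ?w (s * exp t) = (1 - exp (- t)) powr (\<alpha> - 1)"
      using s by simp
    then show "\<bar>s * exp t\<bar> *\<^sub>R (?w (s * exp t) *\<^sub>R f0 (s * exp t)) = (1 - exp (- t)) powr (\<alpha> - 1) *\<^sub>R f0 (exp t * s)"
      by (simp only: scaleR_scaleR mult.commute[of s])
  qed simp
  also have "\<dots> = (LINT t|lborel. indicat_real {0<..} t *\<^sub>R ((1 - exp (- t)) powr (\<alpha> - 1) *\<^sub>R f0 (exp t * s)))"
    unfolding set_lebesgue_integral_def by (rule integral_completion) simp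
  finally have "cesaro_adj \<alpha> f s = (LINT t|lborel. \<alpha> *\<^sub>R (indicat_real {0<..} t *\<^sub>R ((1 - exp (- t)) powr (\<alpha> - 1) *\<^sub>R f0 (exp t * s))))"
    by (simp only: cesaro_adj_def integral_scaleR_right)
  also have "\<dots> = (LINT t|lborel. cesaro_weight \<alpha> (1 / a) t *\<^sub>R dil a (1 * t) f0 s)"
  proof (intro Bochner_Integration.integral_cong refl)
    fix t
    \<comment> \<open>The exponential in the weight exactly undoes the isometry factor of
      \<open>dil\<close>.\<close>
    have "exp (- t * (1 / a)) * exp (t / a) = 1" by (simp flip: exp_add)
    then have "cesaro_weight \<alpha> (1 / a) t * exp (t / a) = \<alpha> * (indicat_real {0<..} t * (1 - exp (- t)) powr (\<alpha> - 1))"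
      unfolding cesaro_weight_def by (simp only: mult.assoc mult_1_right) simp
    then show "\<alpha> *\<^sub>R (indicat_real {0<..} t *\<^sub>R ((1 - exp (- t)) powr (\<alpha> - 1) *\<^sub>R f0 (exp t * s))) = cesaro_weight \<alpha> (1 / a) t *\<^sub>R dil a (1 * t) f0 s"
      by (simp only: dil_def scaleR_scaleR mult_1_left)
  qed
  finally show ?thesis .
qed

lemma cesaro_representative:
  assumes f0: "f0 \<in> Lpos a" and s: "s > 0" and a: "a \<ge> 1"
    and rep: "\<And>E. E \<in> borel_measurable borel \<Longrightarrow> (\<And>t. t \<le> 0 \<Longrightarrow> E t = 0) \<Longrightarrow>
      (LINT t|lebesgue. E t * f t) = (LINT t|lborel. E t * f0 t)"
  shows "cesaro \<alpha> f s = (LINT t|lborel. cesaro_weight \<alpha> (1 - 1 / a) t *\<^sub>R dil a ((- 1) * t) f0 s)"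
proof -
  have [measurable]: "f0 \<in> borel_measurable borel" using f0 by (rule Lpos_measurable)
  let ?w = "\<lambda>u. (s - u) powr (\<alpha> - 1)"
  let ?E = "\<lambda>u. complex_of_real (indicator {0<..<s} u * ?w u)"
  have "(LINT u:{0<..<s}|lebesgue. ?w u *\<^sub>R f u) = (LINT u|lebesgue. ?E u * f u)"
    by (simp add: set_lebesgue_integral_def scaleR_conv_of_real mult.assoc)
  also have "\<dots> = (LINT u|lborel. ?E u * f0 u)" by (rule rep) auto
  also have "\<dots> = (LINT u|lebesgue. ?E u * f0 u)" by (rule integral_completion[symmetric]) simp
  also have "\<dots> = (LINT u:{0<..<s}|lebesgue. ?w u *\<^sub>R f0 u)"
    by (simp add: set_lebesgue_integral_def scaleR_conv_of_real mult.assoc)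
  also have "\<dots> = (LINT u:(\<lambda>t. s * exp (- t)) ` {0<..}|lebesgue. ?w u *\<^sub>R f0 u)"
  proof (rule arg_cong[where f = "\<lambda>A. LINT u:A|lebesgue. ?w u *\<^sub>R f0 u"])
    show "{0<..<s} = (\<lambda>t. s * exp (- t)) ` {0<..}"
    proof (intro equalityI subsetI)
      fix u assume "u \<in> {0<..<s}"
      then have "u = s * exp (- (- ln (u / s)))" "- ln (u / s) \<in> {0<..}" using s by auto
      then show "u \<in> (\<lambda>t. s * exp (- t)) ` {0<..}" by (rule image_eqI)
    qed (use s in auto)
  qed
  also have "(LINT u:(\<lambda>t. s * exp (- t)) ` {0<..}|lebesgue. ?w u *\<^sub>R f0 u)
      = (LINT t:{0<..}|lebesgue. \<bar>- (s * exp (- t))\<bar> *\<^sub>R (?w (s * exp (- t)) *\<^sub>R f0 (s * exp (- t))))"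
    using s by (intro set_lebesgue_integral_substitution) (auto intro!: derivative_eq_intros inj_onI)
  also have "\<dots> = (LINT t:{0<..}|lebesgue. (s powr \<alpha> * (exp (- t) * (1 - exp (- t)) powr (\<alpha> - 1))) *\<^sub>R f0 (exp (- t) * s))"
  proof (intro set_lebesgue_integral_cong allI impI)
    fix t :: real assume "t \<in> {0<..}"
    then have t: "t > 0" by simp
    have "s - s * exp (- t) = s * (1 - exp (- t))" by (simp add: algebra_simps)
    then have "?w (s * exp (- t)) = s powr (\<alpha> - 1) * (1 - exp (- t)) powr (\<alpha> - 1)"
      using s t by (simp add: powr_mult)
    moreover have "s powr \<alpha> = s powr (\<alpha> - 1) * s"
      using s by (simp add: powr_diff)
    ultimately have "\<bar>- (s * exp (- t))\<bar> * ?w (s * exp (- t)) = s powr \<alpha> * (exp (- t) * (1 - exp (- t)) powr (\<alpha> - 1))"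
      using s by simp
    then show "\<bar>- (s * exp (- t))\<bar> *\<^sub>R (?w (s * exp (- t)) *\<^sub>R f0 (s * exp (- t)))
        = (s powr \<alpha> * (exp (- t) * (1 - exp (- t)) powr (\<alpha> - 1))) *\<^sub>R f0 (exp (- t) * s)"
      by (simp only: scaleR_scaleR mult.commute[of s])
  qed simp
  also have "\<dots> = (LINT t|lborel. indicat_real {0<..} t *\<^sub>R ((s powr \<alpha> * (exp (- t) * (1 - exp (- t)) powr (\<alpha> - 1))) *\<^sub>R f0 (exp (- t) * s)))"
    unfolding set_lebesgue_integral_def by (rule integral_completion) simp
  finally have "cesaro \<alpha> f s = (LINT t|lborel. (\<alpha> / s powr \<alpha>) *\<^sub>R (indicat_real {0<..} t *\<^sub>R ((s powr \<alpha> * (exp (- t) * (1 - exp (- t)) powr (\<alpha> - 1))) *\<^sub>R f0 (exp (- t) * s))))"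
    by (simp only: cesaro_def integral_scaleR_right)
  also have "\<dots> = (LINT t|lborel. cesaro_weight \<alpha> (1 - 1 / a) t *\<^sub>R dil a ((- 1) * t) f0 s)"
  proof (intro Bochner_Integration.integral_cong refl)
    fix t
    \<comment> \<open>Here the conjugate exponent appears: weight factor and isometry factor
      multiply to the Jacobian factor exp(-t).\<close>
    have "exp (- t * (1 - 1 / a)) * exp (- 1 * t / a) = exp (- t)"
      by (simp only: exp_add[symmetric]) (simp add: algebra_simps)
    then have "cesaro_weight \<alpha> (1 - 1 / a) t * exp (- 1 * t / a) = \<alpha> * (indicat_real {0<..} t * (exp (- t) * (1 - exp (- t)) powr (\<alpha> - 1)))"
      unfolding cesaro_weight_def by (simp only: mult.assoc) simp
    also have "\<dots> = \<alpha> / s powr \<alpha> * (indicat_real {0<..} t * (s powr \<alpha> * (exp (- t) * (1 - exp (- t)) powr (\<alpha> - 1))))"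
      using s by simp
    finally show "(\<alpha> / s powr \<alpha>) *\<^sub>R (indicat_real {0<..} t *\<^sub>R ((s powr \<alpha> * (exp (- t) * (1 - exp (- t)) powr (\<alpha> - 1))) *\<^sub>R f0 (exp (- t) * s)))
        = cesaro_weight \<alpha> (1 - 1 / a) t *\<^sub>R dil a ((- 1) * t) f0 s"
      by (simp add: dil_def)
  qed
  finally show ?thesis .
qed

section \<open>Conjugate exponents and conclusion\<close>

text \<open>The representations of the Cesaro operators are available for s > 0 only.\<close>

lemma laplace_cong: "(\<And>s. s > 0 \<Longrightarrow> f s = g s) \<Longrightarrow> laplace f = laplace g"
  unfolding laplace_def by (intro ext if_cong refl set_lebesgue_integral_cong) auto

lemma laplace_representative:
  assumes f0: "f0 \<in> Lpos a"
    and rep: "\<And>E. E \<in> borel_measurable borel \<Longrightarrow> (\<And>t. t \<le> 0 \<Longrightarrow> E t = 0) \<Longrightarrow>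
      (LINT t|lebesgue. E t * f t) = (LINT t|lborel. E t * f0 t)"
  shows "laplace f = laplace f0"
proof (rule ext)
  fix z
  show "laplace f z = laplace f0 z"
  proof (cases "Re z > 0")
    case True
    let ?E = "\<lambda>t. complex_of_real (indicator {0<..} t) * exp (- z * complex_of_real t)"
    have "laplace f z = (LINT t|lebesgue. ?E t * f t)"
      using True by (simp add: laplace_def right_half_plane_def set_lebesgue_integral_def scaleR_conv_of_real mult_ac)
    also have "\<dots> = (LINT t|lborel. ?E t * f0 t)" by (rule rep) auto
    also have "\<dots> = laplace f0 z"
      unfolding laplace_eq_lborel[OF f0 True] using Lpos_zero[OF f0]
      by (intro Bochner_Integration.integral_cong refl) (auto simp: indicator_def not_less)
    finally show ?thesis .
  qed (simp add: laplace_outside)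
qed

text \<open>Needed because \<open>cesaro_weight\<close> and \<open>phi\<close> agree for t > 0
  only.\<close>

lemma has_bochner_integral_in_cong:
  assumes "\<And>t. t \<in> space M \<Longrightarrow> g t = h t" "has_bochner_integral_in V N M g I"
  shows "has_bochner_integral_in V N M h I"
proof -
  have 1: "h ` space M = g ` space M" using assms(1) by auto
  have 2: "(AE t in M. (\<lambda>n. N (\<lambda>z. h t z - s n t z)) \<longlonglongrightarrow> 0) \<longleftrightarrow> (AE t in M. (\<lambda>n. N (\<lambda>z. g t z - s n t z)) \<longlonglongrightarrow> 0)"
    for s :: "nat \<Rightarrow> 'a \<Rightarrow> 'b \<Rightarrow> 'c"
    by (rule AE_cong) (simp add: assms(1))
  have 3: "(\<integral>\<^sup>+ t. ennreal (N (\<lambda>z. h t z - s t z)) \<partial>M) = (\<integral>\<^sup>+ t. ennreal (N (\<lambda>z. g t z - s t z)) \<partial>M)"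
    for s :: "'a \<Rightarrow> 'b \<Rightarrow> 'c"
    by (rule nn_integral_cong) (simp add: assms(1))
  show ?thesis using assms(2) unfolding has_bochner_integral_in_def 1 2 3 .
qed

text \<open>In \<open>ennreal\<close> one has 1/0 = top and 1/top = 0. Hence q = 0 is excluded by
  the equation, and q = top corresponds to a = 1.\<close>

lemma conjugate_exponent:
  assumes a: "a \<ge> 1" and pq: "1 / ennreal a + 1 / q = 1"
  shows "q = conj_exp a" "enn2real (1 / q) = 1 - 1 / a"
proof -
  have p: "1 / ennreal a = ennreal (1 / a)"
    using a divide_ennreal[of 1 a] by simp
  have "q = conj_exp a \<and> enn2real (1 / q) = 1 - 1 / a"
  proof (cases q)
    case (real r)
    have r: "r > 0"
    proof (rule ccontr)
      assume "\<not> r > 0"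
      then have "1 / q = top" using real by simp
      then show False using pq by simp
    qed
    then have q: "1 / q = ennreal (1 / r)" using real divide_ennreal[of 1 r] by simp
    have "ennreal (1 / a + 1 / r) = ennreal 1"
      using pq a r unfolding p q by (simp add: ennreal_plus)
    then have *: "1 / a + 1 / r = 1" using a r by (subst (asm) ennreal_inj) auto
    then have "a \<noteq> 1" using r by auto
    moreover have "r = a / (a - 1)"
      using * a r \<open>a \<noteq> 1\<close> by (simp add: field_simps)
    moreover have "enn2real (1 / q) = 1 / r" using q r by simp
    ultimately show ?thesis using real * by (auto simp: conj_exp_def)
  next
    case top
    then have "ennreal (1 / a) = ennreal 1" using pq unfolding p by simp
    then have "a = 1" using a by (subst (asm) ennreal_inj) auto
    then show ?thesis using top by (simp add: conj_exp_def)
  qed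
  then show "q = conj_exp a" "enn2real (1 / q) = 1 - 1 / a" by auto
qed

text \<open>Covers both claims: \<sigma> = 1 for the adjoint real operator and \<sigma> = -1 for the
  other one. The exponent r enters through the weight alone, b through the space. The description
  operator is resolved by existence from \<open>laplace_dil_bochner\<close> and uniqueness in the
  Hardy space.\<close>

lemma laplace_intertwines:
  assumes \<alpha>: "\<alpha> > 0" and a: "1 \<le> a" "a \<le> 2" and c: "enn2real (1 / r) > 0"
    and b: "b = conj_exp a" "enn2real (1 / b) = 1 - 1 / a" and \<sigma>: "\<bar>\<sigma>\<bar> \<le> 1" and f0: "f0 \<in> Lpos a"
  shows "bochner_integral_in (hardy_space b) (hardy_norm b) (lebesgue_on {0<..})
      (\<lambda>t z. phi \<alpha> r t *\<^sub>R dilation b (\<sigma> * t) (laplace f0) z)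
    = laplace (\<lambda>s. LINT t|lborel. cesaro_weight \<alpha> (enn2real (1 / r)) t *\<^sub>R dil a (\<sigma> * t) f0 s)"
  unfolding bochner_integral_in_def
proof (rule the_equality)
  let ?k = "cesaro_weight \<alpha> (enn2real (1 / r))"
  have "has_bochner_integral_in (hardy_space b) (hardy_norm b) (lebesgue_on {0<..})
    (\<lambda>t. laplace (\<lambda>s. ?k t *\<^sub>R dil a (\<sigma> * t) f0 s)) (laplace (\<lambda>s. LINT t|lborel. ?k t *\<^sub>R dil a (\<sigma> * t) f0 s))"
    unfolding b(1)
    by (rule laplace_dil_bochner[OF a f0 cesaro_weight_integrable[OF \<alpha> c] _ _ \<sigma>]) (use \<alpha> in \<open>auto simp: cesaro_weight_def\<close>)
  then show I: "has_bochner_integral_in (hardy_space b) (hardy_norm b) (lebesgue_on {0<..})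
    (\<lambda>t z. phi \<alpha> r t *\<^sub>R dilation b (\<sigma> * t) (laplace f0) z) (laplace (\<lambda>s. LINT t|lborel. ?k t *\<^sub>R dil a (\<sigma> * t) f0 s))"
  proof (rule has_bochner_integral_in_cong[rotated])
    fix t :: real assume "t \<in> space (lebesgue_on {0<..})"
    then have "?k t = phi \<alpha> r t" by (simp add: cesaro_weight_def phi_def)
    moreover have "laplace (\<lambda>s. ?k t *\<^sub>R dil a (\<sigma> * t) f0 s) z = ?k t *\<^sub>R laplace (dil a (\<sigma> * t) f0) z" for z
      by (rule laplace_scale[OF dil_Lpos(1)[OF f0]]) (use a in auto)
    ultimately show "laplace (\<lambda>s. ?k t *\<^sub>R dil a (\<sigma> * t) f0 s) = (\<lambda>z. phi \<alpha> r t *\<^sub>R dilation b (\<sigma> * t) (laplace f0) z)"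
      unfolding laplace_dil[OF f0 a(1) b(2)] by auto
  qed
  show "J = laplace (\<lambda>s. LINT t|lborel. ?k t *\<^sub>R dil a (\<sigma> * t) f0 s)"
    if "has_bochner_integral_in (hardy_space b) (hardy_norm b) (lebesgue_on {0<..})
      (\<lambda>t z. phi \<alpha> r t *\<^sub>R dilation b (\<sigma> * t) (laplace f0) z) J" for J
    using has_bochner_integral_hardy_unique[OF conj_exp_cases[OF a(1), folded b(1)] that I] .
qed

theorem corollary2p6:
  fixes \<alpha> :: real
  assumes "\<alpha> > 0"
  shows "(\<forall>p q :: ennreal. 1 \<le> p \<and> p \<le> 2 \<and> 1 / p + 1 / q = 1 \<longrightarrow>
            (\<forall>f\<in>Lp p. laplace (cesaro_adj \<alpha> f) = cesaro_hardy \<alpha> p q (laplace f)))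
       \<and> (\<forall>p q :: ennreal. 1 < q \<and> q \<le> 2 \<and> 1 / p + 1 / q = 1 \<longrightarrow>
            (\<forall>f\<in>Lp q. laplace (cesaro \<alpha> f) = cesaro_hardy_adj \<alpha> p (laplace f)))"
proof (intro conjI allI impI ballI)
  fix p q :: ennreal and f
  assume pq: "1 \<le> p \<and> p \<le> 2 \<and> 1 / p + 1 / q = 1" and f: "f \<in> Lp p"
  obtain a where a: "p = ennreal a" "1 \<le> a" "a \<le> 2"
    using pq by (cases p) (auto simp: top_unique ennreal_numeral[symmetric] simp del: ennreal_numeral)
  obtain f0 where f0: "f0 \<in> Lpos a"
    and rep: "\<And>E. E \<in> borel_measurable borel \<Longrightarrow> (\<And>t. t \<le> 0 \<Longrightarrow> E t = 0) \<Longrightarrow>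
      (LINT t|lebesgue. E t * f t) = (LINT t|lborel. E t * f0 t)"
    using Lp_representative[OF f] a by auto
  have q: "q = conj_exp a" "enn2real (1 / q) = 1 - 1 / a"
    using conjugate_exponent[OF a(2)] pq a by auto
  have p: "enn2real (1 / p) = 1 / a" using a divide_ennreal[of 1 a] by simp
  have "laplace (cesaro_adj \<alpha> f) = laplace (\<lambda>s. LINT t|lborel. cesaro_weight \<alpha> (enn2real (1 / p)) t *\<^sub>R dil a (1 * t) f0 s)"
    unfolding p by (rule laplace_cong) (rule cesaro_adj_representative[OF f0 _ a(2) rep])
  also have "\<dots> = cesaro_hardy \<alpha> p q (laplace f0)"
    unfolding cesaro_hardy_def
    by (subst laplace_intertwines[OF assms a(2,3) _ q _ f0, symmetric]) (use a p in auto)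
  finally show "laplace (cesaro_adj \<alpha> f) = cesaro_hardy \<alpha> p q (laplace f)"
    by (simp only: laplace_representative[OF f0 rep])
next
  fix p q :: ennreal and f
  assume pq: "1 < q \<and> q \<le> 2 \<and> 1 / p + 1 / q = 1" and f: "f \<in> Lp q"
  obtain a where a: "q = ennreal a" "1 < a" "a \<le> 2"
    using pq by (cases q) (auto simp: top_unique ennreal_numeral[symmetric] simp del: ennreal_numeral)
  then have a1: "1 \<le> a" by simp
  obtain f0 where f0: "f0 \<in> Lpos a"
    and rep: "\<And>E. E \<in> borel_measurable borel \<Longrightarrow> (\<And>t. t \<le> 0 \<Longrightarrow> E t = 0) \<Longrightarrow>
      (LINT t|lebesgue. E t * f t) = (LINT t|lborel. E t * f0 t)"
    using Lp_representative[OF f] a by auto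
  have p: "p = conj_exp a" "enn2real (1 / p) = 1 - 1 / a"
    using conjugate_exponent[OF a1, of p] pq a by (auto simp: add.commute)
  have "laplace (cesaro \<alpha> f) = laplace (\<lambda>s. LINT t|lborel. cesaro_weight \<alpha> (enn2real (1 / p)) t *\<^sub>R dil a ((- 1) * t) f0 s)"
    unfolding p(2) by (rule laplace_cong) (rule cesaro_representative[OF f0 _ a1 rep])
  \<comment> \<open>Positivity of 1/p = 1 - 1/q is required here and rests on q > 1.\<close>
  also have "\<dots> = cesaro_hardy_adj \<alpha> p (laplace f0)"
    unfolding cesaro_hardy_adj_def
    by (subst laplace_intertwines[OF assms a1 a(3) _ p _ f0, symmetric]) (use a p in auto)
  finally show "laplace (cesaro \<alpha> f) = cesaro_hardy_adj \<alpha> p (laplace f)"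
    by (simp only: laplace_representative[OF f0 rep])
qed

end
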